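(* Let $G$ be a finite group and let $k$ be a field. The following are equivalent. 1. $G$ is an $\mathrm{NV}_k$-group. 2. The evaluation functor $ev_G:\mathcal{F}_{G,k}\to kB(G,G)\text{-}\mathrm{Mod}$, $F\mapsto F(G)$, is an equivalence of categories.
   Context: For finite groups $G,H$, a $G$-$H$-biset is a finite set with commuting left $G$-action and right $H$-action. $B(G,H)$ is the Grothendieck group (for disjoint union) of finite $G$-$H$-bisets and $kB(G,H)=k\otimes_{\mathbb Z}B(G,H)$. For a $G$-$H$-biset $U$ and an $H$-$K$-biset $W$, $U\times_H W$ is the quotient of $U\times W$ by the relation $(uh,w)\sim(u,hw)$; this extends to a bilinear map $kB(G,H)\times kB(H,K)\to kB(G,K)$. The biset category $k\mathcal C$ has the finite groups as objects, $\mathrm{Hom}_{k\mathcal C}(G,H)=kB(H,G)$, composition $\times_H$, and the identity of $G$ is the class of the biset $G$. The algebra $kB(G,G)$ is the double Burnside algebra of $G$. A subquotient of $G$ is a group $B/A$ with $A\trianglelefteq B\leqslant G$. $\mathcal F_{G,k}$ is the category of $k$-linear functors from the full subcategory of $k\mathcal C$ on all groups isomorphic to subquotients of $G$ to $k\text{-}\mathrm{Mod}$. If $F$ is such a functor, $F(G)$ is naturally a $kB(G,G)$-module. The group $G$ is called non-vanishing over $k$ (an $\mathrm{NV}_k$-group) if $S(G)\neq 0$ for every simple object $S$ of $\mathcal F_{G,k}$. *)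

theory Defs
  imports "HOL-Algebra.Free_Abelian_Groups" "HOL-Algebra.Module" "HOL-Library.Equipollence"
begin

section \<open>Categories, functors, equivalences\<close>

text \<open>Hom-sets are indexed by their ends and need not be disjoint.  The term
  \<open>cmp C X Y Z g f\<close> is the composite of \<open>f : X \<rightarrow> Y\<close> followed by \<open>g : Y \<rightarrow> Z\<close>.\<close>

record ('o, 'a) category =
  obj :: "'o set"
  arr :: "'o \<Rightarrow> 'o \<Rightarrow> 'a set"
  cmp :: "'o \<Rightarrow> 'o \<Rightarrow> 'o \<Rightarrow> 'a \<Rightarrow> 'a \<Rightarrow> 'a"
  idt :: "'o \<Rightarrow> 'a"

record ('o, 'a, 'p, 'b) cat_functor =
  fobj :: "'o \<Rightarrow> 'p"
  farr :: "'o \<Rightarrow> 'o \<Rightarrow> 'a \<Rightarrow> 'b"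

definition full_subcategory :: "('o, 'a) category \<Rightarrow> ('o \<Rightarrow> bool) \<Rightarrow> ('o, 'a) category" where
  "full_subcategory C P = C\<lparr>obj := {X \<in> obj C. P X}\<rparr>"

definition is_functor ::
  "('o, 'a) category \<Rightarrow> ('p, 'b) category \<Rightarrow> ('o, 'a, 'p, 'b) cat_functor \<Rightarrow> bool" where
  "is_functor C D F \<longleftrightarrow>
     (\<forall>X \<in> obj C. fobj F X \<in> obj D) \<and>
     (\<forall>X \<in> obj C. \<forall>Y \<in> obj C. \<forall>f \<in> arr C X Y. farr F X Y f \<in> arr D (fobj F X) (fobj F Y)) \<and>
     (\<forall>X \<in> obj C. farr F X X (idt C X) = idt D (fobj F X)) \<and>
     (\<forall>X \<in> obj C. \<forall>Y \<in> obj C. \<forall>Z \<in> obj C. \<forall>f \<in> arr C X Y. \<forall>g \<in> arr C Y Z.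
        farr F X Z (cmp C X Y Z g f) =
        cmp D (fobj F X) (fobj F Y) (fobj F Z) (farr F Y Z g) (farr F X Y f))"

definition id_functor :: "('o, 'a, 'o, 'a) cat_functor" where
  "id_functor = \<lparr>fobj = (\<lambda>X. X), farr = (\<lambda>X Y f. f)\<rparr>"

definition comp_functor ::
  "('p, 'b, 'q, 'c) cat_functor \<Rightarrow> ('o, 'a, 'p, 'b) cat_functor \<Rightarrow> ('o, 'a, 'q, 'c) cat_functor" where
  "comp_functor F E = \<lparr>fobj = (\<lambda>X. fobj F (fobj E X)),
     farr = (\<lambda>X Y f. farr F (fobj E X) (fobj E Y) (farr E X Y f))\<rparr>"

definition nat_trans ::
  "('o, 'a) category \<Rightarrow> ('p, 'b) category \<Rightarrow> ('o, 'a, 'p, 'b) cat_functor \<Rightarrow>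
   ('o, 'a, 'p, 'b) cat_functor \<Rightarrow> ('o \<Rightarrow> 'b) \<Rightarrow> bool" where
  "nat_trans C D F F' \<eta> \<longleftrightarrow>
     (\<forall>X \<in> obj C. \<eta> X \<in> arr D (fobj F X) (fobj F' X)) \<and>
     (\<forall>X \<in> obj C. \<forall>Y \<in> obj C. \<forall>f \<in> arr C X Y.
        cmp D (fobj F X) (fobj F Y) (fobj F' Y) (\<eta> Y) (farr F X Y f) =
        cmp D (fobj F X) (fobj F' X) (fobj F' Y) (farr F' X Y f) (\<eta> X))"

definition iso_arr :: "('o, 'a) category \<Rightarrow> 'o \<Rightarrow> 'o \<Rightarrow> 'a \<Rightarrow> bool" where
  "iso_arr C X Y f \<longleftrightarrow> f \<in> arr C X Y \<and>
     (\<exists>g \<in> arr C Y X. cmp C X Y X g f = idt C X \<and> cmp C Y X Y f g = idt C Y)"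

definition naturally_isomorphic ::
  "('o, 'a) category \<Rightarrow> ('p, 'b) category \<Rightarrow> ('o, 'a, 'p, 'b) cat_functor \<Rightarrow>
   ('o, 'a, 'p, 'b) cat_functor \<Rightarrow> bool" where
  "naturally_isomorphic C D F F' \<longleftrightarrow>
     (\<exists>\<eta>. nat_trans C D F F' \<eta> \<and> (\<forall>X \<in> obj C. iso_arr D (fobj F X) (fobj F' X) (\<eta> X)))"

definition equivalence_of_categories ::
  "('o, 'a) category \<Rightarrow> ('p, 'b) category \<Rightarrow> ('o, 'a, 'p, 'b) cat_functor \<Rightarrow> bool" where
  "equivalence_of_categories C D F \<longleftrightarrow> is_functor C D F \<and>
     (\<exists>E. is_functor D C E \<and>
          naturally_isomorphic C C id_functor (comp_functor E F) \<and>
          naturally_isomorphic D D (comp_functor F E) id_functor)"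

text \<open>Natural transformations are made extensional on the objects of \<open>C\<close>, so that equality of
  arrows is equality of components.\<close>

definition functor_category ::
  "('o, 'a) category \<Rightarrow> ('p, 'b) category \<Rightarrow> (('o, 'a, 'p, 'b) cat_functor, 'o \<Rightarrow> 'b) category" where
  "functor_category C D =
     \<lparr>obj = {F. is_functor C D F},
      arr = (\<lambda>F F'. {\<eta> \<in> extensional (obj C). nat_trans C D F F' \<eta>}),
      cmp = (\<lambda>F F' F'' \<theta> \<eta>. \<lambda>X \<in> obj C. cmp D (fobj F X) (fobj F' X) (fobj F'' X) (\<theta> X) (\<eta> X)),
      idt = (\<lambda>F. \<lambda>X \<in> obj C. idt D (fobj F X))\<rparr>"


section \<open>Left modules over a not necessarily commutative ring\<close>

text \<open>The library locale \<^locale>\<open>module\<close> is restricted to commutative rings.\<close>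

locale left_module = R?: ring R + M?: abelian_group M for R (structure) and M (structure) +
  assumes smult_closed:
      "\<lbrakk>a \<in> carrier R; x \<in> carrier M\<rbrakk> \<Longrightarrow> a \<odot>\<^bsub>M\<^esub> x \<in> carrier M"
    and smult_l_distr:
      "\<lbrakk>a \<in> carrier R; b \<in> carrier R; x \<in> carrier M\<rbrakk> \<Longrightarrow>
       (a \<oplus>\<^bsub>R\<^esub> b) \<odot>\<^bsub>M\<^esub> x = a \<odot>\<^bsub>M\<^esub> x \<oplus>\<^bsub>M\<^esub> b \<odot>\<^bsub>M\<^esub> x"
    and smult_r_distr:
      "\<lbrakk>a \<in> carrier R; x \<in> carrier M; y \<in> carrier M\<rbrakk> \<Longrightarrow>
       a \<odot>\<^bsub>M\<^esub> (x \<oplus>\<^bsub>M\<^esub> y) = a \<odot>\<^bsub>M\<^esub> x \<oplus>\<^bsub>M\<^esub> a \<odot>\<^bsub>M\<^esub> y"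
    and smult_assoc:
      "\<lbrakk>a \<in> carrier R; b \<in> carrier R; x \<in> carrier M\<rbrakk> \<Longrightarrow>
       (a \<otimes>\<^bsub>R\<^esub> b) \<odot>\<^bsub>M\<^esub> x = a \<odot>\<^bsub>M\<^esub> (b \<odot>\<^bsub>M\<^esub> x)"
    and smult_one: "x \<in> carrier M \<Longrightarrow> \<one>\<^bsub>R\<^esub> \<odot>\<^bsub>M\<^esub> x = x"

lemma left_module_iff_module: "cring R \<Longrightarrow> left_module R M \<longleftrightarrow> module R M"
  unfolding left_module_def left_module_axioms_def module_def module_axioms_def
  by (auto simp: cring_def)

definition linear_maps :: "('r, 'x) ring_scheme \<Rightarrow> ('r, 'm) module \<Rightarrow> ('r, 'm) module \<Rightarrow> ('m \<Rightarrow> 'm) set"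
  where
  "linear_maps R M N = {f \<in> carrier M \<rightarrow>\<^sub>E carrier N.
     (\<forall>x \<in> carrier M. \<forall>y \<in> carrier M. f (x \<oplus>\<^bsub>M\<^esub> y) = f x \<oplus>\<^bsub>N\<^esub> f y) \<and>
     (\<forall>a \<in> carrier R. \<forall>x \<in> carrier M. f (a \<odot>\<^bsub>M\<^esub> x) = a \<odot>\<^bsub>N\<^esub> f x)}"

text \<open>\<open>R\<close>-Mod, with the type \<open>'m\<close> as universe for the underlying sets.\<close>

definition module_category ::
  "('r, 'x) ring_scheme \<Rightarrow> 'm itself \<Rightarrow> (('r, 'm) module, 'm \<Rightarrow> 'm) category" where
  "module_category R _ =
     \<lparr>obj = {M. left_module R M},
      arr = linear_maps R,
      cmp = (\<lambda>M N P g f. compose (carrier M) g f),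
      idt = (\<lambda>M. \<lambda>x \<in> carrier M. x)\<rparr>"


section \<open>Finite bisets\<close>

record ('g, 'h, 'u) biset =
  points :: "'u set"
  lact :: "'g \<Rightarrow> 'u \<Rightarrow> 'u"
  ract :: "'u \<Rightarrow> 'h \<Rightarrow> 'u"

definition finite_biset :: "'g monoid \<Rightarrow> 'h monoid \<Rightarrow> ('g, 'h, 'u) biset \<Rightarrow> bool" where
  "finite_biset G H U \<longleftrightarrow>
     finite (points U) \<and>
     (\<forall>g \<in> carrier G. \<forall>u \<in> points U. lact U g u \<in> points U) \<and>
     (\<forall>u \<in> points U. lact U \<one>\<^bsub>G\<^esub> u = u) \<and>
     (\<forall>g \<in> carrier G. \<forall>g' \<in> carrier G. \<forall>u \<in> points U.
        lact U (g \<otimes>\<^bsub>G\<^esub> g') u = lact U g (lact U g' u)) \<and>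
     (\<forall>h \<in> carrier H. \<forall>u \<in> points U. ract U u h \<in> points U) \<and>
     (\<forall>u \<in> points U. ract U u \<one>\<^bsub>H\<^esub> = u) \<and>
     (\<forall>h \<in> carrier H. \<forall>h' \<in> carrier H. \<forall>u \<in> points U.
        ract U u (h \<otimes>\<^bsub>H\<^esub> h') = ract U (ract U u h) h') \<and>
     (\<forall>g \<in> carrier G. \<forall>h \<in> carrier H. \<forall>u \<in> points U.
        ract U (lact U g u) h = lact U g (ract U u h))"

definition biset_isomorphic ::
  "'g monoid \<Rightarrow> 'h monoid \<Rightarrow> ('g, 'h, 'u) biset \<Rightarrow> ('g, 'h, 'v) biset \<Rightarrow> bool" where
  "biset_isomorphic G H U V \<longleftrightarrow> (\<exists>\<phi>. bij_betw \<phi> (points U) (points V) \<and>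
     (\<forall>g \<in> carrier G. \<forall>u \<in> points U. \<phi> (lact U g u) = lact V g (\<phi> u)) \<and>
     (\<forall>h \<in> carrier H. \<forall>u \<in> points U. \<phi> (ract U u h) = ract V (\<phi> u) h))"

text \<open>Every finite biset has an isomorphic copy whose points are natural numbers; the isomorphism
  class of a biset (over any type) is represented by the set of all such copies.\<close>

type_synonym ('g, 'h) biset_iso_class = "('g, 'h, nat) biset set"

definition iso_class ::
  "'g monoid \<Rightarrow> 'h monoid \<Rightarrow> ('g, 'h, 'u) biset \<Rightarrow> ('g, 'h) biset_iso_class" where
  "iso_class G H U = {X. finite_biset G H X \<and> biset_isomorphic G H U X}"

definition iso_classes :: "'g monoid \<Rightarrow> 'h monoid \<Rightarrow> ('g, 'h) biset_iso_class set" where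
  "iso_classes G H = {iso_class G H U | U :: ('g, 'h, nat) biset. finite_biset G H U}"

definition biset_union ::
  "('g, 'h, 'u) biset \<Rightarrow> ('g, 'h, 'v) biset \<Rightarrow> ('g, 'h, 'u + 'v) biset" where
  "biset_union U V =
     \<lparr>points = points U <+> points V,
      lact = (\<lambda>g. map_sum (lact U g) (lact V g)),
      ract = (\<lambda>x h. map_sum (\<lambda>u. ract U u h) (\<lambda>v. ract V v h) x)\<rparr>"

text \<open>The relation \<open>(uh, w) \<sim> (u, hw)\<close> on \<open>U \<times> W\<close> is already an equivalence
  relation, its classes being the orbits of \<open>h (u, w) = (u h\<inverse>, h w)\<close>.\<close>

definition balance_rel ::
  "'h monoid \<Rightarrow> ('g, 'h, 'u) biset \<Rightarrow> ('h, 'k, 'w) biset \<Rightarrow> (('u \<times> 'w) \<times> ('u \<times> 'w)) set" where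
  "balance_rel H U W =
     {((ract U u h, w), (u, lact W h w)) | u h w. u \<in> points U \<and> h \<in> carrier H \<and> w \<in> points W}"

definition biset_prod ::
  "'h monoid \<Rightarrow> ('g, 'h, 'u) biset \<Rightarrow> ('h, 'k, 'w) biset \<Rightarrow> ('g, 'k, ('u \<times> 'w) set) biset" where
  "biset_prod H U W =
     \<lparr>points = (points U \<times> points W) // balance_rel H U W,
      lact = (\<lambda>g X. (\<lambda>(u, w). (lact U g u, w)) ` X),
      ract = (\<lambda>X l. (\<lambda>(u, w). (u, ract W w l)) ` X)\<rparr>"

definition id_biset :: "'g monoid \<Rightarrow> ('g, 'g, 'g) biset" where
  "id_biset G = \<lparr>points = carrier G, lact = (\<lambda>g u. g \<otimes>\<^bsub>G\<^esub> u), ract = (\<lambda>u g. u \<otimes>\<^bsub>G\<^esub> g)\<rparr>"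

definition iso_class_prod :: "'g monoid \<Rightarrow> 'h monoid \<Rightarrow> 'k monoid \<Rightarrow>
    ('g, 'h) biset_iso_class \<Rightarrow> ('h, 'k) biset_iso_class \<Rightarrow> ('g, 'k) biset_iso_class" where
  "iso_class_prod G H K X Y = (\<Union>U \<in> X. \<Union>W \<in> Y. iso_class G K (biset_prod H U W))"


section \<open>Abelian groups given by generators and relations\<close>

text \<open>As with \<^const>\<open>free_Abelian_group\<close>, the group law is the monoid multiplication of the record.\<close>

definition ab_pres :: "'a set \<Rightarrow> ('a \<Rightarrow>\<^sub>0 int) set \<Rightarrow> ('a \<Rightarrow>\<^sub>0 int) set monoid" where
  "ab_pres S R = free_Abelian_group S Mod generate (free_Abelian_group S) R"

definition ab_class :: "'a set \<Rightarrow> ('a \<Rightarrow>\<^sub>0 int) set \<Rightarrow> ('a \<Rightarrow>\<^sub>0 int) \<Rightarrow> ('a \<Rightarrow>\<^sub>0 int) set" where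
  "ab_class S R p = generate (free_Abelian_group S) R #>\<^bsub>free_Abelian_group S\<^esub> p"

text \<open>Additive and biadditive extensions to classes of a map given on generators.  For maps that
  respect the relations, the unions below are unions of equal cosets.\<close>

definition ab_lin ::
  "'b set \<Rightarrow> ('b \<Rightarrow>\<^sub>0 int) set \<Rightarrow> ('a \<Rightarrow> 'b) \<Rightarrow> ('a \<Rightarrow>\<^sub>0 int) set \<Rightarrow> ('b \<Rightarrow>\<^sub>0 int) set" where
  "ab_lin S R f X = (\<Union>p \<in> X. ab_class S R (frag_extend (\<lambda>a. frag_of (f a)) p))"

definition ab_bilin :: "'c set \<Rightarrow> ('c \<Rightarrow>\<^sub>0 int) set \<Rightarrow> ('a \<Rightarrow> 'b \<Rightarrow> 'c) \<Rightarrow>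
    ('a \<Rightarrow>\<^sub>0 int) set \<Rightarrow> ('b \<Rightarrow>\<^sub>0 int) set \<Rightarrow> ('c \<Rightarrow>\<^sub>0 int) set" where
  "ab_bilin S R f X Y = (\<Union>p \<in> X. \<Union>q \<in> Y.
     ab_class S R (frag_extend (\<lambda>a. frag_extend (\<lambda>b. frag_of (f a b)) q) p))"


section \<open>The groups B(G,H) and kB(G,H)\<close>

type_synonym ('g, 'h) burnside = "(('g, 'h) biset_iso_class \<Rightarrow>\<^sub>0 int) set"

definition burnside_rels :: "'g monoid \<Rightarrow> 'h monoid \<Rightarrow> (('g, 'h) biset_iso_class \<Rightarrow>\<^sub>0 int) set" where
  "burnside_rels G H =
     {frag_of (iso_class G H (biset_union U V)) - frag_of (iso_class G H U) - frag_of (iso_class G H V)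
      | (U :: ('g, 'h, nat) biset) (V :: ('g, 'h, nat) biset). finite_biset G H U \<and> finite_biset G H V}"

definition burnside_group :: "'g monoid \<Rightarrow> 'h monoid \<Rightarrow> ('g, 'h) burnside monoid" where
  "burnside_group G H = ab_pres (iso_classes G H) (burnside_rels G H)"

definition burnside_elt :: "'g monoid \<Rightarrow> 'h monoid \<Rightarrow> ('g, 'h, 'u) biset \<Rightarrow> ('g, 'h) burnside" where
  "burnside_elt G H U = ab_class (iso_classes G H) (burnside_rels G H) (frag_of (iso_class G H U))"

definition burnside_comp :: "'g monoid \<Rightarrow> 'h monoid \<Rightarrow> 'k monoid \<Rightarrow>
    ('g, 'h) burnside \<Rightarrow> ('h, 'k) burnside \<Rightarrow> ('g, 'k) burnside" where
  "burnside_comp G H K = ab_bilin (iso_classes G K) (burnside_rels G K) (iso_class_prod G H K)"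

text \<open>The tensor product \<open>k \<otimes> A\<close> over the integers of a ring \<open>k\<close> and an abelian group \<open>A\<close> (written
  multiplicatively); the generator \<open>(c, x)\<close> stands for \<open>c \<otimes> x\<close>.  Balancedness over the integers
  follows from biadditivity.\<close>

definition tensor_rels :: "'c ring \<Rightarrow> 'a monoid \<Rightarrow> ('c \<times> 'a \<Rightarrow>\<^sub>0 int) set" where
  "tensor_rels k A =
     {frag_of (c \<oplus>\<^bsub>k\<^esub> d, x) - frag_of (c, x) - frag_of (d, x)
      | c d x. c \<in> carrier k \<and> d \<in> carrier k \<and> x \<in> carrier A} \<union>
     {frag_of (c, x \<otimes>\<^bsub>A\<^esub> y) - frag_of (c, x) - frag_of (c, y)
      | c x y. c \<in> carrier k \<and> x \<in> carrier A \<and> y \<in> carrier A}"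

text \<open>The fields \<^const>\<open>mult\<close> and \<^const>\<open>one\<close> of a module record play no role for modules.\<close>

definition scalar_extension :: "'c ring \<Rightarrow> 'a monoid \<Rightarrow> ('c, ('c \<times> 'a \<Rightarrow>\<^sub>0 int) set) module" where
  "scalar_extension k A =
     (let S = carrier k \<times> carrier A; R = tensor_rels k A; T = ab_pres S R in
      \<lparr>carrier = carrier T, mult = (\<lambda>_ _. undefined), one = undefined,
       zero = \<one>\<^bsub>T\<^esub>, add = (\<lambda>s t. s \<otimes>\<^bsub>T\<^esub> t),
       smult = (\<lambda>c. ab_lin S R (\<lambda>(d, x). (c \<otimes>\<^bsub>k\<^esub> d, x)))\<rparr>)"

type_synonym ('c, 'g, 'h) kburnside = "('c \<times> ('g, 'h) burnside \<Rightarrow>\<^sub>0 int) set"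

definition kB :: "'c ring \<Rightarrow> 'g monoid \<Rightarrow> 'h monoid \<Rightarrow> ('c, ('c, 'g, 'h) kburnside) module" where
  "kB k G H = scalar_extension k (burnside_group G H)"

definition kB_comp :: "'c ring \<Rightarrow> 'g monoid \<Rightarrow> 'h monoid \<Rightarrow> 'k monoid \<Rightarrow>
    ('c, 'g, 'h) kburnside \<Rightarrow> ('c, 'h, 'k) kburnside \<Rightarrow> ('c, 'g, 'k) kburnside" where
  "kB_comp k G H K =
     ab_bilin (carrier k \<times> carrier (burnside_group G K)) (tensor_rels k (burnside_group G K))
       (\<lambda>(c, x) (d, y). (c \<otimes>\<^bsub>k\<^esub> d, burnside_comp G H K x y))"

definition kB_id :: "'c ring \<Rightarrow> 'g monoid \<Rightarrow> ('c, 'g, 'g) kburnside" where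
  "kB_id k G =
     ab_class (carrier k \<times> carrier (burnside_group G G)) (tensor_rels k (burnside_group G G))
       (frag_of (\<one>\<^bsub>k\<^esub>, burnside_elt G G (id_biset G)))"

definition double_burnside_algebra :: "'c ring \<Rightarrow> 'g monoid \<Rightarrow> ('c, ('c, 'g, 'g) kburnside) module" where
  "double_burnside_algebra k G = (kB k G G)\<lparr>mult := kB_comp k G G G, one := kB_id k G\<rparr>"


section \<open>The biset category and biset functors\<close>

text \<open>The type \<open>'g\<close> is the universe for the underlying sets of the groups.\<close>

definition biset_category :: "'c ring \<Rightarrow> ('g monoid, ('c, 'g, 'g) kburnside) category" where
  "biset_category k =
     \<lparr>obj = {H. group H \<and> finite (carrier H)},
      arr = (\<lambda>H K. carrier (kB k K H)),
      cmp = (\<lambda>H K L b a. kB_comp k L K H b a),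
      idt = kB_id k\<rparr>"

definition iso_to_subquotient :: "'g monoid \<Rightarrow> 'g monoid \<Rightarrow> bool" where
  "iso_to_subquotient G H \<longleftrightarrow>
     (\<exists>B A. subgroup B G \<and> A \<lhd> G\<lparr>carrier := B\<rparr> \<and> H \<cong> (G\<lparr>carrier := B\<rparr> Mod A))"

definition subquotient_category :: "'c ring \<Rightarrow> 'g monoid \<Rightarrow> ('g monoid, ('c, 'g, 'g) kburnside) category"
  where
  "subquotient_category k G = full_subcategory (biset_category k) (iso_to_subquotient G)"

type_synonym ('c, 'g, 'm) biset_functor =
  "('g monoid, ('c, 'g, 'g) kburnside, ('c, 'm) module, 'm \<Rightarrow> 'm) cat_functor"

definition k_linear_functor :: "'c ring \<Rightarrow> 'g monoid \<Rightarrow> ('c, 'g, 'm) biset_functor \<Rightarrow> bool" where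
  "k_linear_functor k G F \<longleftrightarrow>
     (\<forall>H \<in> obj (subquotient_category k G). \<forall>K \<in> obj (subquotient_category k G).
      \<forall>a \<in> carrier (kB k K H). \<forall>x \<in> carrier (fobj F H).
        (\<forall>b \<in> carrier (kB k K H).
           farr F H K (a \<oplus>\<^bsub>kB k K H\<^esub> b) x = farr F H K a x \<oplus>\<^bsub>fobj F K\<^esub> farr F H K b x) \<and>
        (\<forall>c \<in> carrier k. farr F H K (c \<odot>\<^bsub>kB k K H\<^esub> a) x = c \<odot>\<^bsub>fobj F K\<^esub> farr F H K a x))"

definition biset_functor_category ::
  "'c ring \<Rightarrow> 'g monoid \<Rightarrow> 'm itself \<Rightarrow> (('c, 'g, 'm) biset_functor, 'g monoid \<Rightarrow> 'm \<Rightarrow> 'm) category"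
  where
  "biset_functor_category k G m =
     full_subcategory (functor_category (subquotient_category k G) (module_category k m))
       (k_linear_functor k G)"

definition subfunctor ::
  "'c ring \<Rightarrow> 'g monoid \<Rightarrow> ('c, 'g, 'm) biset_functor \<Rightarrow> ('g monoid \<Rightarrow> 'm set) \<Rightarrow> bool" where
  "subfunctor k G F T \<longleftrightarrow>
     (\<forall>H \<in> obj (subquotient_category k G). submodule (T H) k (fobj F H)) \<and>
     (\<forall>H \<in> obj (subquotient_category k G). \<forall>K \<in> obj (subquotient_category k G).
      \<forall>a \<in> arr (subquotient_category k G) H K. \<forall>x \<in> T H. farr F H K a x \<in> T K)"

definition simple_functor :: "'c ring \<Rightarrow> 'g monoid \<Rightarrow> ('c, 'g, 'm) biset_functor \<Rightarrow> bool" where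
  "simple_functor k G F \<longleftrightarrow>
     F \<in> obj (biset_functor_category k G TYPE('m)) \<and>
     (\<exists>H \<in> obj (subquotient_category k G). carrier (fobj F H) \<noteq> {\<zero>\<^bsub>fobj F H\<^esub>}) \<and>
     (\<forall>T. subfunctor k G F T \<longrightarrow>
        (\<forall>H \<in> obj (subquotient_category k G). T H = {\<zero>\<^bsub>fobj F H\<^esub>}) \<or>
        (\<forall>H \<in> obj (subquotient_category k G). T H = carrier (fobj F H)))"

definition non_vanishing :: "'c ring \<Rightarrow> 'g monoid \<Rightarrow> 'm itself \<Rightarrow> bool" where
  "non_vanishing k G _ \<longleftrightarrow>
     (\<forall>S :: ('c, 'g, 'm) biset_functor. simple_functor k G S \<longrightarrow>
        carrier (fobj S G) \<noteq> {\<zero>\<^bsub>fobj S G\<^esub>})"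

definition evaluation :: "'g monoid \<Rightarrow>
    (('c, 'g, 'm) biset_functor, 'g monoid \<Rightarrow> 'm \<Rightarrow> 'm, (('c, 'g, 'g) kburnside, 'm) module, 'm \<Rightarrow> 'm)
      cat_functor" where
  "evaluation G =
     \<lparr>fobj = (\<lambda>F. let M = fobj F G in
        \<lparr>carrier = carrier M, mult = mult M, one = one M, zero = zero M, add = add M,
         smult = farr F G G\<rparr>),
      farr = (\<lambda>F F' \<eta>. \<eta> G)\<rparr>"

end

theory Submission
  imports Defs
begin

text \<open>The biset category is linear over \<open>k\<close>, and Morita theory for linear categories applies.  Let \<open>J\<close>
  be the ideal of morphisms \<open>H \<rightarrow> K\<close> that are sums of composites \<open>H \<rightarrow> G \<rightarrow> K\<close>.  If the identity of
  some \<open>H\<close> is not in \<open>J\<close>, then a subfunctor of the representable functor \<open>kB(-,H)\<close>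
  that is maximal among those containing \<open>J(H,-)\<close> and missing the identity has a simple quotient,
  and this quotient vanishes at \<open>G\<close>.
  So if \<open>G\<close> is non-vanishing, all identities factor through sums of copies of \<open>G\<close>.  Then the maps \<open>F(H) \<rightarrow> F(G)\<close>
  jointly separate the elements of \<open>F(H)\<close>, which makes evaluation fully faithful, and a module \<open>M\<close> is the
  evaluation of the functor of linear maps \<open>kB(G,-) \<rightarrow> M\<close>; such a map is determined by finitely many values,
  so this functor fits into the universe \<open>'m\<close>.  Conversely an equivalence is faithful, so it does not kill the
  identity of a nonzero functor.\<close>

section \<open>Equivalences of categories\<close>

text \<open>Universes shape the proof. Functors and modules take values in the type
  \<open>'m\<close>, while \<open>kB(-,H)\<close> and the functor of linear maps are built over
  other types. The Burnside groups have countably many generators, so \<open>kB(K,H)\<close> has at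
  most \<open>max(|k|, aleph_0)\<close> elements and injects into \<open>'m\<close>; the bound on
  \<open>carrier k\<close> serves this. A module \<open>M\<close> is extended by linear maps out of
  \<open>kB(G,-)\<close>: no further quotient has to be formed, and a map can be encoded by a finite
  list of values. The maximal subfunctor exists because a subfunctor of \<open>kB(-,H)\<close> that
  contains the identity is everything: properness is the absence of one single element and survives
  unions of chains. An identity written as \<open>sum b_i a_i\<close> with
  \<open>a_i : H -> G\<close> and \<open>b_i : G -> H\<close> works like a dual basis: each
  \<open>y\<close> in \<open>F(H)\<close> equals \<open>sum F(b_i)(F(a_i) y)\<close>. This principle
  yields the separation of elements, the extension of linear maps from \<open>G\<close> to all
  groups and the determination by finitely many values, each time by induction over
  \<open>through\<close>.\<close>

locale cat =
  fixes C :: "('o, 'a) category" (structure)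
  assumes cmp_closed: "\<lbrakk>X \<in> obj C; Y \<in> obj C; Z \<in> obj C; f \<in> arr C X Y; g \<in> arr C Y Z\<rbrakk>
      \<Longrightarrow> cmp C X Y Z g f \<in> arr C X Z"
    and idt_closed: "X \<in> obj C \<Longrightarrow> idt C X \<in> arr C X X"
    and cmp_assoc: "\<lbrakk>W \<in> obj C; X \<in> obj C; Y \<in> obj C; Z \<in> obj C; f \<in> arr C W X; g \<in> arr C X Y; h \<in> arr C Y Z\<rbrakk>
      \<Longrightarrow> cmp C W Y Z h (cmp C W X Y g f) = cmp C W X Z (cmp C X Y Z h g) f"
    and cmp_idt_left: "\<lbrakk>X \<in> obj C; Y \<in> obj C; f \<in> arr C X Y\<rbrakk> \<Longrightarrow> cmp C X Y Y (idt C Y) f = f"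
    and cmp_idt_right: "\<lbrakk>X \<in> obj C; Y \<in> obj C; f \<in> arr C X Y\<rbrakk> \<Longrightarrow> cmp C X X Y f (idt C X) = f"

lemma cat_full_subcategory:
  assumes "cat C"
  shows "cat (full_subcategory C P)"
  using assms by (auto simp: cat_def full_subcategory_def)

lemma (in cat) iso_arr_cancel_left:
  assumes "X \<in> obj C" "Y \<in> obj C" "Z \<in> obj C" "iso_arr C Y Z h" "f \<in> arr C X Y" "g \<in> arr C X Y"
    and eq: "cmp C X Y Z h f = cmp C X Y Z h g"
  shows "f = g"
proof -
  obtain i where i: "i \<in> arr C Z Y" "cmp C Y Z Y i h = idt C Y" "h \<in> arr C Y Z"
    using assms(4) by (auto simp: iso_arr_def)
  have "f = cmp C X Z Y i (cmp C X Y Z h f)"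
    using cmp_assoc[of X Y Z Y f h i] assms(1-3,5) i by (simp add: cmp_idt_left)
  also have "\<dots> = g"
    unfolding eq using cmp_assoc[of X Y Z Y g h i] assms(1-3,6) i by (simp add: cmp_idt_left)
  finally show ?thesis .
qed

text \<open>The unit is natural, so \<open>\<eta> Y\<close> after \<open>f\<close> equals
  \<open>E(F f)\<close> after \<open>\<eta> X\<close>. This depends on \<open>f\<close> only through
  \<open>F f\<close>, and the isomorphism \<open>\<eta> Y\<close> can be cancelled.\<close>

lemma equivalence_faithful:
  assumes "cat C" "equivalence_of_categories C D F"
    and X: "X \<in> obj C" and Y: "Y \<in> obj C" and f: "f \<in> arr C X Y" and g: "g \<in> arr C X Y"
    and eq: "farr F X Y f = farr F X Y g"
  shows "f = g"
proof -
  interpret cat C by fact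
  obtain E \<eta> where E: "is_functor D C E" and F: "is_functor C D F"
    and \<eta>: "nat_trans C C id_functor (comp_functor E F) \<eta>"
    and iso: "\<And>X. X \<in> obj C \<Longrightarrow> iso_arr C X (fobj E (fobj F X)) (\<eta> X)"
    using assms(2)
    by (auto simp: equivalence_of_categories_def naturally_isomorphic_def id_functor_def comp_functor_def)
  have EY: "fobj E (fobj F Y) \<in> obj C"
    using E F Y by (auto simp: is_functor_def)
  have "cmp C X Y (fobj E (fobj F Y)) (\<eta> Y) f = cmp C X Y (fobj E (fobj F Y)) (\<eta> Y) g"
    using \<eta> X Y f g eq by (auto simp: nat_trans_def id_functor_def comp_functor_def)
  then show ?thesis
    using iso_arr_cancel_left[OF X Y EY iso[OF Y] f g] by simp
qed

text \<open>A quasi-inverse is assembled by choice: an object \<open>e Y\<close> with an isomorphism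
  \<open>\<epsilon> Y\<close> from \<open>F(e Y)\<close> to \<open>Y\<close> for each
  \<open>Y\<close>, and on arrows the unique preimage under \<open>F\<close> of a conjugated arrow.
  Equations in \<open>C\<close> are verified after applying \<open>F\<close>, which is injective on
  hom-sets (\<open>Finj\<close>).\<close>

lemma equivalence_of_categoriesI:
  assumes "cat C" "cat D" and F: "is_functor C D F"
    and ff: "\<And>X Y. \<lbrakk>X \<in> obj C; Y \<in> obj C\<rbrakk> \<Longrightarrow> bij_betw (farr F X Y) (arr C X Y) (arr D (fobj F X) (fobj F Y))"
    and es: "\<And>Y. Y \<in> obj D \<Longrightarrow> \<exists>X \<in> obj C. \<exists>f. iso_arr D (fobj F X) Y f"
  shows "equivalence_of_categories C D F"
proof -
  interpret C: cat C by fact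
  interpret D: cat D by fact
  have Fo: "fobj F X \<in> obj D" if "X \<in> obj C" for X
    using F that by (auto simp: is_functor_def)
  have Fa: "farr F X Y f \<in> arr D (fobj F X) (fobj F Y)" if "X \<in> obj C" "Y \<in> obj C" "f \<in> arr C X Y" for X Y f
    using F that by (auto simp: is_functor_def)
  have Fi: "farr F X X (idt C X) = idt D (fobj F X)" if "X \<in> obj C" for X
    using F that by (auto simp: is_functor_def)
  have Fc: "farr F X Z (cmp C X Y Z g f) = cmp D (fobj F X) (fobj F Y) (fobj F Z) (farr F Y Z g) (farr F X Y f)"
    if "X \<in> obj C" "Y \<in> obj C" "Z \<in> obj C" "f \<in> arr C X Y" "g \<in> arr C Y Z" for X Y Z f g
    using F that by (auto simp: is_functor_def)
  have Finj: "f = g" if "X \<in> obj C" "Y \<in> obj C" "f \<in> arr C X Y" "g \<in> arr C X Y" "farr F X Y f = farr F X Y g" for X Y f g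
    using ff[OF that(1,2)] that(3-5) by (meson bij_betw_imp_inj_on inj_onD)
  define I where "I X Y = inv_into (arr C X Y) (farr F X Y)" for X Y
  have I1: "I X Y g \<in> arr C X Y" and I2: "farr F X Y (I X Y g) = g"
    if "X \<in> obj C" "Y \<in> obj C" "g \<in> arr D (fobj F X) (fobj F Y)" for X Y g
    using ff[OF that(1,2)] that(3) unfolding I_def
    by (auto simp: bij_betw_def intro: inv_into_into f_inv_into_f)
  obtain e where e: "\<And>Y. Y \<in> obj D \<Longrightarrow> e Y \<in> obj C" "\<And>Y. Y \<in> obj D \<Longrightarrow> \<exists>f. iso_arr D (fobj F (e Y)) Y f"
    using es by metis
  obtain \<epsilon> where \<epsilon>: "\<And>Y. Y \<in> obj D \<Longrightarrow> iso_arr D (fobj F (e Y)) Y (\<epsilon> Y)"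
    using e(2) by metis
  have \<epsilon>a: "\<epsilon> Y \<in> arr D (fobj F (e Y)) Y" if "Y \<in> obj D" for Y
    using \<epsilon>[OF that] by (simp add: iso_arr_def)
  have "\<exists>g. g \<in> arr D Y (fobj F (e Y)) \<and> cmp D (fobj F (e Y)) Y (fobj F (e Y)) g (\<epsilon> Y) = idt D (fobj F (e Y))
      \<and> cmp D Y (fobj F (e Y)) Y (\<epsilon> Y) g = idt D Y" if "Y \<in> obj D" for Y
    using \<epsilon>[OF that] by (auto simp: iso_arr_def)
  then obtain \<delta> where \<delta>a: "\<And>Y. Y \<in> obj D \<Longrightarrow> \<delta> Y \<in> arr D Y (fobj F (e Y))"
    and \<delta>\<epsilon>: "\<And>Y. Y \<in> obj D \<Longrightarrow> cmp D (fobj F (e Y)) Y (fobj F (e Y)) (\<delta> Y) (\<epsilon> Y) = idt D (fobj F (e Y))"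
    and \<epsilon>\<delta>: "\<And>Y. Y \<in> obj D \<Longrightarrow> cmp D Y (fobj F (e Y)) Y (\<epsilon> Y) (\<delta> Y) = idt D Y"
    by metis
  \<comment> \<open>\<open>h Y Z g\<close> is \<open>g\<close> conjugated to an arrow between
    objects in the image of \<open>F\<close>; composites are respected because the inner pair
    \<open>\<epsilon> Y\<close>, \<open>\<delta> Y\<close> cancels.\<close>
  define h where "h Y Z g = cmp D (fobj F (e Y)) Z (fobj F (e Z)) (\<delta> Z) (cmp D (fobj F (e Y)) Y Z g (\<epsilon> Y))" for Y Z g
  have ha: "h Y Z g \<in> arr D (fobj F (e Y)) (fobj F (e Z))" if "Y \<in> obj D" "Z \<in> obj D" "g \<in> arr D Y Z" for Y Z g
    unfolding h_def by (meson D.cmp_closed Fo \<delta>a \<epsilon>a e(1) that)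
  have hc: "h X Z (cmp D X Y Z g f) = cmp D (fobj F (e X)) (fobj F (e Y)) (fobj F (e Z)) (h Y Z g) (h X Y f)"
    if "X \<in> obj D" "Y \<in> obj D" "Z \<in> obj D" "f \<in> arr D X Y" "g \<in> arr D Y Z" for X Y Z f g
  proof -
    have 1: "cmp D (fobj F (e X)) (fobj F (e Y)) Y (\<epsilon> Y) (h X Y f) = cmp D (fobj F (e X)) X Y f (\<epsilon> X)"
      unfolding h_def
      by (subst D.cmp_assoc) (use that in \<open>auto simp: D.cmp_closed Fo \<delta>a \<epsilon>a e(1) \<epsilon>\<delta> D.cmp_idt_left\<close>)
    have "cmp D (fobj F (e X)) (fobj F (e Y)) (fobj F (e Z)) (h Y Z g) (h X Y f)
        = cmp D (fobj F (e X)) Z (fobj F (e Z)) (\<delta> Z) (cmp D (fobj F (e X)) (fobj F (e Y)) Z (cmp D (fobj F (e Y)) Y Z g (\<epsilon> Y)) (h X Y f))"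
      unfolding h_def[of Y Z]
      by (rule D.cmp_assoc[symmetric]) (use that ha in \<open>auto simp: D.cmp_closed Fo \<delta>a \<epsilon>a e(1)\<close>)
    also have "cmp D (fobj F (e X)) (fobj F (e Y)) Z (cmp D (fobj F (e Y)) Y Z g (\<epsilon> Y)) (h X Y f)
        = cmp D (fobj F (e X)) Y Z g (cmp D (fobj F (e X)) (fobj F (e Y)) Y (\<epsilon> Y) (h X Y f))"
      by (rule D.cmp_assoc[symmetric]) (use that ha in \<open>auto simp: D.cmp_closed Fo \<delta>a \<epsilon>a e(1)\<close>)
    also have "\<dots> = cmp D (fobj F (e X)) X Z (cmp D X Y Z g f) (\<epsilon> X)"
      unfolding 1 by (rule D.cmp_assoc) (use that in \<open>auto simp: D.cmp_closed Fo \<delta>a \<epsilon>a e(1)\<close>)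
    finally show ?thesis
      by (simp add: h_def)
  qed
  define E where "E = \<lparr>fobj = e, farr = (\<lambda>Y Z g. I (e Y) (e Z) (h Y Z g))\<rparr>"
  have Ea: "farr E Y Z g \<in> arr C (e Y) (e Z)" "farr F (e Y) (e Z) (farr E Y Z g) = h Y Z g"
    if "Y \<in> obj D" "Z \<in> obj D" "g \<in> arr D Y Z" for Y Z g
    using that by (auto simp: E_def I1 I2 e(1) ha)
  have Eo: "fobj E = e" by (simp add: E_def)
  have functor_E: "is_functor D C E"
    unfolding is_functor_def Eo
  proof (intro conjI ballI)
    fix X assume X: "X \<in> obj D"
    show "farr E X X (idt D X) = idt C (e X)"
      by (rule Finj[of "e X" "e X"])
        (use X in \<open>auto simp: e(1) Ea D.idt_closed C.idt_closed Fi h_def D.cmp_idt_left \<epsilon>a Fo \<delta>\<epsilon>\<close>)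
  next
    fix X Y Z f g assume "X \<in> obj D" "Y \<in> obj D" "Z \<in> obj D" "f \<in> arr D X Y" "g \<in> arr D Y Z"
    then show "farr E X Z (cmp D X Y Z g f) = cmp C (e X) (e Y) (e Z) (farr E Y Z g) (farr E X Y f)"
      by (intro Finj[of "e X" "e Z"]) (auto simp: e(1) Ea C.cmp_closed D.cmp_closed Fc hc)
  qed (auto simp: e(1) Ea)
  have counit: "naturally_isomorphic D D (comp_functor F E) id_functor"
    unfolding naturally_isomorphic_def
  proof (intro exI conjI ballI)
    show "nat_trans D D (comp_functor F E) id_functor \<epsilon>"
      unfolding nat_trans_def
    proof (intro conjI ballI)
      fix X Y f assume "X \<in> obj D" "Y \<in> obj D" "f \<in> arr D X Y"
      then show "cmp D (fobj (comp_functor F E) X) (fobj (comp_functor F E) Y) (fobj id_functor Y) (\<epsilon> Y)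
            (farr (comp_functor F E) X Y f) =
          cmp D (fobj (comp_functor F E) X) (fobj id_functor X) (fobj id_functor Y) (farr id_functor X Y f) (\<epsilon> X)"
        by (simp add: comp_functor_def id_functor_def Eo Ea h_def D.cmp_assoc D.cmp_closed Fo \<delta>a \<epsilon>a e(1) \<epsilon>\<delta> D.cmp_idt_left)
    qed (auto simp: comp_functor_def id_functor_def Eo \<epsilon>a)
  qed (auto simp: comp_functor_def id_functor_def Eo \<epsilon>)
  \<comment> \<open>The unit at \<open>X\<close> is the preimage under \<open>F\<close> of the
    inverse of the counit at \<open>F X\<close>.\<close>
  define \<eta> where "\<eta> X = I X (e (fobj F X)) (\<delta> (fobj F X))" for X
  have \<eta>: "\<eta> X \<in> arr C X (e (fobj F X))" "farr F X (e (fobj F X)) (\<eta> X) = \<delta> (fobj F X)" if "X \<in> obj C" for X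
    unfolding \<eta>_def using that by (auto intro!: I1 I2 simp: e(1) Fo \<delta>a)
  have unit: "naturally_isomorphic C C id_functor (comp_functor E F)"
    unfolding naturally_isomorphic_def
  proof (intro exI conjI ballI)
    show "nat_trans C C id_functor (comp_functor E F) \<eta>"
      unfolding nat_trans_def
    proof (intro conjI ballI)
      fix X Y f assume XY: "X \<in> obj C" "Y \<in> obj C" "f \<in> arr C X Y"
      have "cmp D (fobj F X) (fobj F Y) (fobj F (e (fobj F Y))) (\<delta> (fobj F Y)) (farr F X Y f)
          = cmp D (fobj F X) (fobj F (e (fobj F X))) (fobj F (e (fobj F Y))) (h (fobj F X) (fobj F Y) (farr F X Y f)) (\<delta> (fobj F X))"
        unfolding h_def using XY
        by (simp add: D.cmp_assoc D.cmp_closed Fo Fa \<delta>a \<epsilon>a e(1))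
          (simp add: D.cmp_assoc[symmetric] D.cmp_closed Fo Fa \<delta>a \<epsilon>a e(1) \<epsilon>\<delta> D.cmp_idt_right)
      then have "cmp C X Y (e (fobj F Y)) (\<eta> Y) f = cmp C X (e (fobj F X)) (e (fobj F Y)) (farr E (fobj F X) (fobj F Y) (farr F X Y f)) (\<eta> X)"
        using XY by (intro Finj[of X "e (fobj F Y)"]) (auto simp: C.cmp_closed \<eta> e(1) Fo Fa Fc Ea)
      then show "cmp C (fobj id_functor X) (fobj id_functor Y) (fobj (comp_functor E F) Y) (\<eta> Y)
            (farr id_functor X Y f) =
          cmp C (fobj id_functor X) (fobj (comp_functor E F) X) (fobj (comp_functor E F) Y)
            (farr (comp_functor E F) X Y f) (\<eta> X)"
        by (simp add: comp_functor_def id_functor_def Eo)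
    qed (auto simp: comp_functor_def id_functor_def Eo \<eta>)
  next
    fix X assume X: "X \<in> obj C"
    \<comment> \<open>Its inverse is the preimage of the counit itself.\<close>
    define \<theta> where "\<theta> = I (e (fobj F X)) X (\<epsilon> (fobj F X))"
    have \<theta>: "\<theta> \<in> arr C (e (fobj F X)) X" "farr F (e (fobj F X)) X \<theta> = \<epsilon> (fobj F X)"
      unfolding \<theta>_def using X by (auto intro!: I1 I2 simp: e(1) Fo \<epsilon>a)
    have "cmp C X (e (fobj F X)) X \<theta> (\<eta> X) = idt C X"
      by (rule Finj[of X X]) (use X in \<open>auto simp: C.cmp_closed C.idt_closed \<theta> \<eta> e(1) Fo Fc Fi \<epsilon>\<delta>\<close>)
    moreover have "cmp C (e (fobj F X)) X (e (fobj F X)) (\<eta> X) \<theta> = idt C (e (fobj F X))"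
      by (rule Finj[of "e (fobj F X)" "e (fobj F X)"])
        (use X in \<open>auto simp: C.cmp_closed C.idt_closed \<theta> \<eta> e(1) Fo Fc Fi \<delta>\<epsilon>\<close>)
    ultimately show "iso_arr C (fobj id_functor X) (fobj (comp_functor E F) X) (\<eta> X)"
      using X \<theta> \<eta> by (auto simp: iso_arr_def comp_functor_def id_functor_def Eo)
  qed
  show ?thesis
    unfolding equivalence_of_categories_def using F functor_E unit counit by blast
qed

lemma cat_functor_category:
  assumes "cat D"
  shows "cat (functor_category C D)"
proof -
  interpret D: cat D by fact
  have o: "fobj F X \<in> obj D" if "is_functor C D F" "X \<in> obj C" for F X
    using that by (auto simp: is_functor_def)
  have a: "farr F X Y f \<in> arr D (fobj F X) (fobj F Y)"
    if "is_functor C D F" "X \<in> obj C" "Y \<in> obj C" "f \<in> arr C X Y" for F X Y f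
    using that by (auto simp: is_functor_def)
  have na: "\<eta> X \<in> arr D (fobj F X) (fobj F' X)" if "nat_trans C D F F' \<eta>" "X \<in> obj C" for F F' \<eta> X
    using that by (auto simp: nat_trans_def)
  have nn: "cmp D (fobj F X) (fobj F Y) (fobj F' Y) (\<eta> Y) (farr F X Y f) =
        cmp D (fobj F X) (fobj F' X) (fobj F' Y) (farr F' X Y f) (\<eta> X)"
    if "nat_trans C D F F' \<eta>" "X \<in> obj C" "Y \<in> obj C" "f \<in> arr C X Y" for F F' \<eta> X Y f
    using that by (auto simp: nat_trans_def)
  have "nat_trans C D F F'' (\<lambda>X \<in> obj C. cmp D (fobj F X) (fobj F' X) (fobj F'' X) (\<theta> X) (\<eta> X))"
    if F: "is_functor C D F" "is_functor C D F'" "is_functor C D F''"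
      and n: "nat_trans C D F F' \<eta>" "nat_trans C D F' F'' \<theta>" for F F' F'' \<eta> \<theta>
    unfolding nat_trans_def
  proof (intro conjI ballI)
    fix X Y f assume X: "X \<in> obj C" "Y \<in> obj C" "f \<in> arr C X Y"
    \<comment> \<open>The naturality squares of \<open>\<eta>\<close> and \<open>\<theta>\<close>
      are pasted; each use of \<open>nn\<close> is framed by reassociations.\<close>
    have "cmp D (fobj F X) (fobj F Y) (fobj F'' Y) (cmp D (fobj F Y) (fobj F' Y) (fobj F'' Y) (\<theta> Y) (\<eta> Y)) (farr F X Y f)
      = cmp D (fobj F X) (fobj F' Y) (fobj F'' Y) (\<theta> Y) (cmp D (fobj F X) (fobj F Y) (fobj F' Y) (\<eta> Y) (farr F X Y f))"
      by (rule D.cmp_assoc[symmetric]) (use X F n in \<open>auto intro: o a na\<close>)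
    also have "\<dots> = cmp D (fobj F X) (fobj F' Y) (fobj F'' Y) (\<theta> Y) (cmp D (fobj F X) (fobj F' X) (fobj F' Y) (farr F' X Y f) (\<eta> X))"
      by (simp only: nn[OF n(1) X])
    also have "\<dots> = cmp D (fobj F X) (fobj F' X) (fobj F'' Y) (cmp D (fobj F' X) (fobj F' Y) (fobj F'' Y) (\<theta> Y) (farr F' X Y f)) (\<eta> X)"
      by (rule D.cmp_assoc) (use X F n in \<open>auto intro: o a na\<close>)
    also have "\<dots> = cmp D (fobj F X) (fobj F' X) (fobj F'' Y) (cmp D (fobj F' X) (fobj F'' X) (fobj F'' Y) (farr F'' X Y f) (\<theta> X)) (\<eta> X)"
      by (simp only: nn[OF n(2) X])
    also have "\<dots> = cmp D (fobj F X) (fobj F'' X) (fobj F'' Y) (farr F'' X Y f) (cmp D (fobj F X) (fobj F' X) (fobj F'' X) (\<theta> X) (\<eta> X))"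
      by (rule D.cmp_assoc[symmetric]) (use X F n in \<open>auto intro: o a na\<close>)
    finally show "cmp D (fobj F X) (fobj F Y) (fobj F'' Y) ((\<lambda>X \<in> obj C. cmp D (fobj F X) (fobj F' X) (fobj F'' X) (\<theta> X) (\<eta> X)) Y) (farr F X Y f)
      = cmp D (fobj F X) (fobj F'' X) (fobj F'' Y) (farr F'' X Y f) ((\<lambda>X \<in> obj C. cmp D (fobj F X) (fobj F' X) (fobj F'' X) (\<theta> X) (\<eta> X)) X)"
      using X by simp
  qed (simp, meson D.cmp_closed o na F n)
  moreover have "nat_trans C D F F (\<lambda>X \<in> obj C. idt D (fobj F X))" if "is_functor C D F" for F
    using that by (auto simp: nat_trans_def D.idt_closed D.cmp_idt_left D.cmp_idt_right o a)
  moreover have "(\<lambda>X \<in> obj C. cmp D (fobj F X) (fobj F'' X) (fobj F''' X) (\<xi> X)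
        ((\<lambda>X \<in> obj C. cmp D (fobj F X) (fobj F' X) (fobj F'' X) (\<theta> X) (\<eta> X)) X)) =
      (\<lambda>X \<in> obj C. cmp D (fobj F X) (fobj F' X) (fobj F''' X)
        ((\<lambda>X \<in> obj C. cmp D (fobj F' X) (fobj F'' X) (fobj F''' X) (\<xi> X) (\<theta> X)) X) (\<eta> X))"
    if F: "is_functor C D F" "is_functor C D F'" "is_functor C D F''" "is_functor C D F'''"
      and n: "nat_trans C D F F' \<eta>" "nat_trans C D F' F'' \<theta>" "nat_trans C D F'' F''' \<xi>"
    for F F' F'' F''' \<eta> \<theta> \<xi>
    using D.cmp_assoc[OF o[OF F(1)] o[OF F(2)] o[OF F(3)] o[OF F(4)] na[OF n(1)] na[OF n(2)] na[OF n(3)]]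
    by (intro restrict_ext) simp
  moreover have "(\<lambda>X \<in> obj C. cmp D (fobj F X) (fobj F' X) (fobj F' X)
        ((\<lambda>X \<in> obj C. idt D (fobj F' X)) X) (\<eta> X)) = \<eta>"
      "(\<lambda>X \<in> obj C. cmp D (fobj F X) (fobj F X) (fobj F' X)
        (\<eta> X) ((\<lambda>X \<in> obj C. idt D (fobj F X)) X)) = \<eta>"
    if F: "is_functor C D F" "is_functor C D F'" and n: "nat_trans C D F F' \<eta>" "\<eta> \<in> extensional (obj C)"
    for F F' \<eta>
    using D.cmp_idt_left[OF o[OF F(1)] o[OF F(2)] na[OF n(1)]]
      D.cmp_idt_right[OF o[OF F(1)] o[OF F(2)] na[OF n(1)]] n(2)
    by (auto intro!: extensionalityI[of _ "obj C"])
  ultimately show ?thesis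
    unfolding cat_def functor_category_def by simp
qed

section \<open>Generators, relations and tensor products\<close>

text \<open>Fubini for finite formal sums. It makes \<open>bil\<close> visibly additive in its
  second argument as well, so that an induction may run over either one.\<close>

lemma frag_extend_swap:
  "frag_extend (\<lambda>a. frag_extend (\<lambda>b. g a b) q) p = frag_extend (\<lambda>b. frag_extend (\<lambda>a. g a b) p) q"
  using subset_UNIV
proof (induction q rule: frag_induction)
  case (diff q q')
  have "frag_extend (\<lambda>a. frag_extend (g a) q - frag_extend (g a) q') p =
      frag_extend (\<lambda>a. frag_extend (g a) q) p - frag_extend (\<lambda>a. frag_extend (g a) q') p"
    using subset_UNIV by (induction p rule: frag_induction) (auto simp: frag_extend_diff)
  then show ?case
    by (simp add: frag_extend_diff diff)
qed (auto intro: frag_extend_eq_0)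

locale presentation =
  fixes S :: "'a set" and R :: "('a \<Rightarrow>\<^sub>0 int) set"
  assumes keys_rels: "r \<in> R \<Longrightarrow> Poly_Mapping.keys r \<subseteq> S"
begin

text \<open>The subgroup of relations. With it, equality of classes becomes membership of a
  difference, in the additive notation of formal sums instead of cosets.\<close>

definition null :: "('a \<Rightarrow>\<^sub>0 int) set" where
  "null = generate (free_Abelian_group S) R"

lemma null_subgroup: "subgroup null (free_Abelian_group S)"
  unfolding null_def by (rule group.generate_is_subgroup) (auto dest: keys_rels)

lemma null_keys: "p \<in> null \<Longrightarrow> Poly_Mapping.keys p \<subseteq> S"
  using subsetD[OF subgroup.subset[OF null_subgroup], of p] by simp

lemma null_zero: "0 \<in> null"
  using subgroup.one_closed[OF null_subgroup] by simp

lemma null_rels: "r \<in> R \<Longrightarrow> r \<in> null"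
  unfolding null_def by (rule generate.incl)

lemma null_add: "\<lbrakk>p \<in> null; q \<in> null\<rbrakk> \<Longrightarrow> p + q \<in> null"
  using subgroup.m_closed[OF null_subgroup] by auto

lemma null_minus: "p \<in> null \<Longrightarrow> - p \<in> null"
  using subgroup.m_inv_closed[OF null_subgroup, of p] null_keys[of p] by simp

lemma null_diff: "\<lbrakk>p \<in> null; q \<in> null\<rbrakk> \<Longrightarrow> p - q \<in> null"
  using null_add[of p "-q"] null_minus[of q] by simp

text \<open>\<open>generate\<close> only inverts generators; here negation is a step at every null
  element, which fits the additive maps to which the rule is applied.\<close>

lemma null_induct [consumes 1, case_names rel zero minus add]:
  assumes "p \<in> null" "\<And>r. r \<in> R \<Longrightarrow> P r" "P 0" "\<And>p. \<lbrakk>p \<in> null; P p\<rbrakk> \<Longrightarrow> P (- p)"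
    "\<And>p q. \<lbrakk>p \<in> null; q \<in> null; P p; P q\<rbrakk> \<Longrightarrow> P (p + q)"
  shows "P p"
  using assms(1) unfolding null_def
proof induction
  case (inv h)
  then show ?case
    using assms(2,4)[of h] null_rels[of h] keys_rels[of h] by simp
next
  case (eng h1 h2)
  then show ?case
    using assms(5)[of h1 h2] by (simp add: null_def)
qed (use assms in auto)

lemma class_eq_iff:
  assumes "Poly_Mapping.keys p \<subseteq> S" "Poly_Mapping.keys q \<subseteq> S"
  shows "ab_class S R p = ab_class S R q \<longleftrightarrow> p - q \<in> null"
proof -
  have "ab_class S R x = {n + x |n. n \<in> null}" for x
    by (auto simp: ab_class_def r_coset_def null_def)
  moreover have "{n + p |n. n \<in> null} = {n + q |n. n \<in> null} \<longleftrightarrow> p - q \<in> null"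
  proof
    assume "{n + p |n. n \<in> null} = {n + q |n. n \<in> null}"
    moreover have "p \<in> {n + p |n. n \<in> null}"
      using null_zero by force
    ultimately show "p - q \<in> null"
      by auto
  next
    assume pq: "p - q \<in> null"
    have "\<exists>m. n + p = m + q \<and> m \<in> null" if "n \<in> null" for n
      using null_add[OF that pq] by (intro exI[of _ "n + (p - q)"]) simp
    moreover have "\<exists>m. n + q = m + p \<and> m \<in> null" if "n \<in> null" for n
      using null_diff[OF that pq] by (intro exI[of _ "n - (p - q)"]) simp
    ultimately show "{n + p |n. n \<in> null} = {n + q |n. n \<in> null}"
      by auto
  qed
  ultimately show ?thesis
    by simp
qed

lemma mem_class: "q \<in> ab_class S R p \<longleftrightarrow> q - p \<in> null"
proof
  show "q - p \<in> null \<Longrightarrow> q \<in> ab_class S R p"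
    by (auto simp: ab_class_def r_coset_def null_def intro!: bexI[of _ "q - p"])
qed (auto simp: ab_class_def r_coset_def null_def)

lemma mem_class_keys:
  assumes "q \<in> ab_class S R p" "Poly_Mapping.keys p \<subseteq> S"
  shows "Poly_Mapping.keys q \<subseteq> S"
proof -
  have "Poly_Mapping.keys (q - p) \<subseteq> S"
    using assms by (simp add: mem_class null_keys)
  then show ?thesis
    using assms(2) Poly_Mapping.keys_add[of "q - p" p] by auto
qed

lemma carrier_pres: "X \<in> carrier (ab_pres S R) \<longleftrightarrow> (\<exists>p. Poly_Mapping.keys p \<subseteq> S \<and> X = ab_class S R p)"
  unfolding ab_pres_def FactGroup_def RCOSETS_def ab_class_def
  by (simp only: partial_object.simps UN_iff singleton_iff Bex_def carrier_free_Abelian_group_iff)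

lemma class_closed: "Poly_Mapping.keys p \<subseteq> S \<Longrightarrow> ab_class S R p \<in> carrier (ab_pres S R)"
  by (auto simp: carrier_pres)

lemma carrier_presE:
  assumes "X \<in> carrier (ab_pres S R)"
  obtains p where "Poly_Mapping.keys p \<subseteq> S" "X = ab_class S R p"
  using assms by (auto simp: carrier_pres)

lemma comm_group_pres: "comm_group (ab_pres S R)"
  unfolding ab_pres_def
  by (rule comm_group.abelian_FactGroup[OF abelian_free_Abelian_group])
    (use null_subgroup in \<open>simp add: null_def\<close>)

lemma class_add:
  assumes "Poly_Mapping.keys p \<subseteq> S" "Poly_Mapping.keys q \<subseteq> S"
  shows "ab_class S R p \<otimes>\<^bsub>ab_pres S R\<^esub> ab_class S R q = ab_class S R (p + q)"
proof -
  have "normal null (free_Abelian_group S)"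
    by (rule comm_group.normal_iff_subgroup[OF abelian_free_Abelian_group, THEN iffD2, OF null_subgroup])
  from normal.rcos_sum[OF this, of p q] show ?thesis
    using assms by (simp add: ab_pres_def FactGroup_def ab_class_def null_def)
qed

lemma class_zero: "ab_class S R 0 = \<one>\<^bsub>ab_pres S R\<^esub>"
proof -
  interpret comm_group "ab_pres S R" by (rule comm_group_pres)
  have "ab_class S R 0 \<otimes>\<^bsub>ab_pres S R\<^esub> ab_class S R 0 = ab_class S R 0"
    by (simp add: class_add)
  then show ?thesis
    using class_closed[of 0] by (metis keys_zero empty_subsetI r_cancel_one')
qed

lemma class_minus:
  assumes "Poly_Mapping.keys p \<subseteq> S"
  shows "ab_class S R (- p) = inv\<^bsub>ab_pres S R\<^esub> (ab_class S R p)"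
proof -
  interpret comm_group "ab_pres S R" by (rule comm_group_pres)
  have "ab_class S R (- p) \<otimes>\<^bsub>ab_pres S R\<^esub> ab_class S R p = \<one>\<^bsub>ab_pres S R\<^esub>"
    using assms by (simp add: class_add class_zero)
  then show ?thesis
    using assms by (metis class_closed inv_equality keys_minus)
qed

lemma pres_induct [consumes 1, case_names gen one inv mult]:
  assumes "X \<in> carrier (ab_pres S R)" and gen: "\<And>s. s \<in> S \<Longrightarrow> P (ab_class S R (frag_of s))"
    and one: "P \<one>\<^bsub>ab_pres S R\<^esub>"
    and inv: "\<And>X. \<lbrakk>X \<in> carrier (ab_pres S R); P X\<rbrakk> \<Longrightarrow> P (inv\<^bsub>ab_pres S R\<^esub> X)"
    and mult: "\<And>X Y. \<lbrakk>X \<in> carrier (ab_pres S R); Y \<in> carrier (ab_pres S R); P X; P Y\<rbrakk> \<Longrightarrow> P (X \<otimes>\<^bsub>ab_pres S R\<^esub> Y)"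
  shows "P X"
proof -
  obtain p where p: "Poly_Mapping.keys p \<subseteq> S" "X = ab_class S R p"
    using assms(1) by (rule carrier_presE)
  \<comment> \<open>The support condition is part of the claim because the rules for sums and
    inverses of classes require it of both summands.\<close>
  have "Poly_Mapping.keys p \<subseteq> S \<and> P (ab_class S R p)"
    using p(1)
  proof (induction p rule: frag_induction)
    case zero
    then show ?case by (simp add: class_zero one)
  next
    case (one s)
    then show ?case by (simp add: gen)
  next
    case (diff a b)
    then have ab: "Poly_Mapping.keys a \<subseteq> S" "Poly_Mapping.keys b \<subseteq> S" "Poly_Mapping.keys (- b) \<subseteq> S"
      "P (ab_class S R a)" "P (ab_class S R b)"
      by (simp_all add: keys_minus)
    have "P (ab_class S R a \<otimes>\<^bsub>ab_pres S R\<^esub> ab_class S R (- b))"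
      using ab by (intro mult class_closed) (simp_all add: class_minus inv class_closed)
    then show ?case
      using ab Poly_Mapping.keys_diff[of a b] by (auto simp: class_add)
  qed
  then show ?thesis
    using p by simp
qed

end

section \<open>Additive and biadditive maps between presented groups\<close>

lemma ab_lin_class:
  assumes "presentation S R" "presentation S' R'"
    and f: "\<And>s. s \<in> S \<Longrightarrow> f s \<in> S'"
    and rels: "\<And>r. r \<in> R \<Longrightarrow> frag_extend (\<lambda>a. frag_of (f a)) r \<in> presentation.null S' R'"
    and p: "Poly_Mapping.keys p \<subseteq> S"
  shows "ab_lin S' R' f (ab_class S R p) = ab_class S' R' (frag_extend (\<lambda>a. frag_of (f a)) p)"
proof -
  interpret A: presentation S R by fact
  interpret B: presentation S' R' by fact
  let ?f = "frag_extend (\<lambda>a. frag_of (f a))"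
  have null: "?f q \<in> B.null" if "q \<in> A.null" for q
    using that
    by (induction rule: A.null_induct)
      (auto simp: frag_extend_add frag_extend_minus rels B.null_zero B.null_minus B.null_add)
  have keys: "Poly_Mapping.keys (?f q) \<subseteq> S'" if "Poly_Mapping.keys q \<subseteq> S" for q
    using keys_frag_extend[of "\<lambda>a. frag_of (f a)" q] that f by fastforce
  \<comment> \<open>All members of the coset contribute the same class, so the union in
    \<open>ab_lin\<close> collapses to its term at \<open>p\<close>.\<close>
  have "ab_class S' R' (?f q) = ab_class S' R' (?f p)" if q: "q \<in> ab_class S R p" for q
  proof -
    have "?f (q - p) \<in> B.null"
      using q null A.mem_class by blast
    then show ?thesis
      using keys p A.mem_class_keys[OF q p] by (simp add: B.class_eq_iff frag_extend_diff)
  qed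
  moreover have "p \<in> ab_class S R p"
    by (simp add: A.mem_class A.null_zero)
  ultimately show ?thesis
    unfolding ab_lin_def by blast
qed

text \<open>Compatibility is asked only for a relation in one variable against a generator in the
  other. \<open>bil_null_left\<close> and \<open>bil_null_right\<close> extend this to null elements
  against formal sums.\<close>

locale bilinear_presentation = A: presentation S R + B: presentation S' R' + C: presentation S'' R''
  for S :: "'a set" and R and S' :: "'b set" and R' and S'' :: "'c set" and R'' +
  fixes f :: "'a \<Rightarrow> 'b \<Rightarrow> 'c"
  assumes f_closed: "\<lbrakk>a \<in> S; b \<in> S'\<rbrakk> \<Longrightarrow> f a b \<in> S''"
    and left_rels: "\<lbrakk>r \<in> R; b \<in> S'\<rbrakk> \<Longrightarrow> frag_extend (\<lambda>a. frag_of (f a b)) r \<in> C.null"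
    and right_rels: "\<lbrakk>a \<in> S; r' \<in> R'\<rbrakk> \<Longrightarrow> frag_extend (\<lambda>b. frag_of (f a b)) r' \<in> C.null"
begin

definition bil where
  "bil p q = frag_extend (\<lambda>a. frag_extend (\<lambda>b. frag_of (f a b)) q) p"

lemma bil_swap: "bil p q = frag_extend (\<lambda>b. frag_extend (\<lambda>a. frag_of (f a b)) p) q"
  unfolding bil_def by (rule frag_extend_swap)

lemma bil_simps:
  "bil 0 q = 0" "bil (- p) q = - bil p q" "bil (p + p') q = bil p q + bil p' q" "bil (p - p') q = bil p q - bil p' q"
  "bil p 0 = 0" "bil p (- q) = - bil p q" "bil p (q + q') = bil p q + bil p q'" "bil p (q - q') = bil p q - bil p q'"
  "bil (frag_of a) (frag_of b) = frag_of (f a b)"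
proof -
  show "bil 0 q = 0" "bil (- p) q = - bil p q" "bil (p + p') q = bil p q + bil p' q" "bil (p - p') q = bil p q - bil p' q"
    "bil (frag_of a) (frag_of b) = frag_of (f a b)"
    by (simp_all add: bil_def frag_extend_minus frag_extend_add frag_extend_diff)
  show "bil p 0 = 0" "bil p (- q) = - bil p q" "bil p (q + q') = bil p q + bil p q'" "bil p (q - q') = bil p q - bil p q'"
    by (simp_all add: bil_swap frag_extend_minus frag_extend_add frag_extend_diff)
qed

lemma bil_keys:
  assumes "Poly_Mapping.keys p \<subseteq> S" "Poly_Mapping.keys q \<subseteq> S'"
  shows "Poly_Mapping.keys (bil p q) \<subseteq> S''"
proof -
  have "Poly_Mapping.keys (frag_extend (\<lambda>b. frag_of (f a b)) q) \<subseteq> S''" if "a \<in> S" for a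
    using keys_frag_extend[of "\<lambda>b. frag_of (f a b)" q] f_closed[OF that] assms(2) by fastforce
  then show ?thesis
    using keys_frag_extend[of "\<lambda>a. frag_extend (\<lambda>b. frag_of (f a b)) q" p] assms(1) unfolding bil_def by blast
qed

text \<open>Two nested inductions: over the way \<open>p\<close> is generated and, at a relation,
  over the formal sum \<open>q\<close>. The second one needs \<open>q\<close> as the outer sum,
  hence \<open>bil_swap\<close>.\<close>

lemma bil_null_left:
  assumes "p \<in> A.null" "Poly_Mapping.keys q \<subseteq> S'"
  shows "bil p q \<in> C.null"
  using assms(1)
proof (induction rule: A.null_induct)
  case (rel r)
  show ?case
    using assms(2) unfolding bil_swap
    by (induction q rule: frag_induction)
      (auto simp: left_rels[OF rel] C.null_zero C.null_diff frag_extend_diff)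
qed (auto simp: bil_simps C.null_zero C.null_minus C.null_add)

lemma bil_null_right:
  assumes "Poly_Mapping.keys p \<subseteq> S" "q \<in> B.null"
  shows "bil p q \<in> C.null"
  using assms(2)
proof (induction rule: B.null_induct)
  case (rel r)
  show ?case
    using assms(1) unfolding bil_def
    by (induction p rule: frag_induction)
      (auto simp: right_rels[OF _ rel] C.null_zero C.null_diff frag_extend_diff)
qed (auto simp: bil_simps C.null_zero C.null_minus C.null_add)

lemma bilin_class:
  assumes p: "Poly_Mapping.keys p \<subseteq> S" and q: "Poly_Mapping.keys q \<subseteq> S'"
  shows "ab_bilin S'' R'' f (ab_class S R p) (ab_class S' R' q) = ab_class S'' R'' (bil p q)"
proof -
  have "ab_class S'' R'' (bil p' q') = ab_class S'' R'' (bil p q)"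
    if p': "p' \<in> ab_class S R p" and q': "q' \<in> ab_class S' R' q" for p' q'
  proof -
    note keys = A.mem_class_keys[OF p' p] B.mem_class_keys[OF q' q]
    \<comment> \<open>The telescoping \<open>p' q' - p q = (p' - p) q' + p (q' - q)\<close> changes
      one representative at a time.\<close>
    have "bil (p' - p) q' + bil p (q' - q) \<in> C.null"
      using p' q' p keys
      by (intro C.null_add bil_null_left bil_null_right) (auto simp: A.mem_class B.mem_class)
    then show ?thesis
      using keys p q by (simp add: C.class_eq_iff bil_keys bil_simps)
  qed
  moreover have "p \<in> ab_class S R p" "q \<in> ab_class S' R' q"
    by (simp_all add: A.mem_class A.null_zero B.mem_class B.null_zero)
  ultimately show ?thesis
    unfolding ab_bilin_def bil_def[symmetric] by blast
qed

lemma bilin_gen: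
  "\<lbrakk>a \<in> S; b \<in> S'\<rbrakk> \<Longrightarrow>
    ab_bilin S'' R'' f (ab_class S R (frag_of a)) (ab_class S' R' (frag_of b)) = ab_class S'' R'' (frag_of (f a b))"
  by (simp add: bilin_class bil_simps)

lemma bilin_closed:
  assumes "X \<in> carrier (ab_pres S R)" "Y \<in> carrier (ab_pres S' R')"
  shows "ab_bilin S'' R'' f X Y \<in> carrier (ab_pres S'' R'')"
  using assms by (elim A.carrier_presE B.carrier_presE) (simp add: bilin_class bil_keys C.class_closed)

lemma bilin_mult_left:
  assumes "X \<in> carrier (ab_pres S R)" "X' \<in> carrier (ab_pres S R)" "Y \<in> carrier (ab_pres S' R')"
  shows "ab_bilin S'' R'' f (X \<otimes>\<^bsub>ab_pres S R\<^esub> X') Y =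
    ab_bilin S'' R'' f X Y \<otimes>\<^bsub>ab_pres S'' R''\<^esub> ab_bilin S'' R'' f X' Y"
proof -
  obtain p p' q where pq: "Poly_Mapping.keys p \<subseteq> S" "Poly_Mapping.keys p' \<subseteq> S" "Poly_Mapping.keys q \<subseteq> S'"
    "X = ab_class S R p" "X' = ab_class S R p'" "Y = ab_class S' R' q"
    using assms by (elim A.carrier_presE B.carrier_presE)
  moreover have "Poly_Mapping.keys (p + p') \<subseteq> S"
    using Poly_Mapping.keys_add[of p p'] pq by blast
  ultimately show ?thesis
    by (simp add: A.class_add bilin_class bil_simps C.class_add bil_keys)
qed

lemma bilin_mult_right:
  assumes "X \<in> carrier (ab_pres S R)" "Y \<in> carrier (ab_pres S' R')" "Y' \<in> carrier (ab_pres S' R')"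
  shows "ab_bilin S'' R'' f X (Y \<otimes>\<^bsub>ab_pres S' R'\<^esub> Y') =
    ab_bilin S'' R'' f X Y \<otimes>\<^bsub>ab_pres S'' R''\<^esub> ab_bilin S'' R'' f X Y'"
proof -
  obtain p q q' where pq: "Poly_Mapping.keys p \<subseteq> S" "Poly_Mapping.keys q \<subseteq> S'" "Poly_Mapping.keys q' \<subseteq> S'"
    "X = ab_class S R p" "Y = ab_class S' R' q" "Y' = ab_class S' R' q'"
    using assms by (elim A.carrier_presE B.carrier_presE)
  moreover have "Poly_Mapping.keys (q + q') \<subseteq> S'"
    using Poly_Mapping.keys_add[of q q'] pq by blast
  ultimately show ?thesis
    by (simp add: B.class_add bilin_class bil_simps C.class_add bil_keys)
qed

end

section \<open>The tensor product of a commutative ring with an abelian group\<close>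

locale tensor = k: cring k + A: comm_group A for k :: "'c ring" and A :: "'a monoid"
begin

text \<open>The elementary tensor of \<open>c\<close> and \<open>x\<close>.\<close>

definition pure :: "'c \<Rightarrow> 'a \<Rightarrow> ('c \<times> 'a \<Rightarrow>\<^sub>0 int) set" where
  "pure c x = ab_class (carrier k \<times> carrier A) (tensor_rels k A) (frag_of (c, x))"

sublocale P: presentation "carrier k \<times> carrier A" "tensor_rels k A"
proof
  fix r assume "r \<in> tensor_rels k A"
  then consider c d x where "c \<in> carrier k" "d \<in> carrier k" "x \<in> carrier A"
      "r = frag_of (c \<oplus>\<^bsub>k\<^esub> d, x) - frag_of (c, x) - frag_of (d, x)"
    | c x y where "c \<in> carrier k" "x \<in> carrier A" "y \<in> carrier A"
      "r = frag_of (c, x \<otimes>\<^bsub>A\<^esub> y) - frag_of (c, x) - frag_of (c, y)"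
    unfolding tensor_rels_def by blast
  then show "Poly_Mapping.keys r \<subseteq> carrier k \<times> carrier A"
  proof cases
    case 1
    then show ?thesis
      by (auto dest!: subsetD[OF Poly_Mapping.keys_diff])
  next
    case 2
    then show ?thesis
      by (auto dest!: subsetD[OF Poly_Mapping.keys_diff])
  qed
qed

abbreviation gens where "gens \<equiv> carrier k \<times> carrier A"

abbreviation TP where "TP \<equiv> ab_pres gens (tensor_rels k A)"

abbreviation T where "T \<equiv> scalar_extension k A"

lemma carrier_T: "carrier T = carrier (TP)"
  and add_T: "s \<oplus>\<^bsub>T\<^esub> t = s \<otimes>\<^bsub>TP\<^esub> t"
  and zero_T: "\<zero>\<^bsub>T\<^esub> = \<one>\<^bsub>TP\<^esub>"
  and smult_T: "c \<odot>\<^bsub>T\<^esub> t = ab_lin gens (tensor_rels k A) (\<lambda>(d, x). (c \<otimes>\<^bsub>k\<^esub> d, x)) t"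
  by (simp_all add: scalar_extension_def Let_def)

lemma abelian_group_T: "abelian_group T"
proof -
  interpret Q: comm_group "TP"
    by (rule P.comm_group_pres)
  show ?thesis
    by (rule abelian_groupI) (simp_all add: carrier_T add_T zero_T Q.m_ac Q.l_inv_ex)
qed

sublocale T: abelian_group T
  by (rule abelian_group_T)

lemma pure_closed: "\<lbrakk>c \<in> carrier k; x \<in> carrier A\<rbrakk> \<Longrightarrow> pure c x \<in> carrier T"
  unfolding carrier_T pure_def by (rule P.class_closed) simp

lemma pure_add_left:
  assumes "c \<in> carrier k" "d \<in> carrier k" "x \<in> carrier A"
  shows "pure (c \<oplus>\<^bsub>k\<^esub> d) x = pure c x \<oplus>\<^bsub>T\<^esub> pure d x"
proof -
  have "frag_of (c \<oplus>\<^bsub>k\<^esub> d, x) - (frag_of (c, x) + frag_of (d, x)) \<in> P.null"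
    using assms by (intro P.null_rels) (auto simp: tensor_rels_def diff_diff_eq)
  moreover have "Poly_Mapping.keys (frag_of (c, x) + frag_of (d, x)) \<subseteq> gens"
    using assms by (auto dest!: subsetD[OF Poly_Mapping.keys_add])
  ultimately show ?thesis
    using assms by (simp add: pure_def add_T P.class_add P.class_eq_iff)
qed

lemma pure_mult_right:
  assumes "c \<in> carrier k" "x \<in> carrier A" "y \<in> carrier A"
  shows "pure c (x \<otimes>\<^bsub>A\<^esub> y) = pure c x \<oplus>\<^bsub>T\<^esub> pure c y"
proof -
  have "frag_of (c, x \<otimes>\<^bsub>A\<^esub> y) - (frag_of (c, x) + frag_of (c, y)) \<in> P.null"
    using assms by (intro P.null_rels) (auto simp: tensor_rels_def diff_diff_eq)
  moreover have "Poly_Mapping.keys (frag_of (c, x) + frag_of (c, y)) \<subseteq> gens"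
    using assms by (auto dest!: subsetD[OF Poly_Mapping.keys_add])
  ultimately show ?thesis
    using assms by (simp add: pure_def add_T P.class_add P.class_eq_iff)
qed

lemma pure_zero_left: "x \<in> carrier A \<Longrightarrow> pure \<zero>\<^bsub>k\<^esub> x = \<zero>\<^bsub>T\<^esub>"
  using pure_add_left[of "\<zero>\<^bsub>k\<^esub>" "\<zero>\<^bsub>k\<^esub>" x] pure_closed[of "\<zero>\<^bsub>k\<^esub>" x]
  by (simp add: T.add.r_cancel_one')

lemma pure_one_right: "c \<in> carrier k \<Longrightarrow> pure c \<one>\<^bsub>A\<^esub> = \<zero>\<^bsub>T\<^esub>"
  using pure_mult_right[of c "\<one>\<^bsub>A\<^esub>" "\<one>\<^bsub>A\<^esub>"] pure_closed[of c "\<one>\<^bsub>A\<^esub>"]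
  by (simp add: T.add.r_cancel_one')

lemma pure_inv:
  assumes "c \<in> carrier k" "x \<in> carrier A"
  shows "pure c (inv\<^bsub>A\<^esub> x) = \<ominus>\<^bsub>T\<^esub> pure c x" "pure (\<ominus>\<^bsub>k\<^esub> c) x = \<ominus>\<^bsub>T\<^esub> pure c x"
proof -
  have "pure c (inv\<^bsub>A\<^esub> x) \<oplus>\<^bsub>T\<^esub> pure c x = \<zero>\<^bsub>T\<^esub>"
    using assms pure_mult_right[of c "inv\<^bsub>A\<^esub> x" x] by (simp add: pure_one_right)
  then show "pure c (inv\<^bsub>A\<^esub> x) = \<ominus>\<^bsub>T\<^esub> pure c x"
    using assms by (simp add: T.minus_equality pure_closed)
  have "pure (\<ominus>\<^bsub>k\<^esub> c) x \<oplus>\<^bsub>T\<^esub> pure c x = \<zero>\<^bsub>T\<^esub>"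
    using assms pure_add_left[of "\<ominus>\<^bsub>k\<^esub> c" c x] by (simp add: pure_zero_left k.l_neg)
  then show "pure (\<ominus>\<^bsub>k\<^esub> c) x = \<ominus>\<^bsub>T\<^esub> pure c x"
    using assms by (simp add: T.minus_equality pure_closed)
qed

text \<open>Negatives are absorbed by the scalar: minus the tensor of \<open>c\<close> and
  \<open>x\<close> is the tensor of \<open>\<ominus> c\<close> and \<open>x\<close>. Hence sums of
  elementary tensors exhaust \<open>T\<close>.\<close>

lemma T_induct [consumes 1, case_names pure add]:
  assumes "t \<in> carrier T" and pure: "\<And>c x. \<lbrakk>c \<in> carrier k; x \<in> carrier A\<rbrakk> \<Longrightarrow> P (pure c x)"
    and add: "\<And>s t. \<lbrakk>s \<in> carrier T; t \<in> carrier T; P s; P t\<rbrakk> \<Longrightarrow> P (s \<oplus>\<^bsub>T\<^esub> t)"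
  shows "P t"
proof -
  interpret Q: comm_group "TP"
    by (rule P.comm_group_pres)
  \<comment> \<open>The rule for presented groups has a case for inverses, which \<open>P\<close>
    alone would not survive; \<open>P\<close> of the negative is therefore carried along.\<close>
  have "P t \<and> P (inv\<^bsub>TP\<^esub> t)"
    using assms(1) unfolding carrier_T
  proof (induction rule: P.pres_induct)
    case (gen s)
    then obtain c x where s: "s = (c, x)" "c \<in> carrier k" "x \<in> carrier A"
      by auto
    have "\<ominus>\<^bsub>T\<^esub> pure c x = inv\<^bsub>TP\<^esub> (pure c x)"
      using pure_closed[OF s(2,3)] T.l_neg[OF pure_closed[OF s(2,3)]] T.a_inv_closed[OF pure_closed[OF s(2,3)]]
      by (simp add: Q.inv_equality carrier_T add_T zero_T)
    then show ?case
      using s pure[of c x] pure[of "\<ominus>\<^bsub>k\<^esub> c" x] by (simp add: pure_inv pure_def[symmetric])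
  next
    case one
    then show ?case
      using pure[of "\<zero>\<^bsub>k\<^esub>" "\<one>\<^bsub>A\<^esub>"] by (simp add: pure_zero_left zero_T)
  next
    case (mult X Y)
    then show ?case
      using add by (simp add: add_T carrier_T Q.inv_mult)
  qed simp
  then show ?thesis by simp
qed

lemma smult_class:
  assumes c: "c \<in> carrier k" and p: "Poly_Mapping.keys p \<subseteq> gens"
  shows "c \<odot>\<^bsub>T\<^esub> ab_class gens (tensor_rels k A) p =
    ab_class gens (tensor_rels k A) (frag_extend (\<lambda>a. frag_of (c \<otimes>\<^bsub>k\<^esub> fst a, snd a)) p)"
proof -
  \<comment> \<open>Multiplying the scalars by \<open>c\<close> sends each defining relation to a
    relation of the same kind.\<close>
  have "frag_extend (\<lambda>a. frag_of (c \<otimes>\<^bsub>k\<^esub> fst a, snd a)) r \<in> P.null" if "r \<in> tensor_rels k A" for r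
  proof (rule P.null_rels)
    from that consider d e x where "d \<in> carrier k" "e \<in> carrier k" "x \<in> carrier A"
        "r = frag_of (d \<oplus>\<^bsub>k\<^esub> e, x) - frag_of (d, x) - frag_of (e, x)"
      | d x y where "d \<in> carrier k" "x \<in> carrier A" "y \<in> carrier A"
        "r = frag_of (d, x \<otimes>\<^bsub>A\<^esub> y) - frag_of (d, x) - frag_of (d, y)"
      unfolding tensor_rels_def by blast
    then show "frag_extend (\<lambda>a. frag_of (c \<otimes>\<^bsub>k\<^esub> fst a, snd a)) r \<in> tensor_rels k A"
    proof cases
      case 1
      then show ?thesis
        unfolding tensor_rels_def using c
        by (intro UnI1 CollectI exI[of _ "c \<otimes>\<^bsub>k\<^esub> d"] exI[of _ "c \<otimes>\<^bsub>k\<^esub> e"] exI[of _ x])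
          (simp add: frag_extend_diff k.r_distr)
    next
      case 2
      then show ?thesis
        unfolding tensor_rels_def using c
        by (intro UnI2 CollectI exI[of _ "c \<otimes>\<^bsub>k\<^esub> d"] exI[of _ x] exI[of _ y])
          (simp add: frag_extend_diff)
    qed
  qed
  then show ?thesis
    unfolding smult_T case_prod_unfold
    using P.presentation_axioms c p by (intro ab_lin_class) auto
qed

lemma smult_pure:
  "\<lbrakk>c \<in> carrier k; d \<in> carrier k; x \<in> carrier A\<rbrakk> \<Longrightarrow> c \<odot>\<^bsub>T\<^esub> pure d x = pure (c \<otimes>\<^bsub>k\<^esub> d) x"
  unfolding pure_def by (subst smult_class) simp_all

lemma smult_add:
  assumes "c \<in> carrier k" "s \<in> carrier T" "t \<in> carrier T"
  shows "c \<odot>\<^bsub>T\<^esub> (s \<oplus>\<^bsub>T\<^esub> t) = c \<odot>\<^bsub>T\<^esub> s \<oplus>\<^bsub>T\<^esub> c \<odot>\<^bsub>T\<^esub> t"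
proof -
  let ?f = "frag_extend (\<lambda>a. frag_of (c \<otimes>\<^bsub>k\<^esub> fst a, snd a))"
  obtain p q where pq: "Poly_Mapping.keys p \<subseteq> gens" "Poly_Mapping.keys q \<subseteq> gens"
    "s = ab_class gens (tensor_rels k A) p" "t = ab_class gens (tensor_rels k A) q"
    using assms(2,3) unfolding carrier_T by (elim P.carrier_presE)
  have "Poly_Mapping.keys (p + q) \<subseteq> gens"
    using pq(1,2) Poly_Mapping.keys_add[of p q] by blast
  moreover have "Poly_Mapping.keys (?f r) \<subseteq> gens" if "Poly_Mapping.keys r \<subseteq> gens" for r
    using keys_frag_extend[of "\<lambda>a. frag_of (c \<otimes>\<^bsub>k\<^esub> fst a, snd a)" r] that assms(1) by fastforce
  ultimately show ?thesis
    using pq assms(1) by (simp add: add_T P.class_add smult_class frag_extend_add)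
qed

lemma module_T: "module k T"
proof (rule moduleI)
  have closed: "c \<odot>\<^bsub>T\<^esub> t \<in> carrier T" if "c \<in> carrier k" "t \<in> carrier T" for c t
    using that(2)
    by (induction rule: T_induct) (use that(1) in \<open>simp_all add: smult_pure smult_add pure_closed\<close>)
  then show "\<And>c t. \<lbrakk>c \<in> carrier k; t \<in> carrier T\<rbrakk> \<Longrightarrow> c \<odot>\<^bsub>T\<^esub> t \<in> carrier T" .
  show "(c \<oplus>\<^bsub>k\<^esub> d) \<odot>\<^bsub>T\<^esub> t = c \<odot>\<^bsub>T\<^esub> t \<oplus>\<^bsub>T\<^esub> d \<odot>\<^bsub>T\<^esub> t" if "c \<in> carrier k" "d \<in> carrier k" "t \<in> carrier T" for c d t
    using that(3)
  proof (induction rule: T_induct)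
    case (add s t)
    then show ?case
      using that(1,2) closed by (simp add: smult_add T.a_ac)
  qed (use that(1,2) in \<open>simp add: smult_pure k.l_distr pure_add_left\<close>)
  show "(c \<otimes>\<^bsub>k\<^esub> d) \<odot>\<^bsub>T\<^esub> t = c \<odot>\<^bsub>T\<^esub> (d \<odot>\<^bsub>T\<^esub> t)" if "c \<in> carrier k" "d \<in> carrier k" "t \<in> carrier T" for c d t
    using that(3) by (induction rule: T_induct) (use that(1,2) closed in \<open>simp_all add: smult_pure smult_add k.m_assoc\<close>)
  show "\<one>\<^bsub>k\<^esub> \<odot>\<^bsub>T\<^esub> t = t" if "t \<in> carrier T" for t
    using that by (induction rule: T_induct) (simp_all add: smult_pure smult_add)
qed (auto simp: smult_add k.is_cring abelian_group_T)

end

section \<open>Finite bisets up to isomorphism\<close>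

lemma finite_bisetD:
  assumes "finite_biset G H U"
  shows biset_finite: "finite (points U)"
    and lact_closed: "\<lbrakk>g \<in> carrier G; u \<in> points U\<rbrakk> \<Longrightarrow> lact U g u \<in> points U"
    and lact_one: "u \<in> points U \<Longrightarrow> lact U \<one>\<^bsub>G\<^esub> u = u"
    and lact_mult: "\<lbrakk>g \<in> carrier G; g' \<in> carrier G; u \<in> points U\<rbrakk> \<Longrightarrow> lact U (g \<otimes>\<^bsub>G\<^esub> g') u = lact U g (lact U g' u)"
    and ract_closed: "\<lbrakk>h \<in> carrier H; u \<in> points U\<rbrakk> \<Longrightarrow> ract U u h \<in> points U"
    and ract_one: "u \<in> points U \<Longrightarrow> ract U u \<one>\<^bsub>H\<^esub> = u"
    and ract_mult: "\<lbrakk>h \<in> carrier H; h' \<in> carrier H; u \<in> points U\<rbrakk> \<Longrightarrow> ract U u (h \<otimes>\<^bsub>H\<^esub> h') = ract U (ract U u h) h'"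
    and lact_ract: "\<lbrakk>g \<in> carrier G; h \<in> carrier H; u \<in> points U\<rbrakk> \<Longrightarrow> ract U (lact U g u) h = lact U g (ract U u h)"
  using assms by (auto simp: finite_biset_def)

text \<open>The isomorphisms between tensor products below come from parametrising both sides by a common
  index set, which avoids choosing representatives of classes.\<close>

lemma biset_isomorphicI:
  fixes \<alpha> :: "'i \<Rightarrow> 'u" and \<beta> :: "'i \<Rightarrow> 'v"
  assumes \<alpha>: "\<alpha> ` I = points U" and \<beta>: "\<beta> ` I = points V"
    and eq: "\<And>i j. \<lbrakk>i \<in> I; j \<in> I\<rbrakk> \<Longrightarrow> \<alpha> i = \<alpha> j \<longleftrightarrow> \<beta> i = \<beta> j"
    and l: "\<And>g i. \<lbrakk>g \<in> carrier G; i \<in> I\<rbrakk> \<Longrightarrow> \<exists>j \<in> I. \<alpha> j = lact U g (\<alpha> i) \<and> \<beta> j = lact V g (\<beta> i)"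
    and r: "\<And>h i. \<lbrakk>h \<in> carrier H; i \<in> I\<rbrakk> \<Longrightarrow> \<exists>j \<in> I. \<alpha> j = ract U (\<alpha> i) h \<and> \<beta> j = ract V (\<beta> i) h"
  shows "biset_isomorphic G H U V"
proof -
  define \<phi> where "\<phi> x = \<beta> (inv_into I \<alpha> x)" for x
  have \<phi>: "\<phi> (\<alpha> i) = \<beta> i" if "i \<in> I" for i
    unfolding \<phi>_def
    using eq[OF inv_into_into[of "\<alpha> i" \<alpha> I] that] f_inv_into_f[of "\<alpha> i" \<alpha> I] that by auto
  have "inj_on \<phi> (points U)" "\<phi> ` points U = points V"
    using eq \<phi> by (auto simp: \<alpha>[symmetric] \<beta>[symmetric] inj_on_def image_image)
  then show ?thesis
    unfolding biset_isomorphic_def bij_betw_def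
  proof (intro exI[of _ \<phi>] conjI ballI)
    fix g u assume "g \<in> carrier G" "u \<in> points U"
    then show "\<phi> (lact U g u) = lact V g (\<phi> u)"
      using l[of g] \<phi> \<alpha> by (metis (no_types, lifting) imageE)
  next
    fix h u assume "h \<in> carrier H" "u \<in> points U"
    then show "\<phi> (ract U u h) = ract V (\<phi> u) h"
      using r[of h] \<phi> \<alpha> by (metis (no_types, lifting) imageE)
  qed
qed

lemma biset_isomorphicE:
  assumes "biset_isomorphic G H U V"
  obtains \<phi> where "bij_betw \<phi> (points U) (points V)"
    "\<And>g u. \<lbrakk>g \<in> carrier G; u \<in> points U\<rbrakk> \<Longrightarrow> \<phi> (lact U g u) = lact V g (\<phi> u)"
    "\<And>h u. \<lbrakk>h \<in> carrier H; u \<in> points U\<rbrakk> \<Longrightarrow> \<phi> (ract U u h) = ract V (\<phi> u) h"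
  using assms by (auto simp: biset_isomorphic_def)

text \<open>The criterion is applied with \<open>points U\<close> as index set and with
  \<open>\<phi>\<close> and the identity as the two parametrisations, so no inverse map has to be
  written down.\<close>

lemma biset_isomorphic_sym:
  assumes U: "finite_biset G H U" and iso: "biset_isomorphic G H U V"
  shows "biset_isomorphic G H V U"
proof -
  obtain \<phi> where \<phi>: "bij_betw \<phi> (points U) (points V)"
    "\<And>g u. \<lbrakk>g \<in> carrier G; u \<in> points U\<rbrakk> \<Longrightarrow> \<phi> (lact U g u) = lact V g (\<phi> u)"
    "\<And>h u. \<lbrakk>h \<in> carrier H; u \<in> points U\<rbrakk> \<Longrightarrow> \<phi> (ract U u h) = ract V (\<phi> u) h"
    using iso by (rule biset_isomorphicE) blast
  show ?thesis
    by (rule biset_isomorphicI[where I = "points U" and \<alpha> = \<phi> and \<beta> = "\<lambda>u. u"])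
      (use \<phi> lact_closed[OF U] ract_closed[OF U] in
        \<open>auto simp: bij_betw_def inj_on_def intro!: bexI[of _ "lact U _ _"] bexI[of _ "ract U _ _"]\<close>)
qed

lemma biset_isomorphic_trans:
  assumes "biset_isomorphic G H U V" "biset_isomorphic G H V W"
  shows "biset_isomorphic G H U W"
proof -
  obtain \<phi> where \<phi>: "bij_betw \<phi> (points U) (points V)"
    "\<And>g u. \<lbrakk>g \<in> carrier G; u \<in> points U\<rbrakk> \<Longrightarrow> \<phi> (lact U g u) = lact V g (\<phi> u)"
    "\<And>h u. \<lbrakk>h \<in> carrier H; u \<in> points U\<rbrakk> \<Longrightarrow> \<phi> (ract U u h) = ract V (\<phi> u) h"
    using assms(1) by (rule biset_isomorphicE) blast
  obtain \<psi> where \<psi>: "bij_betw \<psi> (points V) (points W)"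
    "\<And>g u. \<lbrakk>g \<in> carrier G; u \<in> points V\<rbrakk> \<Longrightarrow> \<psi> (lact V g u) = lact W g (\<psi> u)"
    "\<And>h u. \<lbrakk>h \<in> carrier H; u \<in> points V\<rbrakk> \<Longrightarrow> \<psi> (ract V u h) = ract W (\<psi> u) h"
    using assms(2) by (rule biset_isomorphicE) blast
  have "\<phi> u \<in> points V" if "u \<in> points U" for u
    using \<phi>(1) that by (auto simp: bij_betw_def)
  then show ?thesis
    unfolding biset_isomorphic_def using \<phi> \<psi>
    by (intro exI[of _ "\<psi> \<circ> \<phi>"]) (auto intro: bij_betw_trans)
qed

text \<open>This makes the \<open>iso_class\<close> of a biset over an arbitrary type nonempty, and
  it lets statements about generators be reduced to bisets on natural numbers. The actions are
  transported along an injection.\<close>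

lemma biset_nat_copy:
  assumes U: "finite_biset G H U"
  obtains X :: "('g, 'h, nat) biset" where "finite_biset G H X" "biset_isomorphic G H U X"
proof -
  obtain f :: "_ \<Rightarrow> nat" where f: "inj_on f (points U)"
    using finite_imp_inj_to_nat_seg[OF biset_finite[OF U]] by blast
  define X where "X = \<lparr>points = f ` points U,
    lact = (\<lambda>g x. f (lact U g (inv_into (points U) f x))),
    ract = (\<lambda>x h. f (ract U (inv_into (points U) f x) h))\<rparr>"
  have "finite_biset G H X"
    using U f by (auto simp: finite_biset_def X_def)
  moreover have "biset_isomorphic G H U X"
    unfolding biset_isomorphic_def
    using f by (intro exI[of _ f]) (auto simp: X_def bij_betw_def)
  ultimately show thesis
    using that by blast
qed

section \<open>The product of two bisets over the middle group\<close>

context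
  fixes G :: "'g monoid" and H :: "'h monoid" and K :: "'k monoid"
    and U :: "('g, 'h, 'u) biset" and W :: "('h, 'k, 'w) biset"
  assumes H: "group H" and U: "finite_biset G H U" and W: "finite_biset H K W"
begin

lemma balance_rel_iff:
  "((a, b), (c, d)) \<in> balance_rel H U W \<longleftrightarrow>
    c \<in> points U \<and> b \<in> points W \<and> (\<exists>h \<in> carrier H. a = ract U c h \<and> d = lact W h b)"
  by (auto simp: balance_rel_def)

lemma equiv_balance_rel: "equiv (points U \<times> points W) (balance_rel H U W)"
proof (rule equivI)
  show "refl_on (points U \<times> points W) (balance_rel H U W)"
    using group.is_monoid[OF H] monoid.one_closed[of H]
    by (auto simp: refl_on_def balance_rel_iff ract_one[OF U] lact_one[OF W] intro!: bexI[of _ "\<one>\<^bsub>H\<^esub>"])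
  show "balance_rel H U W \<subseteq> (points U \<times> points W) \<times> (points U \<times> points W)"
    by (auto simp: balance_rel_def ract_closed[OF U] lact_closed[OF W])
  show "sym (balance_rel H U W)"
  proof (rule symI, clarsimp simp: balance_rel_iff)
    fix c b h assume "c \<in> points U" "b \<in> points W" "h \<in> carrier H"
    then show "ract U c h \<in> points U \<and> lact W h b \<in> points W \<and>
      (\<exists>h'\<in>carrier H. c = ract U (ract U c h) h' \<and> b = lact W h' (lact W h b))"
      by (intro conjI bexI[of _ "inv\<^bsub>H\<^esub> h"])
        (simp_all add: ract_closed[OF U] lact_closed[OF W] ract_mult[OF U, symmetric] lact_mult[OF W, symmetric]
          group.inv_closed[OF H] group.r_inv[OF H] group.l_inv[OF H] ract_one[OF U] lact_one[OF W])
  qed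
  show "trans (balance_rel H U W)"
  proof (rule transI, clarsimp simp: balance_rel_iff)
    fix c b h h' assume "c \<in> points U" "b \<in> points W" "h \<in> carrier H" "h' \<in> carrier H"
    then show "\<exists>l\<in>carrier H. ract U (ract U c h') h = ract U c l \<and> lact W h' (lact W h b) = lact W l b"
      using group.is_monoid[OF H]
      by (intro bexI[of _ "h' \<otimes>\<^bsub>H\<^esub> h"]) (simp_all add: ract_mult[OF U] lact_mult[OF W] monoid.m_closed)
  qed
qed

text \<open>The point of the product represented by the pair, usually written as the tensor of
  \<open>u\<close> and \<open>w\<close> over \<open>H\<close>.\<close>

abbreviation cls where "cls u w \<equiv> balance_rel H U W `` {(u, w)}"

text \<open>The isomorphisms of products below rest on this criterion: equality of points on either
  side is turned into the existence of suitable group elements, and these existence statements are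
  compared.\<close>

lemma cls_eq_iff:
  assumes "u \<in> points U" "w \<in> points W" "u' \<in> points U" "w' \<in> points W"
  shows "cls u w = cls u' w' \<longleftrightarrow> (\<exists>h \<in> carrier H. u' = ract U u h \<and> w = lact W h w')"
proof -
  \<comment> \<open>Reversing the equation makes \<open>balance_rel_iff\<close> express
    \<open>u'\<close> through \<open>u\<close> and \<open>w\<close> through
    \<open>w'\<close>.\<close>
  have "cls u w = cls u' w' \<longleftrightarrow> cls u' w' = cls u w"
    by auto
  also have "\<dots> \<longleftrightarrow> ((u', w'), (u, w)) \<in> balance_rel H U W"
    using assms by (intro eq_equiv_class_iff[OF equiv_balance_rel]) auto
  finally show ?thesis
    using assms by (simp add: balance_rel_iff)
qed

lemma points_prod: "points (biset_prod H U W) = (\<lambda>(u, w). cls u w) ` (points U \<times> points W)"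
  by (auto simp: biset_prod_def quotient_def)

lemma cls_closed: "\<lbrakk>u \<in> points U; w \<in> points W\<rbrakk> \<Longrightarrow> cls u w \<in> points (biset_prod H U W)"
  by (auto simp: points_prod)

text \<open>The action on the product is defined as the image of a whole class, so this image must
  be shown to be a full class and not a part of one. The inclusion that is not immediate comes from
  acting with the inverse of \<open>g\<close>.\<close>

lemma lact_cls:
  assumes G: "group G" and "g \<in> carrier G" "u \<in> points U" "w \<in> points W"
  shows "lact (biset_prod H U W) g (cls u w) = cls (lact U g u) w"
proof -
  have "(\<lambda>(u, w). (lact U g u, w)) ` cls u w = cls (lact U g u) w"
  proof (intro equalityI subsetI)
    fix x assume "x \<in> (\<lambda>(u, w). (lact U g u, w)) ` cls u w"
    then obtain a b where "(a, b) \<in> cls u w" and x: "x = (lact U g a, b)"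
      by auto
    then show "x \<in> cls (lact U g u) w"
      unfolding x using assms
      by (auto simp: balance_rel_iff lact_closed[OF U] lact_ract[OF U])
  next
    fix x assume x: "x \<in> cls (lact U g u) w"
    obtain a b where ab: "x = (a, b)" by (cases x)
    then obtain h where h: "a \<in> points U" "h \<in> carrier H" "lact U g u = ract U a h" "b = lact W h w"
      using x assms by (auto simp: balance_rel_iff lact_closed[OF U])
    have "ract U (lact U (inv\<^bsub>G\<^esub> g) a) h = lact U (inv\<^bsub>G\<^esub> g) (lact U g u)"
      using h assms by (simp add: lact_ract[OF U] group.inv_closed)
    also have "\<dots> = u"
      using assms by (simp add: lact_mult[OF U, symmetric] group.inv_closed group.l_inv lact_one[OF U])
    finally have "(lact U (inv\<^bsub>G\<^esub> g) a, b) \<in> cls u w"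
      using h assms by (auto simp: balance_rel_iff lact_closed[OF U] group.inv_closed)
    moreover have "x = (lact U g (lact U (inv\<^bsub>G\<^esub> g) a), b)"
      using h assms by (simp add: ab lact_mult[OF U, symmetric] group.inv_closed group.r_inv lact_one[OF U])
    ultimately show "x \<in> (\<lambda>(u, w). (lact U g u, w)) ` cls u w"
      by force
  qed
  then show ?thesis
    by (simp only: biset_prod_def biset.simps)
qed

lemma ract_cls:
  assumes K: "group K" and "l \<in> carrier K" "u \<in> points U" "w \<in> points W"
  shows "ract (biset_prod H U W) (cls u w) l = cls u (ract W w l)"
proof -
  have "(\<lambda>(u, w). (u, ract W w l)) ` cls u w = cls u (ract W w l)"
  proof (intro equalityI subsetI)
    fix x assume "x \<in> (\<lambda>(u, w). (u, ract W w l)) ` cls u w"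
    then obtain a b where "(a, b) \<in> cls u w" and x: "x = (a, ract W b l)"
      by auto
    then show "x \<in> cls u (ract W w l)"
      unfolding x using assms
      by (auto simp: balance_rel_iff ract_closed[OF W] lact_ract[OF W])
  next
    fix x assume x: "x \<in> cls u (ract W w l)"
    obtain a b where ab: "x = (a, b)" by (cases x)
    then obtain h where h: "a \<in> points U" "h \<in> carrier H" "u = ract U a h" "b = lact W h (ract W w l)"
      using x assms by (auto simp: balance_rel_iff ract_closed[OF W])
    \<comment> \<open>No inverse of \<open>l\<close> enters here: members of the class have second
      coordinate \<open>h (w l) = (h w) l\<close>, which is already of the required form.\<close>
    then have "(a, lact W h w) \<in> cls u w"
      using assms by (auto simp: balance_rel_iff)
    moreover have "x = (a, ract W (lact W h w) l)"
      using h assms by (simp add: ab lact_ract[OF W])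
    ultimately show "x \<in> (\<lambda>(u, w). (u, ract W w l)) ` cls u w"
      by force
  qed
  then show ?thesis
    by (simp only: biset_prod_def biset.simps)
qed

lemma finite_biset_prod:
  assumes G: "group G" and K: "group K"
  shows "finite_biset G K (biset_prod H U W)"
proof -
  have "finite (points (biset_prod H U W))"
    by (simp add: points_prod biset_finite[OF U] biset_finite[OF W])
  then show ?thesis
    unfolding finite_biset_def
    using group.is_monoid[OF G] group.is_monoid[OF K]
    by (auto simp: points_prod lact_cls[OF G] ract_cls[OF K] lact_one[OF U] ract_one[OF W] lact_mult[OF U] ract_mult[OF W]
        lact_closed[OF U] ract_closed[OF W] monoid.m_closed monoid.one_closed)
qed

end

lemma biset_prod_cong:
  assumes H: "group H" and G: "group G" and K: "group K"
    and U: "finite_biset G H U" and W: "finite_biset H K W" and U': "finite_biset G H U'" and W': "finite_biset H K W'"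
    and "biset_isomorphic G H U U'" "biset_isomorphic H K W W'"
  shows "biset_isomorphic G K (biset_prod H U W) (biset_prod H U' W')"
proof -
  obtain \<phi> where \<phi>: "bij_betw \<phi> (points U) (points U')"
    "\<And>g u. \<lbrakk>g \<in> carrier G; u \<in> points U\<rbrakk> \<Longrightarrow> \<phi> (lact U g u) = lact U' g (\<phi> u)"
    "\<And>h u. \<lbrakk>h \<in> carrier H; u \<in> points U\<rbrakk> \<Longrightarrow> \<phi> (ract U u h) = ract U' (\<phi> u) h"
    using assms(8) by (rule biset_isomorphicE) blast
  obtain \<psi> where \<psi>: "bij_betw \<psi> (points W) (points W')"
    "\<And>g u. \<lbrakk>g \<in> carrier H; u \<in> points W\<rbrakk> \<Longrightarrow> \<psi> (lact W g u) = lact W' g (\<psi> u)"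
    "\<And>h u. \<lbrakk>h \<in> carrier K; u \<in> points W\<rbrakk> \<Longrightarrow> \<psi> (ract W u h) = ract W' (\<psi> u) h"
    using assms(9) by (rule biset_isomorphicE) blast
  have im: "\<phi> ` points U = points U'" "\<psi> ` points W = points W'"
    using \<phi>(1) \<psi>(1) by (auto simp: bij_betw_def)
  have mem: "\<And>u. u \<in> points U \<Longrightarrow> \<phi> u \<in> points U'" "\<And>w. w \<in> points W \<Longrightarrow> \<psi> w \<in> points W'"
    using im by auto
  have inj: "\<phi> u = \<phi> v \<longleftrightarrow> u = v" if "u \<in> points U" "v \<in> points U" for u v
    using \<phi>(1) that by (auto simp: bij_betw_def inj_on_def)
  have inj': "\<psi> u = \<psi> v \<longleftrightarrow> u = v" if "u \<in> points W" "v \<in> points W" for u v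
    using \<psi>(1) that by (auto simp: bij_betw_def inj_on_def)
  let ?\<alpha> = "\<lambda>(u, w). cls H U W u w" and ?\<beta> = "\<lambda>(u, w). cls H U' W' (\<phi> u) (\<psi> w)"
  show ?thesis
  proof (rule biset_isomorphicI[where I = "points U \<times> points W" and \<alpha> = ?\<alpha> and \<beta> = ?\<beta>])
    show "?\<beta> ` (points U \<times> points W) = points (biset_prod H U' W')"
      unfolding points_prod[OF H U' W'] im[symmetric] by force
  next
    fix i j assume "i \<in> points U \<times> points W" "j \<in> points U \<times> points W"
    then obtain u w u' w' where i: "i = (u, w)" "u \<in> points U" "w \<in> points W"
      and j: "j = (u', w')" "u' \<in> points U" "w' \<in> points W"
      by auto
    have "?\<alpha> i = ?\<alpha> j \<longleftrightarrow> (\<exists>h \<in> carrier H. u' = ract U u h \<and> w = lact W h w')"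
      using i j by (simp add: cls_eq_iff[OF H U W])
    also have "\<dots> \<longleftrightarrow> (\<exists>h \<in> carrier H. \<phi> u' = \<phi> (ract U u h) \<and> \<psi> w = \<psi> (lact W h w'))"
      using i j by (auto simp: inj inj' ract_closed[OF U] lact_closed[OF W])
    also have "\<dots> \<longleftrightarrow> ?\<beta> i = ?\<beta> j"
      using i j by (auto simp: cls_eq_iff[OF H U' W'] mem \<phi>(3) \<psi>(2))
    finally show "?\<alpha> i = ?\<alpha> j \<longleftrightarrow> ?\<beta> i = ?\<beta> j" .
  next
    fix g i assume "g \<in> carrier G" "i \<in> points U \<times> points W"
    then show "\<exists>j\<in>points U \<times> points W. ?\<alpha> j = lact (biset_prod H U W) g (?\<alpha> i) \<and> ?\<beta> j = lact (biset_prod H U' W') g (?\<beta> i)"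
      by (intro bexI[of _ "(lact U g (fst i), snd i)"])
        (auto simp: lact_cls[OF H U W G] lact_cls[OF H U' W' G] mem \<phi>(2) lact_closed[OF U])
  next
    fix l i assume "l \<in> carrier K" "i \<in> points U \<times> points W"
    then show "\<exists>j\<in>points U \<times> points W. ?\<alpha> j = ract (biset_prod H U W) (?\<alpha> i) l \<and> ?\<beta> j = ract (biset_prod H U' W') (?\<beta> i) l"
      by (intro bexI[of _ "(fst i, ract W (snd i) l)"])
        (auto simp: ract_cls[OF H U W K] ract_cls[OF H U' W' K] mem \<psi>(3) ract_closed[OF W])
  qed (simp add: points_prod[OF H U W])
qed

lemma biset_prod_assoc:
  assumes G: "group G" and H: "group H" and K: "group K" and L: "group L"
    and U: "finite_biset G H U" and V: "finite_biset H K V" and W: "finite_biset K L W"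
  shows "biset_isomorphic G L (biset_prod K (biset_prod H U V) W) (biset_prod H U (biset_prod K V W))"
proof -
  note UV = finite_biset_prod[OF H U V G K] and VW = finite_biset_prod[OF K V W H L]
  let ?\<alpha> = "\<lambda>(u, v, w). cls K (biset_prod H U V) W (cls H U V u v) w"
  let ?\<beta> = "\<lambda>(u, v, w). cls H U (biset_prod K V W) u (cls K V W v w)"
  let ?I = "points U \<times> points V \<times> points W"
  note simps = lact_cls[OF K UV W G] ract_cls[OF K UV W L] lact_cls[OF H U VW G] ract_cls[OF H U VW L]
    lact_cls[OF H U V G] ract_cls[OF H U V K] lact_cls[OF K V W H] ract_cls[OF K V W L]
    cls_closed[OF H U V] cls_closed[OF K V W]
    lact_closed[OF U] lact_closed[OF V] ract_closed[OF V] ract_closed[OF U] ract_closed[OF W] lact_closed[OF W]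
  show ?thesis
  proof (rule biset_isomorphicI[where I = ?I and \<alpha> = ?\<alpha> and \<beta> = ?\<beta>])
    show "?\<alpha> ` ?I = points (biset_prod K (biset_prod H U V) W)"
      unfolding points_prod[OF K UV W] points_prod[OF H U V] by force
    show "?\<beta> ` ?I = points (biset_prod H U (biset_prod K V W))"
      unfolding points_prod[OF H U VW] points_prod[OF K V W] by force
  next
    fix i j assume "i \<in> ?I" "j \<in> ?I"
    then obtain u v w u' v' w' where i: "i = (u, v, w)" "u \<in> points U" "v \<in> points V" "w \<in> points W"
      and j: "j = (u', v', w')" "u' \<in> points U" "v' \<in> points V" "w' \<in> points W"
      by auto
    \<comment> \<open>Both bracketings lead to the same condition: there are \<open>h\<close> and
      \<open>k\<close> with \<open>u' = u h\<close>, \<open>v k = h v'\<close> and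
      \<open>w = k w'\<close>.\<close>
    have "?\<alpha> i = ?\<alpha> j \<longleftrightarrow>
        (\<exists>h \<in> carrier H. \<exists>k \<in> carrier K. u' = ract U u h \<and> ract V v k = lact V h v' \<and> w = lact W k w')"
      using i j by (auto simp: cls_eq_iff[OF K UV W] simps cls_eq_iff[OF H U V] eq_commute[of "cls H U V u' v'"])
    also have "\<dots> \<longleftrightarrow>
        (\<exists>h \<in> carrier H. u' = ract U u h \<and> (\<exists>k \<in> carrier K. lact V h v' = ract V v k \<and> w = lact W k w'))"
      by metis
    also have "\<dots> \<longleftrightarrow> ?\<beta> i = ?\<beta> j"
      using i j by (simp add: cls_eq_iff[OF H U VW] simps cls_eq_iff[OF K V W])
    finally show "?\<alpha> i = ?\<alpha> j \<longleftrightarrow> ?\<beta> i = ?\<beta> j" .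
  next
    fix g i assume "g \<in> carrier G" "i \<in> ?I"
    then show "\<exists>j\<in>?I. ?\<alpha> j = lact (biset_prod K (biset_prod H U V) W) g (?\<alpha> i) \<and>
        ?\<beta> j = lact (biset_prod H U (biset_prod K V W)) g (?\<beta> i)"
      by (intro bexI[of _ "(lact U g (fst i), snd i)"]) (auto simp: simps)
  next
    fix l i assume "l \<in> carrier L" "i \<in> ?I"
    then show "\<exists>j\<in>?I. ?\<alpha> j = ract (biset_prod K (biset_prod H U V) W) (?\<alpha> i) l \<and>
        ?\<beta> j = ract (biset_prod H U (biset_prod K V W)) (?\<beta> i) l"
      by (intro bexI[of _ "(fst i, fst (snd i), ract W (snd (snd i)) l)"]) (auto simp: simps)
  qed
qed

lemma finite_biset_id: "\<lbrakk>group G; finite (carrier G)\<rbrakk> \<Longrightarrow> finite_biset G G (id_biset G)"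
  by (auto simp: finite_biset_def id_biset_def group_def monoid.m_assoc monoid.m_closed)

lemma biset_prod_id_left:
  assumes G: "group G" "finite (carrier G)" and H: "group H" and U: "finite_biset G H U"
  shows "biset_isomorphic G H (biset_prod G (id_biset G) U) U"
proof -
  interpret G: group G by fact
  note I = finite_biset_id[OF G]
  have I_simps: "points (id_biset G) = carrier G" "lact (id_biset G) g x = g \<otimes>\<^bsub>G\<^esub> x" "ract (id_biset G) x g = x \<otimes>\<^bsub>G\<^esub> g" for g x
    by (simp_all add: id_biset_def)
  let ?\<alpha> = "\<lambda>(x, u). cls G (id_biset G) U x u" and ?\<beta> = "\<lambda>(x, u). lact U x u"
  let ?I = "carrier G \<times> points U"
  show ?thesis
  proof (rule biset_isomorphicI[where I = ?I and \<alpha> = ?\<alpha> and \<beta> = ?\<beta>])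
    show "?\<alpha> ` ?I = points (biset_prod G (id_biset G) U)"
      by (simp add: points_prod[OF G(1) I U] I_simps)
    show "?\<beta> ` ?I = points U"
      using lact_one[OF U] lact_closed[OF U] by (force simp: image_iff)
  next
    fix i j assume "i \<in> ?I" "j \<in> ?I"
    then obtain x u x' u' where i: "i = (x, u)" "x \<in> carrier G" "u \<in> points U"
      and j: "j = (x', u')" "x' \<in> carrier G" "u' \<in> points U"
      by auto
    have "?\<alpha> i = ?\<alpha> j \<longleftrightarrow> (\<exists>h \<in> carrier G. x' = x \<otimes>\<^bsub>G\<^esub> h \<and> u = lact U h u')"
      using i j by (simp add: cls_eq_iff[OF G(1) I U] I_simps)
    also have "\<dots> \<longleftrightarrow> ?\<beta> i = ?\<beta> j"
    proof
      assume eq: "?\<beta> i = ?\<beta> j"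
      \<comment> \<open>The element \<open>h\<close> is forced by \<open>x' = x h\<close>; that it
        also relates \<open>u\<close> and \<open>u'\<close> is exactly the equality of the two
        values in \<open>U\<close>.\<close>
      have "u = lact U (inv\<^bsub>G\<^esub> x) (lact U x u)"
        using i by (simp add: lact_mult[OF U, symmetric] lact_one[OF U])
      also have "\<dots> = lact U (inv\<^bsub>G\<^esub> x \<otimes>\<^bsub>G\<^esub> x') u'"
        using i j eq by (simp add: lact_mult[OF U])
      finally show "\<exists>h \<in> carrier G. x' = x \<otimes>\<^bsub>G\<^esub> h \<and> u = lact U h u'"
        using i j by (intro bexI[of _ "inv\<^bsub>G\<^esub> x \<otimes>\<^bsub>G\<^esub> x'"]) (auto simp: G.m_assoc[symmetric])
    qed (use i j in \<open>auto simp: lact_mult[OF U]\<close>)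
    finally show "?\<alpha> i = ?\<alpha> j \<longleftrightarrow> ?\<beta> i = ?\<beta> j" .
  next
    fix g i assume "g \<in> carrier G" "i \<in> ?I"
    then show "\<exists>j\<in>?I. ?\<alpha> j = lact (biset_prod G (id_biset G) U) g (?\<alpha> i) \<and> ?\<beta> j = lact U g (?\<beta> i)"
      by (intro bexI[of _ "(g \<otimes>\<^bsub>G\<^esub> fst i, snd i)"])
        (auto simp: lact_cls[OF G(1) I U G(1)] I_simps lact_mult[OF U])
  next
    fix l i assume "l \<in> carrier H" "i \<in> ?I"
    then show "\<exists>j\<in>?I. ?\<alpha> j = ract (biset_prod G (id_biset G) U) (?\<alpha> i) l \<and> ?\<beta> j = ract U (?\<beta> i) l"
      by (intro bexI[of _ "(fst i, ract U (snd i) l)"])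
        (auto simp: ract_cls[OF G(1) I U H] I_simps lact_ract[OF U] ract_closed[OF U])
  qed
qed

lemma biset_prod_id_right:
  assumes G: "group G" and H: "group H" "finite (carrier H)" and U: "finite_biset G H U"
  shows "biset_isomorphic G H (biset_prod H U (id_biset H)) U"
proof -
  interpret H: group H by fact
  note I = finite_biset_id[OF H]
  have I_simps: "points (id_biset H) = carrier H" "lact (id_biset H) g x = g \<otimes>\<^bsub>H\<^esub> x" "ract (id_biset H) x g = x \<otimes>\<^bsub>H\<^esub> g" for g x
    by (simp_all add: id_biset_def)
  let ?\<alpha> = "\<lambda>(u, x). cls H U (id_biset H) u x" and ?\<beta> = "\<lambda>(u, x). ract U u x"
  let ?I = "points U \<times> carrier H"
  show ?thesis
  proof (rule biset_isomorphicI[where I = ?I and \<alpha> = ?\<alpha> and \<beta> = ?\<beta>])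
    show "?\<alpha> ` ?I = points (biset_prod H U (id_biset H))"
      by (simp add: points_prod[OF H(1) U I] I_simps)
    show "?\<beta> ` ?I = points U"
      using ract_one[OF U] ract_closed[OF U] by (force simp: image_iff)
  next
    fix i j assume "i \<in> ?I" "j \<in> ?I"
    then obtain x u x' u' where i: "i = (u, x)" "x \<in> carrier H" "u \<in> points U"
      and j: "j = (u', x')" "x' \<in> carrier H" "u' \<in> points U"
      by auto
    have "?\<alpha> i = ?\<alpha> j \<longleftrightarrow> (\<exists>h \<in> carrier H. u' = ract U u h \<and> x = h \<otimes>\<^bsub>H\<^esub> x')"
      using i j by (simp add: cls_eq_iff[OF H(1) U I] I_simps)
    also have "\<dots> \<longleftrightarrow> ?\<beta> i = ?\<beta> j"
    proof
      assume eq: "?\<beta> i = ?\<beta> j"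
      \<comment> \<open>Here the second coordinates force \<open>h\<close>, through
        \<open>x = h x'\<close>.\<close>
      have "u' = ract U (ract U u' x') (inv\<^bsub>H\<^esub> x')"
        using j by (simp add: ract_mult[OF U, symmetric] ract_one[OF U])
      also have "\<dots> = ract U u (x \<otimes>\<^bsub>H\<^esub> inv\<^bsub>H\<^esub> x')"
        using i j eq by (simp add: ract_mult[OF U])
      finally show "\<exists>h \<in> carrier H. u' = ract U u h \<and> x = h \<otimes>\<^bsub>H\<^esub> x'"
        using i j by (intro bexI[of _ "x \<otimes>\<^bsub>H\<^esub> inv\<^bsub>H\<^esub> x'"]) (auto simp: H.m_assoc)
    qed (use i j in \<open>auto simp: ract_mult[OF U]\<close>)
    finally show "?\<alpha> i = ?\<alpha> j \<longleftrightarrow> ?\<beta> i = ?\<beta> j" .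
  next
    fix g i assume "g \<in> carrier G" "i \<in> ?I"
    then show "\<exists>j\<in>?I. ?\<alpha> j = lact (biset_prod H U (id_biset H)) g (?\<alpha> i) \<and> ?\<beta> j = lact U g (?\<beta> i)"
      by (intro bexI[of _ "(lact U g (fst i), snd i)"])
        (auto simp: lact_cls[OF H(1) U I G] I_simps lact_ract[OF U] lact_closed[OF U])
  next
    fix l i assume "l \<in> carrier H" "i \<in> ?I"
    then show "\<exists>j\<in>?I. ?\<alpha> j = ract (biset_prod H U (id_biset H)) (?\<alpha> i) l \<and> ?\<beta> j = ract U (?\<beta> i) l"
      by (intro bexI[of _ "(fst i, snd i \<otimes>\<^bsub>H\<^esub> l)"])
        (auto simp: ract_cls[OF H(1) U I H(1)] I_simps ract_mult[OF U])
  qed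
qed

section \<open>Disjoint unions of bisets and distributivity of the product\<close>

lemma union_simps:
  "Inl a \<in> P <+> Q \<longleftrightarrow> a \<in> P" "Inr b \<in> P <+> Q \<longleftrightarrow> b \<in> Q"
  "points (biset_union A B) = points A <+> points B"
  "lact (biset_union A B) g (Inl a) = Inl (lact A g a)" "lact (biset_union A B) g (Inr b) = Inr (lact B g b)"
  "ract (biset_union A B) (Inl a) h = Inl (ract A a h)" "ract (biset_union A B) (Inr b) h = Inr (ract B b h)"
  by (auto simp: biset_union_def)

lemma finite_biset_union:
  assumes "finite_biset G H U" "finite_biset G H V"
  shows "finite_biset G H (biset_union U V)"
  using assms unfolding finite_biset_def
  by (simp add: union_simps) (safe; simp add: union_simps)

lemma biset_union_cong:
  assumes "biset_isomorphic G H U U'" "biset_isomorphic G H V V'"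
  shows "biset_isomorphic G H (biset_union U V) (biset_union U' V')"
proof -
  obtain \<phi> where \<phi>: "bij_betw \<phi> (points U) (points U')"
    "\<And>g u. \<lbrakk>g \<in> carrier G; u \<in> points U\<rbrakk> \<Longrightarrow> \<phi> (lact U g u) = lact U' g (\<phi> u)"
    "\<And>h u. \<lbrakk>h \<in> carrier H; u \<in> points U\<rbrakk> \<Longrightarrow> \<phi> (ract U u h) = ract U' (\<phi> u) h"
    using assms(1) by (rule biset_isomorphicE) blast
  obtain \<psi> where \<psi>: "bij_betw \<psi> (points V) (points V')"
    "\<And>g u. \<lbrakk>g \<in> carrier G; u \<in> points V\<rbrakk> \<Longrightarrow> \<psi> (lact V g u) = lact V' g (\<psi> u)"
    "\<And>h u. \<lbrakk>h \<in> carrier H; u \<in> points V\<rbrakk> \<Longrightarrow> \<psi> (ract V u h) = ract V' (\<psi> u) h"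
    using assms(2) by (rule biset_isomorphicE) blast
  have "bij_betw (map_sum \<phi> \<psi>) (points U <+> points V) (points U' <+> points V')"
  proof (rule bij_betw_imageI)
    show "inj_on (map_sum \<phi> \<psi>) (points U <+> points V)"
      using \<phi>(1)[THEN bij_betw_imp_inj_on] \<psi>(1)[THEN bij_betw_imp_inj_on]
      by (auto intro!: inj_onI dest: inj_onD)
    have "map_sum \<phi> \<psi> ` (points U <+> points V) = \<phi> ` points U <+> \<psi> ` points V"
      by (simp add: Plus_def image_Un image_image)
    then show "map_sum \<phi> \<psi> ` (points U <+> points V) = points U' <+> points V'"
      using \<phi>(1) \<psi>(1) by (simp add: bij_betw_def)
  qed
  then show ?thesis
    unfolding biset_isomorphic_def using \<phi> \<psi>
    by (intro exI[of _ "map_sum \<phi> \<psi>"]) (auto simp: biset_union_def)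
qed

text \<open>Actions never move a point to the other summand. So an element balancing two pairs
  exists only if both lie on the same side, and there it balances them in the corresponding
  product.\<close>

lemma biset_prod_union_left:
  assumes G: "group G" and H: "group H" and K: "group K"
    and U: "finite_biset G H U" and V: "finite_biset G H V" and W: "finite_biset H K W"
  shows "biset_isomorphic G K (biset_prod H (biset_union U V) W) (biset_union (biset_prod H U W) (biset_prod H V W))"
proof -
  note UV = finite_biset_union[OF U V]
  let ?\<alpha> = "\<lambda>(s, w). cls H (biset_union U V) W s w"
  let ?\<beta> = "\<lambda>(s, w). map_sum (\<lambda>u. cls H U W u w) (\<lambda>v. cls H V W v w) s"
  let ?I = "(points U <+> points V) \<times> points W"
  note simps = union_simps lact_cls[OF H UV W G] ract_cls[OF H UV W K] lact_cls[OF H U W G] ract_cls[OF H U W K]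
    lact_cls[OF H V W G] ract_cls[OF H V W K]
    lact_closed[OF U] lact_closed[OF V] ract_closed[OF V] ract_closed[OF U] ract_closed[OF W] lact_closed[OF W]
  show ?thesis
  proof (rule biset_isomorphicI[where I = ?I and \<alpha> = ?\<alpha> and \<beta> = ?\<beta>])
    show "?\<alpha> ` ?I = points (biset_prod H (biset_union U V) W)"
      by (simp add: points_prod[OF H UV W] union_simps)
    show "?\<beta> ` ?I = points (biset_union (biset_prod H U W) (biset_prod H V W))"
      unfolding union_simps points_prod[OF H U W] points_prod[OF H V W] by (force simp: image_iff)
  next
    fix i j assume "i \<in> ?I" "j \<in> ?I"
    then obtain x w x' w' where i: "i = (x, w)" "x \<in> points U <+> points V" "w \<in> points W"
      and j: "j = (x', w')" "x' \<in> points U <+> points V" "w' \<in> points W"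
      by auto
    then have "?\<alpha> i = ?\<alpha> j \<longleftrightarrow> (\<exists>h \<in> carrier H. x' = ract (biset_union U V) x h \<and> w = lact W h w')"
      by (simp add: cls_eq_iff[OF H UV W] union_simps)
    also have "\<dots> \<longleftrightarrow> ?\<beta> i = ?\<beta> j"
      using i j by (cases x; cases x')
        (simp_all add: cls_eq_iff[OF H U W] cls_eq_iff[OF H V W] union_simps )
    finally show "?\<alpha> i = ?\<alpha> j \<longleftrightarrow> ?\<beta> i = ?\<beta> j" .
  next
    fix g i assume "g \<in> carrier G" "i \<in> ?I"
    then show "\<exists>j\<in>?I. ?\<alpha> j = lact (biset_prod H (biset_union U V) W) g (?\<alpha> i) \<and>
        ?\<beta> j = lact (biset_union (biset_prod H U W) (biset_prod H V W)) g (?\<beta> i)"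
      by (intro bexI[of _ "(lact (biset_union U V) g (fst i), snd i)"]) (auto simp: simps)
  next
    fix l i assume "l \<in> carrier K" "i \<in> ?I"
    then show "\<exists>j\<in>?I. ?\<alpha> j = ract (biset_prod H (biset_union U V) W) (?\<alpha> i) l \<and>
        ?\<beta> j = ract (biset_union (biset_prod H U W) (biset_prod H V W)) (?\<beta> i) l"
      by (intro bexI[of _ "(fst i, ract W (snd i) l)"]) (auto simp: simps)
  qed
qed

lemma biset_prod_union_right:
  assumes G: "group G" and H: "group H" and K: "group K"
    and U: "finite_biset G H U" and V: "finite_biset H K V" and W: "finite_biset H K W"
  shows "biset_isomorphic G K (biset_prod H U (biset_union V W)) (biset_union (biset_prod H U V) (biset_prod H U W))"
proof -
  note VW = finite_biset_union[OF V W]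
  let ?\<alpha> = "\<lambda>(u, s). cls H U (biset_union V W) u s"
  let ?\<beta> = "\<lambda>(u, s). map_sum (\<lambda>v. cls H U V u v) (\<lambda>w. cls H U W u w) s"
  let ?I = "points U \<times> (points V <+> points W)"
  note simps = union_simps lact_cls[OF H U VW G] ract_cls[OF H U VW K] lact_cls[OF H U V G] ract_cls[OF H U V K]
    lact_cls[OF H U W G] ract_cls[OF H U W K]
    lact_closed[OF U] lact_closed[OF V] ract_closed[OF V] ract_closed[OF U] ract_closed[OF W] lact_closed[OF W]
  show ?thesis
  proof (rule biset_isomorphicI[where I = ?I and \<alpha> = ?\<alpha> and \<beta> = ?\<beta>])
    show "?\<alpha> ` ?I = points (biset_prod H U (biset_union V W))"
      by (simp add: points_prod[OF H U VW] union_simps)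
    show "?\<beta> ` ?I = points (biset_union (biset_prod H U V) (biset_prod H U W))"
      unfolding union_simps points_prod[OF H U W] points_prod[OF H U V] by (force simp: image_iff)
  next
    fix i j assume "i \<in> ?I" "j \<in> ?I"
    then obtain u x u' x' where i: "i = (u, x)" "u \<in> points U" "x \<in> points V <+> points W"
      and j: "j = (u', x')" "u' \<in> points U" "x' \<in> points V <+> points W"
      by auto
    then have "?\<alpha> i = ?\<alpha> j \<longleftrightarrow> (\<exists>h \<in> carrier H. u' = ract U u h \<and> x = lact (biset_union V W) h x')"
      by (simp add: cls_eq_iff[OF H U VW] union_simps)
    also have "\<dots> \<longleftrightarrow> ?\<beta> i = ?\<beta> j"
      using i j by (cases x; cases x')
        (simp_all add: cls_eq_iff[OF H U V] cls_eq_iff[OF H U W] union_simps )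
    finally show "?\<alpha> i = ?\<alpha> j \<longleftrightarrow> ?\<beta> i = ?\<beta> j" .
  next
    fix g i assume "g \<in> carrier G" "i \<in> ?I"
    then show "\<exists>j\<in>?I. ?\<alpha> j = lact (biset_prod H U (biset_union V W)) g (?\<alpha> i) \<and>
        ?\<beta> j = lact (biset_union (biset_prod H U V) (biset_prod H U W)) g (?\<beta> i)"
      by (intro bexI[of _ "(lact U g (fst i), snd i)"]) (auto simp: simps)
  next
    fix l i assume "l \<in> carrier K" "i \<in> ?I"
    then show "\<exists>j\<in>?I. ?\<alpha> j = ract (biset_prod H U (biset_union V W)) (?\<alpha> i) l \<and>
        ?\<beta> j = ract (biset_union (biset_prod H U V) (biset_prod H U W)) (?\<beta> i) l"
      by (intro bexI[of _ "(fst i, ract (biset_union V W) (snd i) l)"]) (auto simp: simps)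
  qed
qed

section \<open>Isomorphism classes of bisets and their number\<close>

lemma iso_class_eqI:
  assumes "finite_biset G H U" "biset_isomorphic G H U V"
  shows "iso_class G H U = iso_class G H V"
  using biset_isomorphic_trans[OF assms(2)] biset_isomorphic_trans[OF biset_isomorphic_sym[OF assms]]
  unfolding iso_class_def by blast

lemma iso_class_nat_copy:
  assumes "finite_biset G H U"
  obtains X :: "('g, 'h, nat) biset" where "finite_biset G H X" "biset_isomorphic G H U X" "iso_class G H U = iso_class G H X"
  using biset_nat_copy[OF assms] iso_class_eqI[OF assms] by metis

lemma iso_class_in_iso_classes: "finite_biset G H U \<Longrightarrow> iso_class G H U \<in> iso_classes G H"
  unfolding iso_classes_def by (erule iso_class_nat_copy) blast

lemma iso_classesE:
  assumes "X \<in> iso_classes G H"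
  obtains U :: "('g, 'h, nat) biset" where "finite_biset G H U" "X = iso_class G H U"
  using assms by (auto simp: iso_classes_def)

text \<open>\<open>iso_class_prod\<close> is a union over all representatives. Products of
  isomorphic bisets are isomorphic, so all terms coincide, and \<open>biset_nat_copy\<close>
  provides at least one.\<close>

lemma iso_class_prod_eq:
  assumes "group G" "group H" "group K" and U: "finite_biset G H U" and W: "finite_biset H K W"
  shows "iso_class_prod G H K (iso_class G H U) (iso_class H K W) = iso_class G K (biset_prod H U W)"
proof -
  have "iso_class G K (biset_prod H U' W') = iso_class G K (biset_prod H U W)"
    if "U' \<in> iso_class G H U" "W' \<in> iso_class H K W" for U' W'
    using that assms
    by (intro iso_class_eqI[symmetric] finite_biset_prod biset_prod_cong) (auto simp: iso_class_def)
  moreover obtain U' where "U' \<in> iso_class G H U"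
    using biset_nat_copy[OF U] by (auto simp: iso_class_def)
  moreover obtain W' where "W' \<in> iso_class H K W"
    using biset_nat_copy[OF W] by (auto simp: iso_class_def)
  ultimately show ?thesis
    unfolding iso_class_prod_def by blast
qed

text \<open>Starting point of the size estimates. The records themselves are uncountably many, since
  the actions have arbitrary values outside the points and outside the groups; up to isomorphism
  only a finite set of naturals and the finite graphs of the two actions matter.\<close>

lemma countable_iso_classes:
  fixes G :: "'g monoid" and H :: "'h monoid"
  assumes "finite (carrier G)" "finite (carrier H)"
  shows "countable (iso_classes G H)"
proof -
  define code where "code U = (points U, {(g, u, lact U g u) |g u. g \<in> carrier G \<and> u \<in> points U},
    {(u, h, ract U u h) |u h. u \<in> points U \<and> h \<in> carrier H})" for U :: "('g, 'h, nat) biset"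
  have "iso_class G H U = iso_class G H V" if U: "finite_biset G H U" and eq: "code U = code V"
    for U V :: "('g, 'h, nat) biset"
  proof (rule iso_class_eqI[OF U])
    have pts: "points U = points V"
      and l: "{(g, u, lact U g u) |g u. g \<in> carrier G \<and> u \<in> points U} =
        {(g, u, lact V g u) |g u. g \<in> carrier G \<and> u \<in> points V}"
      and r: "{(u, h, ract U u h) |u h. u \<in> points U \<and> h \<in> carrier H} =
        {(u, h, ract V u h) |u h. u \<in> points V \<and> h \<in> carrier H}"
      using eq[unfolded code_def prod.inject, THEN conjunct1] eq[unfolded code_def prod.inject, THEN conjunct2, THEN conjunct1]
        eq[unfolded code_def prod.inject, THEN conjunct2, THEN conjunct2]
      by - assumption+
    have "lact U g u = lact V g u" if "g \<in> carrier G" "u \<in> points U" for g u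
    proof -
      have "(g, u, lact U g u) \<in> {(g, u, lact V g u) |g u. g \<in> carrier G \<and> u \<in> points V}"
        unfolding l[symmetric] using that by blast
      then show ?thesis by blast
    qed
    moreover have "ract U u h = ract V u h" if "h \<in> carrier H" "u \<in> points U" for u h
    proof -
      have "(u, h, ract U u h) \<in> {(u, h, ract V u h) |u h. u \<in> points V \<and> h \<in> carrier H}"
        unfolding r[symmetric] using that by blast
      then show ?thesis by blast
    qed
    moreover note pts
    ultimately show "biset_isomorphic G H U V"
      unfolding biset_isomorphic_def by (intro exI[of _ id]) auto
  qed
  note code_inj = this
  \<comment> \<open>Each class is recovered from a code by choosing any biset with that code, so
    there are at most as many classes as codes.\<close>
  have "iso_classes G H \<subseteq> (\<lambda>c. iso_class G H (SOME U. finite_biset G H U \<and> code U = c)) ` (code ` {U. finite_biset G H U})"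
  proof
    fix X assume "X \<in> iso_classes G H"
    then obtain U :: "('g, 'h, nat) biset" where U: "finite_biset G H U" "X = iso_class G H U"
      by (rule iso_classesE)
    have "\<exists>V. finite_biset G H V \<and> code V = code U"
      using U by blast
    then have "finite_biset G H (SOME V. finite_biset G H V \<and> code V = code U)"
      "code (SOME V. finite_biset G H V \<and> code V = code U) = code U"
      by (metis (mono_tags, lifting) someI_ex)+
    then have "X = iso_class G H (SOME V. finite_biset G H V \<and> code V = code U)"
      using code_inj U by blast
    then show "X \<in> (\<lambda>c. iso_class G H (SOME U. finite_biset G H U \<and> code U = c)) ` (code ` {U. finite_biset G H U})"
      using U by blast
  qed
  moreover have "code ` {U. finite_biset G H U} \<subseteq>
      Collect finite \<times> {X. X \<subseteq> carrier G \<times> UNIV \<times> UNIV \<and> finite X} \<times> {X. X \<subseteq> UNIV \<times> carrier H \<times> UNIV \<and> finite X}"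
  proof (rule image_subsetI)
    fix U :: "('g, 'h, nat) biset" assume "U \<in> {U. finite_biset G H U}"
    then have "finite (points U)"
      by (simp add: biset_finite)
    moreover have "code U = (points U, (\<lambda>(g, u). (g, u, lact U g u)) ` (carrier G \<times> points U),
      (\<lambda>(u, h). (u, h, ract U u h)) ` (points U \<times> carrier H))"
      by (auto simp: code_def)
    ultimately show "code U \<in> Collect finite \<times> {X. X \<subseteq> carrier G \<times> UNIV \<times> UNIV \<and> finite X} \<times>
        {X. X \<subseteq> UNIV \<times> carrier H \<times> UNIV \<and> finite X}"
      using assms by auto
  qed
  moreover have "countable (Collect finite \<times> {X. X \<subseteq> carrier G \<times> (UNIV :: nat set) \<times> (UNIV :: nat set) \<and> finite X} \<times>
      {X. X \<subseteq> (UNIV :: nat set) \<times> carrier H \<times> (UNIV :: nat set) \<and> finite X} :: (nat set \<times> _ \<times> _) set)"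
  proof -
    have "countable (carrier G \<times> (UNIV :: nat set) \<times> (UNIV :: nat set))"
      "countable ((UNIV :: nat set) \<times> carrier H \<times> (UNIV :: nat set))"
      using assms by (simp_all add: countable_SIGMA countable_finite)
    from this[THEN countable_Collect_finite_subset] show ?thesis
      by (simp add: countable_SIGMA countable_Collect_finite conj_commute)
  qed
  ultimately show ?thesis
    by (meson countable_image countable_subset)
qed

section \<open>The biset category is linear\<close>

text \<open>Extension of scalars turns a biadditive map \<open>m\<close> into a
  \<open>k\<close>-bilinear one; the case of interest is \<open>burnside_comp\<close>.\<close>

locale tensor_pairing = A: tensor k A + B: tensor k B + C: tensor k C
  for k :: "'c ring" and A :: "'a monoid" and B :: "'b monoid" and C :: "'d monoid" +
  fixes m :: "'a \<Rightarrow> 'b \<Rightarrow> 'd"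
  assumes m_closed: "\<lbrakk>x \<in> carrier A; y \<in> carrier B\<rbrakk> \<Longrightarrow> m x y \<in> carrier C"
    and m_mult_left: "\<lbrakk>x \<in> carrier A; x' \<in> carrier A; y \<in> carrier B\<rbrakk> \<Longrightarrow>
      m (x \<otimes>\<^bsub>A\<^esub> x') y = m x y \<otimes>\<^bsub>C\<^esub> m x' y"
    and m_mult_right: "\<lbrakk>x \<in> carrier A; y \<in> carrier B; y' \<in> carrier B\<rbrakk> \<Longrightarrow>
      m x (y \<otimes>\<^bsub>B\<^esub> y') = m x y \<otimes>\<^bsub>C\<^esub> m x y'"
begin

text \<open>Against a fixed pair in the other variable, additivity in the scalar and additivity in
  the group element each go to a relation of the same kind.\<close>

sublocale P: bilinear_presentation "carrier k \<times> carrier A" "tensor_rels k A"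
  "carrier k \<times> carrier B" "tensor_rels k B" "carrier k \<times> carrier C" "tensor_rels k C"
  "\<lambda>(c, x) (d, y). (c \<otimes>\<^bsub>k\<^esub> d, m x y)"
proof (unfold_locales, goal_cases)
  case (1 a b)
  then show ?case by (auto simp: m_closed)
next
  case (2 r b)
  obtain d y where b: "b = (d, y)" "d \<in> carrier k" "y \<in> carrier B"
    using 2 by auto
  from 2 consider c c' x where "c \<in> carrier k" "c' \<in> carrier k" "x \<in> carrier A"
      "r = frag_of (c \<oplus>\<^bsub>k\<^esub> c', x) - frag_of (c, x) - frag_of (c', x)"
    | c x x' where "c \<in> carrier k" "x \<in> carrier A" "x' \<in> carrier A"
      "r = frag_of (c, x \<otimes>\<^bsub>A\<^esub> x') - frag_of (c, x) - frag_of (c, x')"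
    unfolding tensor_rels_def by blast
  then show ?case
  proof cases
    case 1
    show ?thesis
      unfolding tensor_rels_def using b 1
      by (intro C.P.null_rels[unfolded tensor_rels_def] UnI1 CollectI exI[of _ "c \<otimes>\<^bsub>k\<^esub> d"] exI[of _ "c' \<otimes>\<^bsub>k\<^esub> d"] exI[of _ "m x y"])
        (simp add: frag_extend_diff A.k.l_distr m_closed)
  next
    case 2
    show ?thesis
      unfolding tensor_rels_def using b 2
      by (intro C.P.null_rels[unfolded tensor_rels_def] UnI2 CollectI exI[of _ "c \<otimes>\<^bsub>k\<^esub> d"] exI[of _ "m x y"] exI[of _ "m x' y"])
        (simp add: frag_extend_diff m_mult_left m_closed)
  qed
next
  case (3 a r)
  obtain d y where a: "a = (d, y)" "d \<in> carrier k" "y \<in> carrier A"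
    using 3 by auto
  from 3 consider c c' x where "c \<in> carrier k" "c' \<in> carrier k" "x \<in> carrier B"
      "r = frag_of (c \<oplus>\<^bsub>k\<^esub> c', x) - frag_of (c, x) - frag_of (c', x)"
    | c x x' where "c \<in> carrier k" "x \<in> carrier B" "x' \<in> carrier B"
      "r = frag_of (c, x \<otimes>\<^bsub>B\<^esub> x') - frag_of (c, x) - frag_of (c, x')"
    unfolding tensor_rels_def by blast
  then show ?case
  proof cases
    case 1
    show ?thesis
      unfolding tensor_rels_def using a 1
      by (intro C.P.null_rels[unfolded tensor_rels_def] UnI1 CollectI exI[of _ "d \<otimes>\<^bsub>k\<^esub> c"] exI[of _ "d \<otimes>\<^bsub>k\<^esub> c'"] exI[of _ "m y x"])
        (simp add: frag_extend_diff A.k.r_distr m_closed)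
  next
    case 2
    show ?thesis
      unfolding tensor_rels_def using a 2
      by (intro C.P.null_rels[unfolded tensor_rels_def] UnI2 CollectI exI[of _ "d \<otimes>\<^bsub>k\<^esub> c"] exI[of _ "m y x"] exI[of _ "m y x'"])
        (simp add: frag_extend_diff m_mult_right m_closed)
  qed
qed

definition pairing where
  "pairing = ab_bilin (carrier k \<times> carrier C) (tensor_rels k C) (\<lambda>(c, x) (d, y). (c \<otimes>\<^bsub>k\<^esub> d, m x y))"

lemma pairing_closed: "\<lbrakk>s \<in> carrier A.T; t \<in> carrier B.T\<rbrakk> \<Longrightarrow> pairing s t \<in> carrier C.T"
  unfolding pairing_def A.carrier_T B.carrier_T C.carrier_T by (rule P.bilin_closed)

lemma pairing_add_left: "\<lbrakk>s \<in> carrier A.T; s' \<in> carrier A.T; t \<in> carrier B.T\<rbrakk> \<Longrightarrow>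
    pairing (s \<oplus>\<^bsub>A.T\<^esub> s') t = pairing s t \<oplus>\<^bsub>C.T\<^esub> pairing s' t"
  unfolding pairing_def A.carrier_T B.carrier_T A.add_T C.add_T by (rule P.bilin_mult_left)

lemma pairing_add_right: "\<lbrakk>s \<in> carrier A.T; t \<in> carrier B.T; t' \<in> carrier B.T\<rbrakk> \<Longrightarrow>
    pairing s (t \<oplus>\<^bsub>B.T\<^esub> t') = pairing s t \<oplus>\<^bsub>C.T\<^esub> pairing s t'"
  unfolding pairing_def A.carrier_T B.carrier_T B.add_T C.add_T by (rule P.bilin_mult_right)

lemma pairing_pure: "\<lbrakk>c \<in> carrier k; x \<in> carrier A; d \<in> carrier k; y \<in> carrier B\<rbrakk> \<Longrightarrow>
    pairing (A.pure c x) (B.pure d y) = C.pure (c \<otimes>\<^bsub>k\<^esub> d) (m x y)"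
  unfolding pairing_def A.pure_def B.pure_def C.pure_def
  using P.bilin_gen[of "(c, x)" "(d, y)"] by simp

interpretation AM: module k A.T by (rule A.module_T)
interpretation BM: module k B.T by (rule B.module_T)
interpretation CM: module k C.T by (rule C.module_T)

lemma pairing_smult_left:
  assumes c: "c \<in> carrier k" and s: "s \<in> carrier A.T" and t: "t \<in> carrier B.T"
  shows "pairing (c \<odot>\<^bsub>A.T\<^esub> s) t = c \<odot>\<^bsub>C.T\<^esub> pairing s t"
  using s
proof (induction rule: A.T_induct)
  case (pure d x)
  show ?case
    using t
  proof (induction rule: B.T_induct)
    case (pure e y)
    then show ?case
      using c \<open>d \<in> carrier k\<close> \<open>x \<in> carrier A\<close>
      by (simp add: A.smult_pure C.smult_pure pairing_pure m_closed A.k.m_assoc)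
  next
    case (add t t')
    then show ?case
      using c pure by (simp add: pairing_add_right pairing_closed A.pure_closed CM.smult_r_distr)
  qed
next
  case (add s s')
  then show ?case
    using c t by (simp add: pairing_add_left pairing_closed AM.smult_r_distr CM.smult_r_distr)
qed

lemma pairing_smult_right:
  assumes c: "c \<in> carrier k" and s: "s \<in> carrier A.T" and t: "t \<in> carrier B.T"
  shows "pairing s (c \<odot>\<^bsub>B.T\<^esub> t) = c \<odot>\<^bsub>C.T\<^esub> pairing s t"
  using t
proof (induction rule: B.T_induct)
  case (pure d x)
  show ?case
    using s
  proof (induction rule: A.T_induct)
    case (pure e y)
    \<comment> \<open>The scalar has to pass the coefficient of the left factor: commutativity of
      \<open>k\<close> enters, through \<open>m_lcomm\<close>.\<close>
    then show ?case
      using c \<open>d \<in> carrier k\<close> \<open>x \<in> carrier B\<close>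
      by (simp add: B.smult_pure C.smult_pure pairing_pure m_closed A.k.m_lcomm)
  next
    case (add t t')
    then show ?case
      using c pure by (simp add: pairing_add_left pairing_closed B.pure_closed CM.smult_r_distr)
  qed
next
  case (add s s')
  then show ?case
    using c s by (simp add: pairing_add_right pairing_closed BM.smult_r_distr CM.smult_r_distr)
qed

end

section \<open>Burnside groups and composition in the biset category\<close>

abbreviation fgroup :: "'g monoid \<Rightarrow> bool" where
  "fgroup G \<equiv> group G \<and> finite (carrier G)"

text \<open>\<open>burnside_rels\<close> only mentions bisets on natural numbers, while products
  have classes of pairs as points. Passing to isomorphic copies makes the relation available for
  bisets over every type.\<close>

lemma union_rel:
  fixes G :: "'g monoid" and H :: "'h monoid"
  assumes U: "finite_biset G H U" and V: "finite_biset G H V"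
  shows "frag_of (iso_class G H (biset_union U V)) - frag_of (iso_class G H U) - frag_of (iso_class G H V) \<in> burnside_rels G H"
proof -
  obtain X :: "('g, 'h, nat) biset" where X: "finite_biset G H X" "biset_isomorphic G H U X" "iso_class G H U = iso_class G H X"
    using U by (rule iso_class_nat_copy)
  obtain Y :: "('g, 'h, nat) biset" where Y: "finite_biset G H Y" "biset_isomorphic G H V Y" "iso_class G H V = iso_class G H Y"
    using V by (rule iso_class_nat_copy)
  have "iso_class G H (biset_union U V) = iso_class G H (biset_union X Y)"
    by (intro iso_class_eqI finite_biset_union biset_union_cong U V X Y)
  then show ?thesis
    using X Y by (auto simp: burnside_rels_def)
qed

lemma burnside_relsE:
  assumes "r \<in> burnside_rels G H"
  obtains U V :: "('g, 'h, nat) biset" where "finite_biset G H U" "finite_biset G H V"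
    "r = frag_of (iso_class G H (biset_union U V)) - frag_of (iso_class G H U) - frag_of (iso_class G H V)"
  using assms by (auto simp: burnside_rels_def)

interpretation burnside: presentation "iso_classes G H" "burnside_rels G H"
proof
  fix r assume "r \<in> burnside_rels G H"
  then show "Poly_Mapping.keys r \<subseteq> iso_classes G H"
    by (rule burnside_relsE)
      (auto dest!: subsetD[OF Poly_Mapping.keys_diff] simp: iso_class_in_iso_classes finite_biset_union)
qed

lemma comm_group_burnside: "comm_group (burnside_group G H)"
  unfolding burnside_group_def by (rule burnside.comm_group_pres)

lemma burnside_elt_closed: "finite_biset G H U \<Longrightarrow> burnside_elt G H U \<in> carrier (burnside_group G H)"
  unfolding burnside_group_def burnside_elt_def
  by (rule burnside.class_closed) (simp add: iso_class_in_iso_classes)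

lemma burnside_elt_cong: "\<lbrakk>finite_biset G H U; biset_isomorphic G H U V\<rbrakk> \<Longrightarrow> burnside_elt G H U = burnside_elt G H V"
  unfolding burnside_elt_def by (simp add: iso_class_eqI)

text \<open>Distributivity of the product over disjoint unions is exactly what carries a relation
  \<open>[U + V] - [U] - [V]\<close> to a relation of the target.\<close>

lemma bilinear_burnside:
  fixes G :: "'g monoid" and H :: "'h monoid" and K :: "'l monoid"
  assumes G: "group G" and H: "group H" and K: "group K"
  shows "bilinear_presentation (iso_classes G H) (burnside_rels G H) (iso_classes H K) (burnside_rels H K)
    (iso_classes G K) (burnside_rels G K) (iso_class_prod G H K)"
proof (unfold_locales, goal_cases)
  case (1 a b)
  then show ?case
    by (elim iso_classesE) (simp add: iso_class_prod_eq G H K iso_class_in_iso_classes finite_biset_prod)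
next
  case (2 r b)
  obtain U V :: "('g, 'h, nat) biset" where UV: "finite_biset G H U" "finite_biset G H V"
    "r = frag_of (iso_class G H (biset_union U V)) - frag_of (iso_class G H U) - frag_of (iso_class G H V)"
    using 2(1) by (rule burnside_relsE)
  obtain W :: "('h, 'l, nat) biset" where W: "finite_biset H K W" "b = iso_class H K W"
    using 2(2) by (rule iso_classesE)
  have "iso_class G K (biset_prod H (biset_union U V) W) = iso_class G K (biset_union (biset_prod H U W) (biset_prod H V W))"
    by (intro iso_class_eqI finite_biset_prod biset_prod_union_left finite_biset_union G H K UV W)
  then show ?case
    using UV W
    by (auto simp: frag_extend_diff iso_class_prod_eq G H K finite_biset_union finite_biset_prod
        intro!: burnside.null_rels union_rel)
next
  case (3 a r)
  obtain U V :: "('h, 'l, nat) biset" where UV: "finite_biset H K U" "finite_biset H K V"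
    "r = frag_of (iso_class H K (biset_union U V)) - frag_of (iso_class H K U) - frag_of (iso_class H K V)"
    using 3(2) by (rule burnside_relsE)
  obtain W :: "('g, 'h, nat) biset" where W: "finite_biset G H W" "a = iso_class G H W"
    using 3(1) by (rule iso_classesE)
  have "iso_class G K (biset_prod H W (biset_union U V)) = iso_class G K (biset_union (biset_prod H W U) (biset_prod H W V))"
    by (intro iso_class_eqI finite_biset_prod biset_prod_union_right finite_biset_union G H K UV W)
  then show ?case
    using UV W
    by (auto simp: frag_extend_diff iso_class_prod_eq G H K finite_biset_union finite_biset_prod
        intro!: burnside.null_rels union_rel)
qed

lemma burnside_comp_elt:
  assumes "group G" "group H" "group K" "finite_biset G H U" "finite_biset H K W"
  shows "burnside_comp G H K (burnside_elt G H U) (burnside_elt H K W) = burnside_elt G K (biset_prod H U W)"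
  using assms bilinear_presentation.bilin_gen[OF bilinear_burnside[OF assms(1-3)]]
  by (simp add: burnside_comp_def burnside_elt_def iso_class_in_iso_classes iso_class_prod_eq)

lemma burnside_induct [consumes 1, case_names elt one inv mult]:
  fixes G :: "'g monoid" and H :: "'h monoid"
  assumes "x \<in> carrier (burnside_group G H)"
    and "\<And>U :: ('g, 'h, nat) biset. finite_biset G H U \<Longrightarrow> P (burnside_elt G H U)"
    and "P \<one>\<^bsub>burnside_group G H\<^esub>"
    and "\<And>x. \<lbrakk>x \<in> carrier (burnside_group G H); P x\<rbrakk> \<Longrightarrow> P (inv\<^bsub>burnside_group G H\<^esub> x)"
    and "\<And>x y. \<lbrakk>x \<in> carrier (burnside_group G H); y \<in> carrier (burnside_group G H); P x; P y\<rbrakk> \<Longrightarrow>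
      P (x \<otimes>\<^bsub>burnside_group G H\<^esub> y)"
  shows "P x"
  using assms unfolding burnside_group_def burnside_elt_def
  by (induction rule: burnside.pres_induct) (auto elim: iso_classesE)

locale kB_pairing =
  fixes k :: "'c ring" and G :: "'g monoid" and H :: "'h monoid" and K :: "'l monoid"
  assumes k: "cring k" and G: "group G" and H: "group H" and K: "group K"
begin

sublocale tensor_pairing k "burnside_group G H" "burnside_group H K" "burnside_group G K" "burnside_comp G H K"
proof -
  interpret B: bilinear_presentation "iso_classes G H" "burnside_rels G H" "iso_classes H K" "burnside_rels H K"
    "iso_classes G K" "burnside_rels G K" "iso_class_prod G H K"
    using G H K by (rule bilinear_burnside)
  show "tensor_pairing k (burnside_group G H) (burnside_group H K) (burnside_group G K) (burnside_comp G H K)"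
    unfolding tensor_pairing_def tensor_pairing_axioms_def tensor_def burnside_comp_def
    using k comm_group_burnside[of G H] comm_group_burnside[of H K] comm_group_burnside[of G K]
      B.bilin_closed B.bilin_mult_left B.bilin_mult_right
    by (simp add: burnside_group_def)
qed

lemma kB_comp_eq: "kB_comp k G H K = pairing"
  by (simp add: kB_comp_def pairing_def fun_eq_iff)

end

text \<open>The tensor of \<open>c\<close> with the class of \<open>U\<close>, for a biset over any
  type. Identities in \<open>kB\<close> are verified on these elements.\<close>

definition kgen :: "'c ring \<Rightarrow> 'g monoid \<Rightarrow> 'h monoid \<Rightarrow> 'c \<Rightarrow> ('g, 'h, 'u) biset \<Rightarrow> ('c, 'g, 'h) kburnside" where
  "kgen k G H c U = tensor.pure k (burnside_group G H) c (burnside_elt G H U)"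

lemma tensor_burnside: "cring k \<Longrightarrow> tensor k (burnside_group G H)"
  unfolding tensor_def using comm_group_burnside by blast

lemma kgen_closed: "\<lbrakk>cring k; c \<in> carrier k; finite_biset G H U\<rbrakk> \<Longrightarrow> kgen k G H c U \<in> carrier (kB k G H)"
  unfolding kgen_def kB_def by (intro tensor.pure_closed tensor_burnside burnside_elt_closed)

lemma kgen_cong: "\<lbrakk>finite_biset G H U; biset_isomorphic G H U V\<rbrakk> \<Longrightarrow> kgen k G H c U = kgen k G H c V"
  unfolding kgen_def by (simp add: burnside_elt_cong)

lemma module_kB: "cring k \<Longrightarrow> module k (kB k G H)"
  unfolding kB_def by (intro tensor.module_T tensor_burnside)

lemma kB_induct [consumes 2, case_names gen add]:
  fixes G :: "'g monoid" and H :: "'h monoid"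
  assumes k: "cring k" and t: "t \<in> carrier (kB k G H)"
    and gen: "\<And>c (U :: ('g, 'h, nat) biset). \<lbrakk>c \<in> carrier k; finite_biset G H U\<rbrakk> \<Longrightarrow> P (kgen k G H c U)"
    and add: "\<And>s t. \<lbrakk>s \<in> carrier (kB k G H); t \<in> carrier (kB k G H); P s; P t\<rbrakk> \<Longrightarrow> P (s \<oplus>\<^bsub>kB k G H\<^esub> t)"
  shows "P t"
proof -
  interpret T: tensor k "burnside_group G H" using k by (rule tensor_burnside)
  \<comment> \<open>The empty biset is available for all \<open>G\<close> and \<open>H\<close>; with
    coefficient zero it writes the zero tensor as a \<open>kgen\<close>.\<close>
  define E :: "('g, 'h, nat) biset" where "E = \<lparr>points = {}, lact = (\<lambda>g x. x), ract = (\<lambda>x h. x)\<rparr>"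
  have E: "finite_biset G H E"
    by (simp add: finite_biset_def E_def)
  \<comment> \<open>All scalars are quantified together because the case of an inverse passes from
    \<open>c\<close> to \<open>\<ominus> c\<close>.\<close>
  have pure: "\<forall>c \<in> carrier k. P (T.pure c x)" if "x \<in> carrier (burnside_group G H)" for x
    using that
  proof (induction rule: burnside_induct)
    case (elt U)
    then show ?case using gen by (simp add: kgen_def)
  next
    case one
    then show ?case
      using gen[OF T.k.zero_closed E]
      by (simp add: kgen_def T.pure_one_right T.pure_zero_left burnside_elt_closed[OF E])
  next
    case (inv x)
    then show ?case
      by (simp add: T.pure_inv(1) T.pure_inv(2)[symmetric])
  next
    case (mult x y)
    then show ?case
      using add by (simp add: T.pure_mult_right kB_def T.pure_closed)
  qed
  show ?thesis
    using t unfolding kB_def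
  proof (induction rule: T.T_induct)
    case (pure c x)
    then show ?case using \<open>\<And>x. x \<in> carrier (burnside_group G H) \<Longrightarrow> \<forall>c \<in> carrier k. P (T.pure c x)\<close> by blast
  next
    case (add s t)
    then show ?case using \<open>\<And>s t. \<lbrakk>s \<in> carrier (kB k G H); t \<in> carrier (kB k G H); P s; P t\<rbrakk> \<Longrightarrow> P (s \<oplus>\<^bsub>kB k G H\<^esub> t)\<close>
      by (simp add: kB_def)
  qed
qed

lemma kB_id_eq:
  assumes "cring k"
  shows "kB_id k G = kgen k G G \<one>\<^bsub>k\<^esub> (id_biset G)"
  by (simp add: kB_id_def kgen_def tensor.pure_def[OF tensor_burnside[OF assms]])

lemma kB_id_closed: "\<lbrakk>cring k; fgroup G\<rbrakk> \<Longrightarrow> kB_id k G \<in> carrier (kB k G G)"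
  by (simp add: kB_id_eq kgen_closed finite_biset_id cring.cring_simprules)

context
  fixes k :: "'c ring"
  assumes k: "cring k"
begin

lemma
  assumes "group G" "group H" "group K" and a: "a \<in> carrier (kB k G H)" and b: "b \<in> carrier (kB k H K)"
  shows kB_comp_closed: "kB_comp k G H K a b \<in> carrier (kB k G K)"
    and kB_comp_add_left: "a' \<in> carrier (kB k G H) \<Longrightarrow>
      kB_comp k G H K (a \<oplus>\<^bsub>kB k G H\<^esub> a') b = kB_comp k G H K a b \<oplus>\<^bsub>kB k G K\<^esub> kB_comp k G H K a' b"
    and kB_comp_add_right: "b' \<in> carrier (kB k H K) \<Longrightarrow>
      kB_comp k G H K a (b \<oplus>\<^bsub>kB k H K\<^esub> b') = kB_comp k G H K a b \<oplus>\<^bsub>kB k G K\<^esub> kB_comp k G H K a b'"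
    and kB_comp_smult_left: "c \<in> carrier k \<Longrightarrow>
      kB_comp k G H K (c \<odot>\<^bsub>kB k G H\<^esub> a) b = c \<odot>\<^bsub>kB k G K\<^esub> kB_comp k G H K a b"
    and kB_comp_smult_right: "c \<in> carrier k \<Longrightarrow>
      kB_comp k G H K a (c \<odot>\<^bsub>kB k H K\<^esub> b) = c \<odot>\<^bsub>kB k G K\<^esub> kB_comp k G H K a b"
proof -
  interpret kB_pairing k G H K
    using assms k by (simp add: kB_pairing_def)
  note ab = a[unfolded kB_def] b[unfolded kB_def]
  show "kB_comp k G H K a b \<in> carrier (kB k G K)"
    unfolding kB_comp_eq kB_def using ab by (rule pairing_closed)
  show "kB_comp k G H K (a \<oplus>\<^bsub>kB k G H\<^esub> a') b = kB_comp k G H K a b \<oplus>\<^bsub>kB k G K\<^esub> kB_comp k G H K a' b"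
    if "a' \<in> carrier (kB k G H)"
    using that ab unfolding kB_comp_eq kB_def by (intro pairing_add_left)
  show "kB_comp k G H K a (b \<oplus>\<^bsub>kB k H K\<^esub> b') = kB_comp k G H K a b \<oplus>\<^bsub>kB k G K\<^esub> kB_comp k G H K a b'"
    if "b' \<in> carrier (kB k H K)"
    using that ab unfolding kB_comp_eq kB_def by (intro pairing_add_right)
  show "kB_comp k G H K (c \<odot>\<^bsub>kB k G H\<^esub> a) b = c \<odot>\<^bsub>kB k G K\<^esub> kB_comp k G H K a b" if "c \<in> carrier k"
    using that ab unfolding kB_comp_eq kB_def by (intro pairing_smult_left)
  show "kB_comp k G H K a (c \<odot>\<^bsub>kB k H K\<^esub> b) = c \<odot>\<^bsub>kB k G K\<^esub> kB_comp k G H K a b" if "c \<in> carrier k"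
    using that ab unfolding kB_comp_eq kB_def by (intro pairing_smult_right)
qed

lemma kB_comp_kgen:
  assumes "group G" "group H" "group K" "c \<in> carrier k" "d \<in> carrier k" "finite_biset G H U" "finite_biset H K W"
  shows "kB_comp k G H K (kgen k G H c U) (kgen k H K d W) = kgen k G K (c \<otimes>\<^bsub>k\<^esub> d) (biset_prod H U W)"
proof -
  interpret kB_pairing k G H K
    using assms k by (simp add: kB_pairing_def)
  show ?thesis
    using assms by (simp add: kB_comp_eq kgen_def pairing_pure burnside_elt_closed burnside_comp_elt)
qed

lemma kB_comp_id_left:
  assumes G: "fgroup G" and H: "group H" and a: "a \<in> carrier (kB k G H)"
  shows "kB_comp k G G H (kB_id k G) a = a"
proof -
  interpret cring k by (rule k)
  show ?thesis
    using k a
  proof (induction rule: kB_induct)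
    case (gen c U)
    have "kgen k G H c (biset_prod G (id_biset G) U) = kgen k G H c U"
      using G H gen by (intro kgen_cong finite_biset_prod biset_prod_id_left finite_biset_id) auto
    then show ?case
      using G H k gen finite_biset_id[of G]
      by (simp add: kB_id_eq kB_comp_kgen)
  qed (use assms k in \<open>simp add: kB_comp_add_right kB_id_closed\<close>)
qed

lemma kB_comp_id_right:
  assumes G: "group G" and H: "fgroup H" and a: "a \<in> carrier (kB k G H)"
  shows "kB_comp k G H H a (kB_id k H) = a"
proof -
  interpret cring k by (rule k)
  show ?thesis
    using k a
  proof (induction rule: kB_induct)
    case (gen c U)
    have "kgen k G H c (biset_prod H U (id_biset H)) = kgen k G H c U"
      using G H gen by (intro kgen_cong finite_biset_prod biset_prod_id_right finite_biset_id) auto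
    then show ?case
      using G H k gen finite_biset_id[of H]
      by (simp add: kB_id_eq kB_comp_kgen)
  qed (use assms k in \<open>simp add: kB_comp_add_left kB_id_closed\<close>)
qed

text \<open>The three arguments are reduced to generators by nested inductions; what remains is
  associativity for bisets and for scalars.\<close>

lemma kB_comp_assoc:
  assumes grp: "group G" "group H" "group K" "group L"
    and a: "a \<in> carrier (kB k G H)" and b: "b \<in> carrier (kB k H K)" and c: "c \<in> carrier (kB k K L)"
  shows "kB_comp k G H L a (kB_comp k H K L b c) = kB_comp k G K L (kB_comp k G H K a b) c"
  using k a
proof (induction rule: kB_induct)
  case (gen x U)
  note x = gen
  from k b show ?case
  proof (induction rule: kB_induct)
    case (gen y V)
    note y = gen
    from k c show ?case
    proof (induction rule: kB_induct)
      case (gen z W)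
      have "kgen k G L w (biset_prod K (biset_prod H U V) W) = kgen k G L w (biset_prod H U (biset_prod K V W))" for w
        using grp x y gen by (intro kgen_cong finite_biset_prod biset_prod_assoc)
      then show ?case
        using grp x y gen k
        by (simp add: kB_comp_kgen finite_biset_prod cring.cring_simprules)
    next
      case (add c c')
      then show ?case
        using grp x y by (simp add: kB_comp_add_right kB_comp_closed kgen_closed k)
    qed
  next
    case (add b b')
    then show ?case
      using grp x c by (simp add: kB_comp_add_right kB_comp_add_left kB_comp_closed kgen_closed k)
  qed
next
  case (add a a')
  then show ?case
    using grp b c by (simp add: kB_comp_add_left kB_comp_closed)
qed

end

section \<open>Cardinality bounds for the hom-modules\<close>

lemma countable_lepoll_infinite:
  assumes "countable A" "infinite B"
  shows "A \<lesssim> B"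
  using assms by (meson countable_def infinite_le_lepoll lepoll_def lepoll_trans subset_UNIV)

text \<open>A presented group is a quotient of the free abelian group on \<open>S\<close>, which is
  covered by the image of the free group on all of \<open>'m\<close>; the latter is equipotent to
  \<open>'m\<close> because \<open>'m\<close> is infinite.\<close>

lemma carrier_pres_lepoll:
  assumes "presentation S R" "infinite (UNIV :: 'm set)" "S \<lesssim> (UNIV :: 'm set)"
  shows "carrier (ab_pres S R) \<lesssim> (UNIV :: 'm set)"
proof -
  interpret presentation S R by fact
  have "carrier (ab_pres S R) \<lesssim> carrier (free_Abelian_group S)"
    by (rule subset_image_lepoll[of _ "ab_class S R"]) (auto elim: carrier_presE)
  also have "carrier (free_Abelian_group S) \<lesssim> carrier (free_Abelian_group (UNIV :: 'm set))"
  proof -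
  \<comment> \<open>The comparison of \<open>S\<close> with \<open>'m\<close> is used as a map
    \<open>g\<close> whose range covers \<open>S\<close>, since its additive extension then reaches
    every formal sum on \<open>S\<close>.\<close>
  obtain g :: "'m \<Rightarrow> 'a" where g: "S \<subseteq> range g"
    using assms(3) by (auto simp: lepoll_iff)
  have "p \<in> range (frag_extend (frag_of \<circ> g))" if "Poly_Mapping.keys p \<subseteq> S" for p
    using that
  proof (induction p rule: frag_induction)
    case zero
    show ?case by (rule range_eqI[of _ _ 0]) simp
  next
    case (one s)
    then obtain x where "s = g x" using g by auto
    then show ?case by (intro range_eqI[of _ _ "frag_of x"]) simp
  next
    case (diff p q)
    then obtain p' q' where "p = frag_extend (frag_of \<circ> g) p'" "q = frag_extend (frag_of \<circ> g) q'"
      unfolding image_iff by blast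
    then show ?case by (intro range_eqI[of _ _ "p' - q'"]) (simp only: frag_extend_diff)
  qed
  then show ?thesis
    by (intro subset_image_lepoll[of _ "frag_extend (frag_of \<circ> g)"]) (simp add: subset_iff free_Abelian_group_def)
  qed
  also have "\<dots> \<lesssim> (UNIV :: 'm set)"
    using eqpoll_free_Abelian_group_infinite[OF assms(2)] by (rule eqpoll_imp_lepoll)
  finally show ?thesis .
qed

text \<open>Ensures that quotients of \<open>kB(K,H)\<close>, in particular the values of the simple
  functor constructed later, can be realised inside \<open>'m\<close>. The bound for presented
  groups is used twice, for the Burnside group and for the tensor product, with
  \<open>'m \<times> 'm\<close> no larger than \<open>'m\<close> in between.\<close>

lemma kB_lepoll:
  fixes k :: "'c ring" and G :: "'g monoid" and H :: "'h monoid"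
  assumes k: "cring k" and inf: "infinite (UNIV :: 'm set)" and "carrier k \<lesssim> (UNIV :: 'm set)"
    and "finite (carrier G)" "finite (carrier H)"
  shows "carrier (kB k G H) \<lesssim> (UNIV :: 'm set)"
proof -
  interpret tensor k "burnside_group G H" using k by (rule tensor_burnside)
  have "iso_classes G H \<lesssim> (UNIV :: 'm set)"
    using countable_iso_classes[OF assms(4,5)] inf by (rule countable_lepoll_infinite)
  then have "carrier (burnside_group G H) \<lesssim> (UNIV :: 'm set)"
    unfolding burnside_group_def using burnside.presentation_axioms inf by (intro carrier_pres_lepoll)
  then have "carrier k \<times> carrier (burnside_group G H) \<lesssim> (UNIV :: 'm set) \<times> (UNIV :: 'm set)"
    using assms(3) by (intro times_lepoll_mono)
  also have "(UNIV :: 'm set) \<times> (UNIV :: 'm set) \<lesssim> (UNIV :: 'm set)"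
    using card_of_Times_same_infinite[OF inf] by (simp add: eqpoll_imp_lepoll eqpoll_iff_card_of_ordIso)
  finally show ?thesis
    unfolding kB_def carrier_T using P.presentation_axioms inf by (intro carrier_pres_lepoll)
qed

section \<open>Modules and biset functors\<close>

lemma linear_mapsI:
  assumes "f \<in> extensional (carrier M)" "\<And>x. x \<in> carrier M \<Longrightarrow> f x \<in> carrier N"
    and "\<And>x y. \<lbrakk>x \<in> carrier M; y \<in> carrier M\<rbrakk> \<Longrightarrow> f (x \<oplus>\<^bsub>M\<^esub> y) = f x \<oplus>\<^bsub>N\<^esub> f y"
    and "\<And>a x. \<lbrakk>a \<in> carrier R; x \<in> carrier M\<rbrakk> \<Longrightarrow> f (a \<odot>\<^bsub>M\<^esub> x) = a \<odot>\<^bsub>N\<^esub> f x"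
  shows "f \<in> linear_maps R M N"
  using assms by (auto simp: linear_maps_def PiE_def)

lemma linear_mapsD:
  assumes "f \<in> linear_maps R M N"
  shows linear_maps_ext: "f \<in> extensional (carrier M)"
    and linear_maps_closed: "x \<in> carrier M \<Longrightarrow> f x \<in> carrier N"
    and linear_maps_add: "\<lbrakk>x \<in> carrier M; y \<in> carrier M\<rbrakk> \<Longrightarrow> f (x \<oplus>\<^bsub>M\<^esub> y) = f x \<oplus>\<^bsub>N\<^esub> f y"
    and linear_maps_smult: "\<lbrakk>a \<in> carrier R; x \<in> carrier M\<rbrakk> \<Longrightarrow> f (a \<odot>\<^bsub>M\<^esub> x) = a \<odot>\<^bsub>N\<^esub> f x"
  using assms by (auto simp: linear_maps_def PiE_def)

lemma linear_maps_eqI: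
  assumes "f \<in> linear_maps R M N" "g \<in> linear_maps R M N'" "\<And>x. x \<in> carrier M \<Longrightarrow> f x = g x"
  shows "f = g"
  using assms by (intro extensionalityI[of _ "carrier M"]) (auto dest: linear_maps_ext)

lemma additive_zero:
  assumes "abelian_group M" "abelian_group N" "\<And>x. x \<in> carrier M \<Longrightarrow> f x \<in> carrier N"
    and "\<And>x y. \<lbrakk>x \<in> carrier M; y \<in> carrier M\<rbrakk> \<Longrightarrow> f (x \<oplus>\<^bsub>M\<^esub> y) = f x \<oplus>\<^bsub>N\<^esub> f y"
  shows "f \<zero>\<^bsub>M\<^esub> = \<zero>\<^bsub>N\<^esub>"
proof -
  interpret M: abelian_group M by fact
  interpret N: abelian_group N by fact
  have "f \<zero>\<^bsub>M\<^esub> \<oplus>\<^bsub>N\<^esub> f \<zero>\<^bsub>M\<^esub> = f \<zero>\<^bsub>M\<^esub>"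
    using assms(4)[of "\<zero>\<^bsub>M\<^esub>" "\<zero>\<^bsub>M\<^esub>"] by simp
  then show ?thesis
    using assms(3)[of "\<zero>\<^bsub>M\<^esub>"] by (simp add: N.add.r_cancel_one')
qed

lemma (in abelian_group) a_l_inv_ex: "x \<in> carrier G \<Longrightarrow> \<exists>y \<in> carrier G. y \<oplus> x = \<zero>"
  by (rule bexI[of _ "\<ominus> x"]) (simp_all add: l_neg)

lemma (in left_module) smult_r_zero: "a \<in> carrier R \<Longrightarrow> a \<odot>\<^bsub>M\<^esub> \<zero>\<^bsub>M\<^esub> = \<zero>\<^bsub>M\<^esub>"
  using smult_r_distr[of a "\<zero>\<^bsub>M\<^esub>" "\<zero>\<^bsub>M\<^esub>"] smult_closed[of a "\<zero>\<^bsub>M\<^esub>"] by (simp add: M.add.r_cancel_one')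

lemma (in left_module) smult_l_zero: "x \<in> carrier M \<Longrightarrow> \<zero>\<^bsub>R\<^esub> \<odot>\<^bsub>M\<^esub> x = \<zero>\<^bsub>M\<^esub>"
  using smult_l_distr[of "\<zero>\<^bsub>R\<^esub>" "\<zero>\<^bsub>R\<^esub>" x] smult_closed[of "\<zero>\<^bsub>R\<^esub>" x] by (simp add: M.add.r_cancel_one')

lemma (in left_module) smult_minus_one: "x \<in> carrier M \<Longrightarrow> (\<ominus>\<^bsub>R\<^esub> \<one>\<^bsub>R\<^esub>) \<odot>\<^bsub>M\<^esub> x = \<ominus>\<^bsub>M\<^esub> x"
  using smult_l_distr[of "\<ominus>\<^bsub>R\<^esub> \<one>\<^bsub>R\<^esub>" "\<one>\<^bsub>R\<^esub>" x] smult_closed[of "\<ominus>\<^bsub>R\<^esub> \<one>\<^bsub>R\<^esub>" x]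
  by (simp add: smult_one smult_l_zero R.l_neg M.minus_equality)

lemma cat_module_category: "cat (module_category R TYPE('m))"
proof -
  have cmp: "compose (carrier M) g f \<in> linear_maps R M P"
    if "left_module R M" and f: "f \<in> linear_maps R M N" and g: "g \<in> linear_maps R N P"
    for f g and M N P :: "('a, 'm) module"
  proof -
    interpret left_module R M by fact
    show ?thesis
      by (rule linear_mapsI)
        (simp_all add: compose_def smult_closed linear_mapsD[OF f] linear_mapsD[OF g])
  qed
  have idt: "(\<lambda>x\<in>carrier M. x) \<in> linear_maps R M M" if "left_module R M" for M :: "('a, 'm) module"
  proof -
    interpret left_module R M by fact
    show ?thesis by (rule linear_mapsI) (auto simp: smult_closed)
  qed
  have assoc: "compose (carrier M) h (compose (carrier M) g f) = compose (carrier M) (compose (carrier N) h g) f"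
    if "f \<in> linear_maps R M N" for f g h and M N :: "('a, 'm) module"
    using that by (auto simp: compose_def fun_eq_iff dest: linear_maps_closed)
  have unit: "compose (carrier M) (\<lambda>x\<in>carrier N. x) f = f" "compose (carrier M) f (\<lambda>x\<in>carrier M. x) = f"
    if "f \<in> linear_maps R M N" for f and M N :: "('a, 'm) module"
    using linear_maps_ext[OF that] linear_maps_closed[OF that]
    by (auto simp: compose_def fun_eq_iff extensional_def)
  show ?thesis
    unfolding cat_def module_category_def category.simps mem_Collect_eq
    by (intro conjI allI impI; (erule (2) cmp | erule idt | rule assoc, assumption | erule unit))
qed

lemma iso_arr_module_category:
  fixes M N :: "('r, 'm) module"
  assumes "left_module R M" "left_module R N" and f: "f \<in> linear_maps R M N" and bij: "bij_betw f (carrier M) (carrier N)"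
  shows "iso_arr (module_category R TYPE('m)) M N f"
proof -
  interpret M: left_module R M by fact
  define g where "g = (\<lambda>y\<in>carrier N. inv_into (carrier M) f y)"
  have gc: "g y \<in> carrier M" and fg: "f (g y) = y" if "y \<in> carrier N" for y
    using bij that by (auto simp: g_def bij_betw_def f_inv_into_f inv_into_into)
  have gf: "g (f x) = x" if "x \<in> carrier M" for x
    using bij that linear_maps_closed[OF f that] by (auto simp: g_def bij_betw_def)
  have "g \<in> linear_maps R N M"
  proof (rule linear_mapsI)
    fix x y assume xy: "x \<in> carrier N" "y \<in> carrier N"
    have "g (f (g x \<oplus>\<^bsub>M\<^esub> g y)) = g (x \<oplus>\<^bsub>N\<^esub> y)"
      using xy by (simp add: linear_maps_add[OF f] gc fg)
    then show "g (x \<oplus>\<^bsub>N\<^esub> y) = g x \<oplus>\<^bsub>M\<^esub> g y"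
      using xy by (simp add: gf gc)
  next
    fix a x assume ax: "a \<in> carrier R" "x \<in> carrier N"
    have "g (f (a \<odot>\<^bsub>M\<^esub> g x)) = g (a \<odot>\<^bsub>N\<^esub> x)"
      using ax by (simp add: linear_maps_smult[OF f] gc fg)
    then show "g (a \<odot>\<^bsub>N\<^esub> x) = a \<odot>\<^bsub>M\<^esub> g x"
      using ax by (simp add: gf gc M.smult_closed)
  qed (auto simp: gc, simp add: g_def)
  moreover have "compose (carrier M) g f = (\<lambda>x\<in>carrier M. x)" "compose (carrier N) f g = (\<lambda>x\<in>carrier N. x)"
    by (auto simp: compose_def gf fg)
  ultimately show ?thesis
    using f by (auto simp: iso_arr_def module_category_def)
qed

text \<open>The structure on the image of a map whose kernel is a congruence; it serves both to form
  quotients and to move a module into the universe \<open>'m\<close>.\<close>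

definition image_module :: "('x \<Rightarrow> 'm) \<Rightarrow> ('r, 'x) module \<Rightarrow> ('r, 'm) module" where
  "image_module \<rho> N = (let r = inv_into (carrier N) \<rho> in
     \<lparr>carrier = \<rho> ` carrier N, mult = (\<lambda>_ _. undefined), one = undefined,
      zero = \<rho> \<zero>\<^bsub>N\<^esub>, add = (\<lambda>s t. \<rho> (r s \<oplus>\<^bsub>N\<^esub> r t)), smult = (\<lambda>c s. \<rho> (c \<odot>\<^bsub>N\<^esub> r s))\<rparr>)"

text \<open>Addition is only asked to respect the fibres of \<open>\<rho>\<close> in its left
  argument; \<open>image_add\<close> obtains the right argument by commutativity.\<close>

locale module_congruence = left_module R N for R (structure) and N :: "('r, 'x) module" +
  fixes \<rho> :: "'x \<Rightarrow> 'm"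
  assumes cong_add: "\<lbrakk>x \<in> carrier N; x' \<in> carrier N; y \<in> carrier N; \<rho> x = \<rho> x'\<rbrakk> \<Longrightarrow> \<rho> (x \<oplus>\<^bsub>N\<^esub> y) = \<rho> (x' \<oplus>\<^bsub>N\<^esub> y)"
    and cong_smult: "\<lbrakk>c \<in> carrier R; x \<in> carrier N; x' \<in> carrier N; \<rho> x = \<rho> x'\<rbrakk> \<Longrightarrow> \<rho> (c \<odot>\<^bsub>N\<^esub> x) = \<rho> (c \<odot>\<^bsub>N\<^esub> x')"
begin

lemma section_closed: "x \<in> carrier N \<Longrightarrow> inv_into (carrier N) \<rho> (\<rho> x) \<in> carrier N"
  by (auto intro: inv_into_into)

lemma section_eq: "x \<in> carrier N \<Longrightarrow> \<rho> (inv_into (carrier N) \<rho> (\<rho> x)) = \<rho> x"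
  by (auto intro: f_inv_into_f)

lemma image_carrier: "carrier (image_module \<rho> N) = \<rho> ` carrier N"
  by (simp add: image_module_def Let_def)

lemma image_zero: "\<zero>\<^bsub>image_module \<rho> N\<^esub> = \<rho> \<zero>\<^bsub>N\<^esub>"
  by (simp add: image_module_def Let_def)

lemma image_add:
  assumes "x \<in> carrier N" "y \<in> carrier N"
  shows "\<rho> x \<oplus>\<^bsub>image_module \<rho> N\<^esub> \<rho> y = \<rho> (x \<oplus>\<^bsub>N\<^esub> y)"
proof -
  let ?r = "inv_into (carrier N) \<rho>"
  have "\<rho> (?r (\<rho> x) \<oplus>\<^bsub>N\<^esub> ?r (\<rho> y)) = \<rho> (x \<oplus>\<^bsub>N\<^esub> ?r (\<rho> y))"
    using assms by (intro cong_add section_closed section_eq)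
  also have "\<dots> = \<rho> (?r (\<rho> y) \<oplus>\<^bsub>N\<^esub> x)"
    using assms by (simp add: M.a_comm section_closed)
  also have "\<dots> = \<rho> (y \<oplus>\<^bsub>N\<^esub> x)"
    using assms by (intro cong_add section_closed section_eq)
  finally show ?thesis
    using assms by (simp add: M.a_comm image_module_def Let_def)
qed

lemma image_smult: "\<lbrakk>c \<in> carrier R; x \<in> carrier N\<rbrakk> \<Longrightarrow> c \<odot>\<^bsub>image_module \<rho> N\<^esub> \<rho> x = \<rho> (c \<odot>\<^bsub>N\<^esub> x)"
  unfolding image_module_def Let_def module.simps by (intro cong_smult section_closed section_eq)

lemma left_module_image: "left_module R (image_module \<rho> N)"
proof -
  have "abelian_group (image_module \<rho> N)"
  proof (rule abelian_groupI)
    fix s assume "s \<in> carrier (image_module \<rho> N)"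
    then obtain x where x: "x \<in> carrier N" "s = \<rho> x"
      by (auto simp: image_carrier)
    then have "\<rho> (\<ominus>\<^bsub>N\<^esub> x) \<oplus>\<^bsub>image_module \<rho> N\<^esub> s = \<zero>\<^bsub>image_module \<rho> N\<^esub>"
      by (simp add: image_add image_zero M.l_neg)
    then show "\<exists>t\<in>carrier (image_module \<rho> N). t \<oplus>\<^bsub>image_module \<rho> N\<^esub> s = \<zero>\<^bsub>image_module \<rho> N\<^esub>"
      using x by (auto simp: image_carrier)
  next
    fix r s t assume "r \<in> carrier (image_module \<rho> N)" "s \<in> carrier (image_module \<rho> N)" "t \<in> carrier (image_module \<rho> N)"
    then show "r \<oplus>\<^bsub>image_module \<rho> N\<^esub> s \<oplus>\<^bsub>image_module \<rho> N\<^esub> t = r \<oplus>\<^bsub>image_module \<rho> N\<^esub> (s \<oplus>\<^bsub>image_module \<rho> N\<^esub> t)"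
      by (auto simp: image_carrier image_add M.a_assoc)
  next
    fix s t assume "s \<in> carrier (image_module \<rho> N)" "t \<in> carrier (image_module \<rho> N)"
    then show "s \<oplus>\<^bsub>image_module \<rho> N\<^esub> t = t \<oplus>\<^bsub>image_module \<rho> N\<^esub> s"
      by (auto simp: image_carrier image_add M.a_comm)
  qed (auto simp: image_carrier image_add image_zero)
  moreover have "left_module_axioms R (image_module \<rho> N)"
    by unfold_locales
      (auto simp: image_carrier image_add image_smult smult_closed smult_l_distr smult_r_distr smult_assoc smult_one)
  ultimately show ?thesis
    using R.ring_axioms by (simp add: left_module_def)
qed

end

section \<open>Biset functors and their evaluation at \<open>G\<close>\<close>

locale biset_setting =
  fixes k :: "'c ring" and G :: "'g monoid"
  assumes k: "cring k" and G: "group G" "finite (carrier G)"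
begin

abbreviation Ob where "Ob \<equiv> obj (subquotient_category k G)"

text \<open>Arguments come in the order of \<open>kB\<close>: \<open>Hom K H\<close> consists of the
  arrows from \<open>H\<close> to \<open>K\<close>.\<close>

abbreviation Hom where "Hom K H \<equiv> carrier (kB k K H)"

abbreviation BFC where "BFC m \<equiv> biset_functor_category k G m"

abbreviation BF where "BF m \<equiv> obj (BFC m)"

lemma Ob_group: "H \<in> Ob \<Longrightarrow> group H"
  and Ob_finite: "H \<in> Ob \<Longrightarrow> finite (carrier H)"
  and arr_subq: "arr (subquotient_category k G) H K = Hom K H"
  and cmp_subq: "cmp (subquotient_category k G) H K L b a = kB_comp k L K H b a"
  and idt_subq: "idt (subquotient_category k G) = kB_id k"
  by (simp_all add: subquotient_category_def full_subcategory_def biset_category_def)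

text \<open>\<open>G\<close> is the subquotient \<open>G/1\<close> of itself.\<close>

lemma G_Ob: "G \<in> Ob"
proof -
  interpret G: group G by (rule G)
  have "subgroup (carrier G) G"
    by (rule G.subgroup_self)
  moreover have "{\<one>\<^bsub>G\<^esub>} \<lhd> G\<lparr>carrier := carrier G\<rparr>"
    using G.one_is_normal by simp
  moreover have "G \<cong> (G\<lparr>carrier := carrier G\<rparr> Mod {\<one>\<^bsub>G\<^esub>})"
  proof -
    have "G Mod {\<one>\<^bsub>G\<^esub>} \<cong> G"
      using G.trivial_factor_iso by (auto simp: is_iso_def)
    then show ?thesis
      using group.iso_sym[OF normal.factorgroup_is_group[OF G.one_is_normal]] by simp
  qed
  ultimately have "iso_to_subquotient G G"
    unfolding iso_to_subquotient_def by blast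
  then show ?thesis
    using G by (simp add: subquotient_category_def full_subcategory_def biset_category_def)
qed

sublocale hom: module k "kB k H K" for H :: "'g monoid" and K :: "'g monoid"
  using k by (rule module_kB)

lemma comp_closed: "\<lbrakk>H \<in> Ob; K \<in> Ob; L \<in> Ob; a \<in> Hom K H; b \<in> Hom L K\<rbrakk> \<Longrightarrow>
    kB_comp k L K H b a \<in> Hom L H"
  by (simp add: kB_comp_closed k Ob_group)

lemma id_closed: "H \<in> Ob \<Longrightarrow> kB_id k H \<in> Hom H H"
  by (simp add: kB_id_closed k Ob_group Ob_finite)

lemma comp_assoc: "\<lbrakk>H \<in> Ob; K \<in> Ob; L \<in> Ob; N \<in> Ob; a \<in> Hom K H; b \<in> Hom L K; c \<in> Hom N L\<rbrakk> \<Longrightarrow>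
    kB_comp k N K H (kB_comp k N L K c b) a = kB_comp k N L H c (kB_comp k L K H b a)"
  by (simp add: kB_comp_assoc k Ob_group)

lemma comp_id: "\<lbrakk>H \<in> Ob; K \<in> Ob; a \<in> Hom K H\<rbrakk> \<Longrightarrow> kB_comp k K K H (kB_id k K) a = a"
  "\<lbrakk>H \<in> Ob; K \<in> Ob; a \<in> Hom K H\<rbrakk> \<Longrightarrow> kB_comp k K H H a (kB_id k H) = a"
  by (simp_all add: kB_comp_id_left kB_comp_id_right k Ob_group Ob_finite)

lemma comp_linear:
  assumes "H \<in> Ob" "K \<in> Ob" "L \<in> Ob" "a \<in> Hom K H" "b \<in> Hom L K"
  shows "a' \<in> Hom K H \<Longrightarrow> kB_comp k L K H b (a \<oplus>\<^bsub>kB k K H\<^esub> a') = kB_comp k L K H b a \<oplus>\<^bsub>kB k L H\<^esub> kB_comp k L K H b a'"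
    and "b' \<in> Hom L K \<Longrightarrow> kB_comp k L K H (b \<oplus>\<^bsub>kB k L K\<^esub> b') a = kB_comp k L K H b a \<oplus>\<^bsub>kB k L H\<^esub> kB_comp k L K H b' a"
    and "c \<in> carrier k \<Longrightarrow> kB_comp k L K H b (c \<odot>\<^bsub>kB k K H\<^esub> a) = c \<odot>\<^bsub>kB k L H\<^esub> kB_comp k L K H b a"
    and "c \<in> carrier k \<Longrightarrow> kB_comp k L K H (c \<odot>\<^bsub>kB k L K\<^esub> b) a = c \<odot>\<^bsub>kB k L H\<^esub> kB_comp k L K H b a"
  using assms by (simp_all add: k Ob_group kB_comp_add_left kB_comp_add_right kB_comp_smult_left kB_comp_smult_right)

lemma BF_iff: "F \<in> BF TYPE('m) \<longleftrightarrow>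
    is_functor (subquotient_category k G) (module_category k TYPE('m)) F \<and> k_linear_functor k G F"
  by (simp add: biset_functor_category_def full_subcategory_def functor_category_def)

lemma BF_D:
  fixes F :: "('c, 'g, 'm) biset_functor"
  assumes F: "F \<in> BF TYPE('m)"
  shows BF_module: "H \<in> Ob \<Longrightarrow> left_module k (fobj F H)"
    and BF_arr: "\<lbrakk>H \<in> Ob; K \<in> Ob; a \<in> Hom K H\<rbrakk> \<Longrightarrow> farr F H K a \<in> linear_maps k (fobj F H) (fobj F K)"
    and BF_id: "\<lbrakk>H \<in> Ob; x \<in> carrier (fobj F H)\<rbrakk> \<Longrightarrow> farr F H H (kB_id k H) x = x"
    and BF_comp: "\<lbrakk>H \<in> Ob; K \<in> Ob; L \<in> Ob; a \<in> Hom K H; b \<in> Hom L K; x \<in> carrier (fobj F H)\<rbrakk> \<Longrightarrow>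
      farr F H L (kB_comp k L K H b a) x = farr F K L b (farr F H K a x)"
    and BF_add_left: "\<lbrakk>H \<in> Ob; K \<in> Ob; a \<in> Hom K H; b \<in> Hom K H; x \<in> carrier (fobj F H)\<rbrakk> \<Longrightarrow>
      farr F H K (a \<oplus>\<^bsub>kB k K H\<^esub> b) x = farr F H K a x \<oplus>\<^bsub>fobj F K\<^esub> farr F H K b x"
    and BF_smult_left: "\<lbrakk>H \<in> Ob; K \<in> Ob; a \<in> Hom K H; c \<in> carrier k; x \<in> carrier (fobj F H)\<rbrakk> \<Longrightarrow>
      farr F H K (c \<odot>\<^bsub>kB k K H\<^esub> a) x = c \<odot>\<^bsub>fobj F K\<^esub> farr F H K a x"
  using F unfolding BF_iff is_functor_def k_linear_functor_def
  by (simp_all add: module_category_def arr_subq cmp_subq idt_subq compose_def)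

lemma BF_closed: "\<lbrakk>F \<in> BF TYPE('m); H \<in> Ob; K \<in> Ob; a \<in> Hom K H; x \<in> carrier (fobj F H)\<rbrakk> \<Longrightarrow>
    farr F H K a x \<in> carrier (fobj F K)"
  by (rule linear_maps_closed[OF BF_arr])

lemma BF_add: "\<lbrakk>F \<in> BF TYPE('m); H \<in> Ob; K \<in> Ob; a \<in> Hom K H; x \<in> carrier (fobj F H); y \<in> carrier (fobj F H)\<rbrakk> \<Longrightarrow>
    farr F H K a (x \<oplus>\<^bsub>fobj F H\<^esub> y) = farr F H K a x \<oplus>\<^bsub>fobj F K\<^esub> farr F H K a y"
  by (rule linear_maps_add[OF BF_arr])

lemma BF_smult: "\<lbrakk>F \<in> BF TYPE('m); H \<in> Ob; K \<in> Ob; a \<in> Hom K H; c \<in> carrier k; x \<in> carrier (fobj F H)\<rbrakk> \<Longrightarrow>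
    farr F H K a (c \<odot>\<^bsub>fobj F H\<^esub> x) = c \<odot>\<^bsub>fobj F K\<^esub> farr F H K a x"
  by (rule linear_maps_smult[OF BF_arr])

text \<open>The functor laws may be verified on elements: arrows of the module category are
  extensional, so equality of functions follows.\<close>

lemma BF_I:
  fixes F :: "('c, 'g, 'm) biset_functor"
  assumes "\<And>H. H \<in> Ob \<Longrightarrow> left_module k (fobj F H)"
    and arr: "\<And>H K a. \<lbrakk>H \<in> Ob; K \<in> Ob; a \<in> Hom K H\<rbrakk> \<Longrightarrow> farr F H K a \<in> linear_maps k (fobj F H) (fobj F K)"
    and id: "\<And>H x. \<lbrakk>H \<in> Ob; x \<in> carrier (fobj F H)\<rbrakk> \<Longrightarrow> farr F H H (kB_id k H) x = x"
    and comp: "\<And>H K L a b x. \<lbrakk>H \<in> Ob; K \<in> Ob; L \<in> Ob; a \<in> Hom K H; b \<in> Hom L K; x \<in> carrier (fobj F H)\<rbrakk> \<Longrightarrow>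
      farr F H L (kB_comp k L K H b a) x = farr F K L b (farr F H K a x)"
    and "\<And>H K a b x. \<lbrakk>H \<in> Ob; K \<in> Ob; a \<in> Hom K H; b \<in> Hom K H; x \<in> carrier (fobj F H)\<rbrakk> \<Longrightarrow>
      farr F H K (a \<oplus>\<^bsub>kB k K H\<^esub> b) x = farr F H K a x \<oplus>\<^bsub>fobj F K\<^esub> farr F H K b x"
    and "\<And>H K a c x. \<lbrakk>H \<in> Ob; K \<in> Ob; a \<in> Hom K H; c \<in> carrier k; x \<in> carrier (fobj F H)\<rbrakk> \<Longrightarrow>
      farr F H K (c \<odot>\<^bsub>kB k K H\<^esub> a) x = c \<odot>\<^bsub>fobj F K\<^esub> farr F H K a x"
  shows "F \<in> BF TYPE('m)"
proof -
  have "farr F H H (kB_id k H) = (\<lambda>x\<in>carrier (fobj F H). x)" if "H \<in> Ob" for H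
    using linear_maps_ext[OF arr[OF that that id_closed[OF that]]] id[OF that]
    by (auto simp: extensional_def)
  moreover have "farr F H L (kB_comp k L K H b a) = compose (carrier (fobj F H)) (farr F K L b) (farr F H K a)"
    if "H \<in> Ob" "K \<in> Ob" "L \<in> Ob" "a \<in> Hom K H" "b \<in> Hom L K" for H K L a b
    using linear_maps_ext[OF arr[OF that(1,3) comp_closed[OF that]]] comp[OF that]
    by (auto simp: extensional_def compose_def)
  ultimately show ?thesis
    using assms unfolding BF_iff is_functor_def k_linear_functor_def
    by (auto simp: module_category_def arr_subq cmp_subq idt_subq)
qed

lemma BF_arr_iff: "\<eta> \<in> arr (BFC TYPE('m)) F F' \<longleftrightarrow> \<eta> \<in> extensional Ob \<and>
    (\<forall>H \<in> Ob. \<eta> H \<in> linear_maps k (fobj F H) (fobj F' H)) \<and>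
    (\<forall>H \<in> Ob. \<forall>K \<in> Ob. \<forall>a \<in> Hom K H.
      compose (carrier (fobj F H)) (\<eta> K) (farr F H K a) = compose (carrier (fobj F H)) (farr F' H K a) (\<eta> H))"
  by (auto simp: biset_functor_category_def full_subcategory_def functor_category_def nat_trans_def module_category_def arr_subq)

lemma BF_natural:
  assumes "\<eta> \<in> arr (BFC TYPE('m)) F F'" "H \<in> Ob" "K \<in> Ob" "a \<in> Hom K H" "x \<in> carrier (fobj F H)"
  shows "\<eta> K (farr F H K a x) = farr F' H K a (\<eta> H x)"
proof -
  have "compose (carrier (fobj F H)) (\<eta> K) (farr F H K a) = compose (carrier (fobj F H)) (farr F' H K a) (\<eta> H)"
    using assms unfolding BF_arr_iff by blast
  from fun_cong[OF this, of x] show ?thesis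
    using assms(5) by (simp add: compose_def)
qed

lemma BF_arrI:
  assumes "\<eta> \<in> extensional Ob" "\<And>H. H \<in> Ob \<Longrightarrow> \<eta> H \<in> linear_maps k (fobj F H) (fobj F' H)"
    and "\<And>H K a x. \<lbrakk>H \<in> Ob; K \<in> Ob; a \<in> Hom K H; x \<in> carrier (fobj F H)\<rbrakk> \<Longrightarrow>
      \<eta> K (farr F H K a x) = farr F' H K a (\<eta> H x)"
  shows "\<eta> \<in> arr (BFC TYPE('m)) F F'"
  unfolding BF_arr_iff compose_def using assms(1,2)
  by (intro conjI ballI restrict_ext assms(3))

lemma cat_BF: "cat (BFC TYPE('m))"
  unfolding biset_functor_category_def
  by (intro cat_full_subcategory cat_functor_category cat_module_category)

abbreviation DB where "DB \<equiv> double_burnside_algebra k G"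

lemma DB_simps: "carrier DB = Hom G G" "a \<oplus>\<^bsub>DB\<^esub> b = a \<oplus>\<^bsub>kB k G G\<^esub> b" "\<zero>\<^bsub>DB\<^esub> = \<zero>\<^bsub>kB k G G\<^esub>"
  "a \<otimes>\<^bsub>DB\<^esub> b = kB_comp k G G G a b" "\<one>\<^bsub>DB\<^esub> = kB_id k G"
  by (simp_all add: double_burnside_algebra_def)

lemma ring_DB: "ring DB"
proof (rule ringI)
  show "abelian_group DB"
  proof (rule abelian_groupI)
    fix a b assume "a \<in> carrier DB" "b \<in> carrier DB"
    then show "a \<oplus>\<^bsub>DB\<^esub> b = b \<oplus>\<^bsub>DB\<^esub> a"
      by (simp add: DB_simps hom.a_comm)
  qed (simp_all add: DB_simps hom.a_assoc hom.a_l_inv_ex)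
  show "monoid DB"
    by (rule monoidI) (auto simp: DB_simps comp_closed id_closed comp_assoc comp_id G_Ob)
qed (simp_all add: DB_simps comp_linear G_Ob)

text \<open>Additivity in the algebra comes from linearity of \<open>F\<close> on hom-modules,
  associativity and the unit law from functoriality at \<open>G\<close>.\<close>

lemma left_module_evaluation:
  fixes F :: "('c, 'g, 'm) biset_functor"
  assumes F: "F \<in> BF TYPE('m)"
  shows "left_module DB (fobj (evaluation G) F)"
proof -
  interpret M: left_module k "fobj F G"
    using F G_Ob by (rule BF_module)
  have "abelian_group (fobj (evaluation G) F)"
  proof (rule abelian_groupI)
    fix x y assume "x \<in> carrier (fobj (evaluation G) F)" "y \<in> carrier (fobj (evaluation G) F)"
    then show "x \<oplus>\<^bsub>fobj (evaluation G) F\<^esub> y = y \<oplus>\<^bsub>fobj (evaluation G) F\<^esub> x"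
      by (simp add: evaluation_def Let_def M.M.a_comm)
  qed (simp_all add: evaluation_def Let_def M.M.a_assoc M.a_l_inv_ex)
  moreover have "left_module_axioms DB (fobj (evaluation G) F)"
    by unfold_locales
      (auto simp: evaluation_def Let_def DB_simps BF_closed[OF F] BF_add[OF F] BF_add_left[OF F] BF_comp[OF F] BF_id[OF F] G_Ob)
  ultimately show ?thesis
    using ring_DB by (simp add: left_module_def)
qed

lemma is_functor_evaluation:
  "is_functor (BFC TYPE('m)) (module_category DB TYPE('m)) (evaluation G)"
proof -
  have "\<eta> G \<in> linear_maps DB (fobj (evaluation G) F) (fobj (evaluation G) F')"
    if \<eta>: "\<eta> \<in> arr (BFC TYPE('m)) F F'" for F F' \<eta>
  proof -
    have "\<eta> G \<in> linear_maps k (fobj F G) (fobj F' G)"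
      using \<eta> G_Ob by (auto simp: BF_arr_iff)
    \<comment> \<open>Naturality with respect to the endomorphisms of \<open>G\<close> is precisely
      linearity over the double Burnside algebra.\<close>
    then show ?thesis
      using BF_natural[OF \<eta> G_Ob G_Ob]
      by (intro linear_mapsI) (auto simp: evaluation_def Let_def DB_simps dest: linear_mapsD)
  qed
  moreover have "idt (BFC TYPE('m)) F G = (\<lambda>x\<in>carrier (fobj F G). x)" for F
    using G_Ob by (simp add: biset_functor_category_def full_subcategory_def functor_category_def module_category_def)
  moreover have "cmp (BFC TYPE('m)) F F' F'' \<theta> \<eta> G = compose (carrier (fobj F G)) (\<theta> G) (\<eta> G)" for F F' F'' \<eta> \<theta>
    using G_Ob by (simp add: biset_functor_category_def full_subcategory_def functor_category_def module_category_def)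
  ultimately show ?thesis
    using left_module_evaluation
    unfolding is_functor_def by (auto simp: module_category_def evaluation_def Let_def)
qed

lemma equivalence_imp_non_vanishing:
  assumes eqv: "equivalence_of_categories (BFC TYPE('m)) (module_category DB TYPE('m)) (evaluation G)"
  shows "non_vanishing k G TYPE('m)"
  unfolding non_vanishing_def
proof (intro allI impI notI)
  fix S :: "('c, 'g, 'm) biset_functor"
  assume simple: "simple_functor k G S" and vanish: "carrier (fobj S G) = {\<zero>\<^bsub>fobj S G\<^esub>}"
  then have S: "S \<in> BF TYPE('m)"
    by (simp add: simple_functor_def)
  \<comment> \<open>The zero and the identity endomorphism of \<open>S\<close> agree at
    \<open>G\<close>, where the module has only one element.\<close>
  let ?z = "\<lambda>H\<in>Ob. \<lambda>x\<in>carrier (fobj S H). \<zero>\<^bsub>fobj S H\<^esub>" and ?i = "\<lambda>H\<in>Ob. \<lambda>x\<in>carrier (fobj S H). x"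
  have mod: "left_module k (fobj S H)" if "H \<in> Ob" for H
    using S that by (rule BF_module)
  have ab: "abelian_group (fobj S H)" if "H \<in> Ob" for H
    using mod[OF that] by (simp add: left_module_def)
  have z0: "\<zero>\<^bsub>fobj S H\<^esub> \<in> carrier (fobj S H)" if "H \<in> Ob" for H
    using ab[OF that] by (simp add: abelian_group_def abelian_monoid.zero_closed)
  have zero: "farr S H K a \<zero>\<^bsub>fobj S H\<^esub> = \<zero>\<^bsub>fobj S K\<^esub>" if "H \<in> Ob" "K \<in> Ob" "a \<in> Hom K H" for H K a
    using ab that by (intro additive_zero[of "fobj S H"]) (auto simp: BF_closed[OF S] BF_add[OF S])
  have lin: "(\<lambda>x\<in>carrier (fobj S H). \<zero>\<^bsub>fobj S H\<^esub>) \<in> linear_maps k (fobj S H) (fobj S H)"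
      "(\<lambda>x\<in>carrier (fobj S H). x) \<in> linear_maps k (fobj S H) (fobj S H)" if "H \<in> Ob" for H
  proof -
    interpret left_module k "fobj S H" using that by (rule mod)
    show "(\<lambda>x\<in>carrier (fobj S H). \<zero>\<^bsub>fobj S H\<^esub>) \<in> linear_maps k (fobj S H) (fobj S H)"
      "(\<lambda>x\<in>carrier (fobj S H). x) \<in> linear_maps k (fobj S H) (fobj S H)"
      by (rule linear_mapsI; simp add: smult_closed smult_r_zero)+
  qed
  have z: "?z \<in> arr (BFC TYPE('m)) S S"
    using lin ab by (intro BF_arrI) (auto simp: BF_closed[OF S] zero z0)
  have i: "?i \<in> arr (BFC TYPE('m)) S S"
    using lin by (intro BF_arrI) (auto simp: BF_closed[OF S])
  have "?z = ?i"
    by (rule equivalence_faithful[OF cat_BF eqv S S z i])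
      (use vanish G_Ob in \<open>auto simp: evaluation_def\<close>)
  then have "x = \<zero>\<^bsub>fobj S H\<^esub>" if "H \<in> Ob" "x \<in> carrier (fobj S H)" for H x
    using that by (metis (no_types, lifting) restrict_apply')
  then have "carrier (fobj S H) = {\<zero>\<^bsub>fobj S H\<^esub>}" if "H \<in> Ob" for H
    using that z0[OF that] by blast
  then show False
    using simple by (auto simp: simple_functor_def)
qed

end

section \<open>Quotients and transports of biset functors\<close>

lemma additive_minus:
  assumes M: "abelian_group M" and N: "abelian_group N" and f: "\<And>x. x \<in> carrier M \<Longrightarrow> f x \<in> carrier N"
    and add: "\<And>x y. \<lbrakk>x \<in> carrier M; y \<in> carrier M\<rbrakk> \<Longrightarrow> f (x \<oplus>\<^bsub>M\<^esub> y) = f x \<oplus>\<^bsub>N\<^esub> f y"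
    and x: "x \<in> carrier M"
  shows "f (\<ominus>\<^bsub>M\<^esub> x) = \<ominus>\<^bsub>N\<^esub> f x"
proof -
  interpret M: abelian_group M by fact
  interpret N: abelian_group N by fact
  have "f (\<ominus>\<^bsub>M\<^esub> x) \<oplus>\<^bsub>N\<^esub> f x = \<zero>\<^bsub>N\<^esub>"
    using add[of "\<ominus>\<^bsub>M\<^esub> x" x] additive_zero[OF M N f add] x by (simp add: M.l_neg)
  then show ?thesis
    using f x by (simp add: N.minus_equality)
qed

text \<open>Used with two kinds of \<open>\<rho>\<close>: maps whose fibres are the cosets of a
  subfunctor, which give the simple quotient, and injections, which bring the functor of equivariant
  maps into \<open>'m\<close>.\<close>

definition image_functor :: "('g monoid \<Rightarrow> 'x \<Rightarrow> 'm) \<Rightarrow> ('c, 'g, 'x) biset_functor \<Rightarrow> ('c, 'g, 'm) biset_functor" where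
  "image_functor \<rho> F = \<lparr>fobj = (\<lambda>H. image_module (\<rho> H) (fobj F H)),
     farr = (\<lambda>H K a. \<lambda>s \<in> \<rho> H ` carrier (fobj F H). \<rho> K (farr F H K a (inv_into (carrier (fobj F H)) (\<rho> H) s)))\<rparr>"

locale functor_congruence = biset_setting k G for k :: "'c ring" and G :: "'g monoid" +
  fixes F :: "('c, 'g, 'x) biset_functor" and \<rho> :: "'g monoid \<Rightarrow> 'x \<Rightarrow> 'm"
  assumes F: "F \<in> BF TYPE('x)"
    and cong: "H \<in> Ob \<Longrightarrow> module_congruence k (fobj F H) (\<rho> H)"
    and cong_arr: "\<lbrakk>H \<in> Ob; K \<in> Ob; a \<in> Hom K H; x \<in> carrier (fobj F H); x' \<in> carrier (fobj F H); \<rho> H x = \<rho> H x'\<rbrakk> \<Longrightarrow>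
      \<rho> K (farr F H K a x) = \<rho> K (farr F H K a x')"
begin

abbreviation Q where "Q \<equiv> image_functor \<rho> F"

lemma Q_obj: "fobj Q H = image_module (\<rho> H) (fobj F H)"
  by (simp add: image_functor_def)

lemma Q_carrier: "H \<in> Ob \<Longrightarrow> carrier (fobj Q H) = \<rho> H ` carrier (fobj F H)"
  unfolding Q_obj by (rule module_congruence.image_carrier[OF cong])

lemma Q_arr: "\<lbrakk>H \<in> Ob; K \<in> Ob; a \<in> Hom K H; x \<in> carrier (fobj F H)\<rbrakk> \<Longrightarrow>
    farr Q H K a (\<rho> H x) = \<rho> K (farr F H K a x)"
  using cong_arr[of H K a "inv_into (carrier (fobj F H)) (\<rho> H) (\<rho> H x)" x]
    module_congruence.section_closed[OF cong, of H x] module_congruence.section_eq[OF cong, of H x]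
  by (simp add: image_functor_def)

lemma Q_add: "\<lbrakk>H \<in> Ob; x \<in> carrier (fobj F H); y \<in> carrier (fobj F H)\<rbrakk> \<Longrightarrow>
    \<rho> H x \<oplus>\<^bsub>fobj Q H\<^esub> \<rho> H y = \<rho> H (x \<oplus>\<^bsub>fobj F H\<^esub> y)"
  unfolding Q_obj by (rule module_congruence.image_add[OF cong])

lemma Q_smult: "\<lbrakk>H \<in> Ob; c \<in> carrier k; x \<in> carrier (fobj F H)\<rbrakk> \<Longrightarrow>
    c \<odot>\<^bsub>fobj Q H\<^esub> \<rho> H x = \<rho> H (c \<odot>\<^bsub>fobj F H\<^esub> x)"
  unfolding Q_obj by (rule module_congruence.image_smult[OF cong])

lemma Q_zero: "H \<in> Ob \<Longrightarrow> \<zero>\<^bsub>fobj Q H\<^esub> = \<rho> H \<zero>\<^bsub>fobj F H\<^esub>"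
  unfolding Q_obj by (rule module_congruence.image_zero[OF cong])

lemma Q_BF: "Q \<in> BF TYPE('m)"
proof (rule BF_I)
  fix H assume H: "H \<in> Ob"
  show "left_module k (fobj Q H)"
    unfolding Q_obj using cong[OF H] by (rule module_congruence.left_module_image)
next
  fix H K a assume HK: "H \<in> Ob" "K \<in> Ob" "a \<in> Hom K H"
  interpret left_module k "fobj F H"
    using F HK(1) by (rule BF_module)
  show "farr Q H K a \<in> linear_maps k (fobj Q H) (fobj Q K)"
  proof (rule linear_mapsI)
    show "farr Q H K a \<in> extensional (carrier (fobj Q H))"
      using HK by (simp add: Q_carrier) (simp add: image_functor_def)
  next
    fix s t assume "s \<in> carrier (fobj Q H)" "t \<in> carrier (fobj Q H)"
    then show "farr Q H K a (s \<oplus>\<^bsub>fobj Q H\<^esub> t) = farr Q H K a s \<oplus>\<^bsub>fobj Q K\<^esub> farr Q H K a t"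
      using HK by (auto simp: Q_carrier Q_arr Q_add BF_add[OF F] BF_closed[OF F])
  next
    fix c s assume "c \<in> carrier k" "s \<in> carrier (fobj Q H)"
    then show "farr Q H K a (c \<odot>\<^bsub>fobj Q H\<^esub> s) = c \<odot>\<^bsub>fobj Q K\<^esub> farr Q H K a s"
      using HK by (auto simp: Q_carrier Q_arr Q_smult BF_smult[OF F] BF_closed[OF F] smult_closed)
  next
    fix s assume "s \<in> carrier (fobj Q H)"
    then show "farr Q H K a s \<in> carrier (fobj Q K)"
      using HK by (auto simp: Q_carrier Q_arr BF_closed[OF F])
  qed
next
  fix H s assume "H \<in> Ob" "s \<in> carrier (fobj Q H)"
  then show "farr Q H H (kB_id k H) s = s"
    by (auto simp: Q_carrier Q_arr BF_id[OF F] id_closed)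
next
  fix H K L a b s
  assume "H \<in> Ob" "K \<in> Ob" "L \<in> Ob" "a \<in> Hom K H" "b \<in> Hom L K" "s \<in> carrier (fobj Q H)"
  then show "farr Q H L (kB_comp k L K H b a) s = farr Q K L b (farr Q H K a s)"
    by (auto simp: Q_carrier Q_arr BF_comp[OF F] BF_closed[OF F] comp_closed)
next
  fix H K a b s
  assume "H \<in> Ob" "K \<in> Ob" "a \<in> Hom K H" "b \<in> Hom K H" "s \<in> carrier (fobj Q H)"
  then show "farr Q H K (a \<oplus>\<^bsub>kB k K H\<^esub> b) s = farr Q H K a s \<oplus>\<^bsub>fobj Q K\<^esub> farr Q H K b s"
    by (auto simp: Q_carrier Q_arr Q_add BF_add_left[OF F] BF_closed[OF F])
next
  fix H K a c s
  assume "H \<in> Ob" "K \<in> Ob" "a \<in> Hom K H" "c \<in> carrier k" "s \<in> carrier (fobj Q H)"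
  then show "farr Q H K (c \<odot>\<^bsub>kB k K H\<^esub> a) s = c \<odot>\<^bsub>fobj Q K\<^esub> farr Q H K a s"
    by (auto simp: Q_carrier Q_arr Q_smult BF_smult_left[OF F] BF_closed[OF F])
qed

end

section \<open>Identities factor through a non-vanishing group\<close>

text \<open>The quotient of \<open>M\<close> by \<open>T\<close> is realised inside
  \<open>'m\<close> without sets of cosets: a chosen representative of each coset, followed by an
  injection of \<open>carrier M\<close>.\<close>

lemma quotient_map_exists:
  fixes M :: "('r, 'x) module"
  assumes "module R M" "submodule T R M" "carrier M \<lesssim> (UNIV :: 'm set)"
  shows "\<exists>\<rho> :: 'x \<Rightarrow> 'm. \<forall>x \<in> carrier M. \<forall>x' \<in> carrier M. \<rho> x = \<rho> x' \<longleftrightarrow> x \<ominus>\<^bsub>M\<^esub> x' \<in> T"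
proof -
  interpret M: module R M by fact
  interpret T: submodule T R M by fact
  obtain i :: "'x \<Rightarrow> 'm" where i: "inj_on i (carrier M)"
    using assms(3) by (auto simp: lepoll_def)
  define rep where "rep x = (SOME y. y \<in> carrier M \<and> x \<ominus>\<^bsub>M\<^esub> y \<in> T)" for x
  have Tc: "x \<in> carrier M" if "x \<in> T" for x
    using T.subset that by auto
  have Tadd: "x \<oplus>\<^bsub>M\<^esub> y \<in> T" if "x \<in> T" "y \<in> T" for x y
    using T.m_closed[OF that] by simp
  have Tminus: "\<ominus>\<^bsub>M\<^esub> x \<in> T" if "x \<in> T" for x
    using T.m_inv_closed[OF that] by (simp add: a_inv_def)
  have T0: "\<zero>\<^bsub>M\<^esub> \<in> T"
    using T.one_closed by simp
  have rep: "rep x \<in> carrier M \<and> x \<ominus>\<^bsub>M\<^esub> rep x \<in> T" if "x \<in> carrier M" for x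
    unfolding rep_def
    by (rule someI[of _ x]) (use that T0 in \<open>simp add: M.minus_eq M.r_neg\<close>)
  have trans: "x \<ominus>\<^bsub>M\<^esub> z \<in> T" if "x \<in> carrier M" "y \<in> carrier M" "z \<in> carrier M" "x \<ominus>\<^bsub>M\<^esub> y \<in> T" "y \<ominus>\<^bsub>M\<^esub> z \<in> T" for x y z
  proof -
    have "x \<ominus>\<^bsub>M\<^esub> z = (x \<ominus>\<^bsub>M\<^esub> y) \<oplus>\<^bsub>M\<^esub> (y \<ominus>\<^bsub>M\<^esub> z)"
      using that by (simp add: M.minus_eq M.a_assoc M.r_neg1)
    then show ?thesis
      using Tadd[OF that(4,5)] by simp
  qed
  have sym: "y \<ominus>\<^bsub>M\<^esub> x \<in> T" if "x \<in> carrier M" "y \<in> carrier M" "x \<ominus>\<^bsub>M\<^esub> y \<in> T" for x y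
  proof -
    have "y \<ominus>\<^bsub>M\<^esub> x = \<ominus>\<^bsub>M\<^esub> (x \<ominus>\<^bsub>M\<^esub> y)"
      using that by (simp add: M.minus_eq M.minus_add M.a_comm)
    then show ?thesis
      using Tminus[OF that(3)] by simp
  qed
  have "rep x = rep x' \<longleftrightarrow> x \<ominus>\<^bsub>M\<^esub> x' \<in> T" if x: "x \<in> carrier M" "x' \<in> carrier M" for x x'
  proof
    assume "rep x = rep x'"
    then show "x \<ominus>\<^bsub>M\<^esub> x' \<in> T"
      using rep[OF x(1)] rep[OF x(2)] x trans[of x "rep x" x'] sym[of x' "rep x'"] by simp
  next
    assume "x \<ominus>\<^bsub>M\<^esub> x' \<in> T"
    then have "y \<in> carrier M \<and> x \<ominus>\<^bsub>M\<^esub> y \<in> T \<longleftrightarrow> y \<in> carrier M \<and> x' \<ominus>\<^bsub>M\<^esub> y \<in> T" for y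
      using x trans sym by blast
    \<comment> \<open>Congruent elements give the same predicate to \<open>SOME\<close>, hence the
      same representative.\<close>
    then show "rep x = rep x'"
      by (simp add: rep_def)
  qed
  then show ?thesis
    using rep i by (intro exI[of _ "i \<circ> rep"]) (simp add: inj_on_eq_iff)
qed

text \<open>\<open>through k G K H\<close> is \<open>J(H,K)\<close>.  Closure under scalars, hence under zero and negation, is automatic.\<close>

inductive_set through :: "'c ring \<Rightarrow> 'g monoid \<Rightarrow> 'g monoid \<Rightarrow> 'g monoid \<Rightarrow> ('c, 'g, 'g) kburnside set"
  for k G K H where
    through_comp: "\<lbrakk>a \<in> carrier (kB k G H); b \<in> carrier (kB k K G)\<rbrakk> \<Longrightarrow> kB_comp k K G H b a \<in> through k G K H"
  | through_add: "\<lbrakk>x \<in> through k G K H; y \<in> through k G K H\<rbrakk> \<Longrightarrow> x \<oplus>\<^bsub>kB k K H\<^esub> y \<in> through k G K H"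

text \<open>The covariant hom-functor of \<open>H\<close>. Its values live in the type of
  \<open>kB\<close> and not in \<open>'m\<close>; only a quotient of it will be carried
  there.\<close>

definition representable :: "'c ring \<Rightarrow> 'g monoid \<Rightarrow> ('c, 'g, ('c, 'g, 'g) kburnside) biset_functor" where
  "representable k H = \<lparr>fobj = (\<lambda>K. kB k K H), farr = (\<lambda>K L a. \<lambda>x \<in> carrier (kB k K H). kB_comp k L K H a x)\<rparr>"

context biset_setting
begin

text \<open>Negation is multiplication by minus one, so closure under it follows from closure under
  scalars.\<close>

lemma submodule_iff:
  assumes "left_module k M"
  shows "submodule T k M \<longleftrightarrow> T \<subseteq> carrier M \<and> \<zero>\<^bsub>M\<^esub> \<in> T \<and> (\<forall>x \<in> T. \<forall>y \<in> T. x \<oplus>\<^bsub>M\<^esub> y \<in> T) \<and>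
    (\<forall>c \<in> carrier k. \<forall>x \<in> T. c \<odot>\<^bsub>M\<^esub> x \<in> T)"
proof -
  interpret left_module k M by fact
  interpret module k M
    using assms k by (simp add: left_module_iff_module)
  show ?thesis
  proof
    assume "submodule T k M"
    then interpret T: submodule T k M .
    show "T \<subseteq> carrier M \<and> \<zero>\<^bsub>M\<^esub> \<in> T \<and> (\<forall>x \<in> T. \<forall>y \<in> T. x \<oplus>\<^bsub>M\<^esub> y \<in> T) \<and> (\<forall>c \<in> carrier k. \<forall>x \<in> T. c \<odot>\<^bsub>M\<^esub> x \<in> T)"
      using T.subset T.one_closed T.m_closed T.smult_closed by auto
  next
    assume T: "T \<subseteq> carrier M \<and> \<zero>\<^bsub>M\<^esub> \<in> T \<and> (\<forall>x \<in> T. \<forall>y \<in> T. x \<oplus>\<^bsub>M\<^esub> y \<in> T) \<and> (\<forall>c \<in> carrier k. \<forall>x \<in> T. c \<odot>\<^bsub>M\<^esub> x \<in> T)"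
    have "\<ominus>\<^bsub>M\<^esub> x \<in> T" if "x \<in> T" for x
    proof -
      have "\<ominus>\<^bsub>k\<^esub> \<one>\<^bsub>k\<^esub> \<in> carrier k"
        using k by (simp add: cring.cring_simprules)
      then show ?thesis
        using T that smult_minus_one[of x] by (metis subsetD)
    qed
    then show "submodule T k M"
      using T by (intro submoduleI) auto
  qed
qed

lemma subfunctor_iff:
  assumes F: "F \<in> BF TYPE('m)"
  shows "subfunctor k G F T \<longleftrightarrow> (\<forall>H \<in> Ob. T H \<subseteq> carrier (fobj F H) \<and> \<zero>\<^bsub>fobj F H\<^esub> \<in> T H \<and>
      (\<forall>x \<in> T H. \<forall>y \<in> T H. x \<oplus>\<^bsub>fobj F H\<^esub> y \<in> T H) \<and> (\<forall>c \<in> carrier k. \<forall>x \<in> T H. c \<odot>\<^bsub>fobj F H\<^esub> x \<in> T H) \<and>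
      (\<forall>K \<in> Ob. \<forall>a \<in> Hom K H. \<forall>x \<in> T H. farr F H K a x \<in> T K))"
proof -
  have "(\<forall>H \<in> Ob. submodule (T H) k (fobj F H)) \<longleftrightarrow> (\<forall>H \<in> Ob. T H \<subseteq> carrier (fobj F H) \<and> \<zero>\<^bsub>fobj F H\<^esub> \<in> T H \<and>
      (\<forall>x \<in> T H. \<forall>y \<in> T H. x \<oplus>\<^bsub>fobj F H\<^esub> y \<in> T H) \<and> (\<forall>c \<in> carrier k. \<forall>x \<in> T H. c \<odot>\<^bsub>fobj F H\<^esub> x \<in> T H))"
    by (intro ball_cong refl submodule_iff BF_module F)
  then show ?thesis
    unfolding subfunctor_def arr_subq by (simp only: ball_conj_distrib conj_assoc)
qed

lemma representable_BF: "H \<in> Ob \<Longrightarrow> representable k H \<in> BF TYPE(('c, 'g, 'g) kburnside)"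
proof (rule BF_I)
  fix K assume "H \<in> Ob" "K \<in> Ob"
  show "left_module k (fobj (representable k H) K)"
    using hom.module_axioms k by (simp add: representable_def left_module_iff_module)
next
  fix K L a assume "H \<in> Ob" "K \<in> Ob" "L \<in> Ob" "a \<in> Hom L K"
  then show "farr (representable k H) K L a \<in> linear_maps k (fobj (representable k H) K) (fobj (representable k H) L)"
    by (intro linear_mapsI) (simp_all add: representable_def comp_closed comp_linear)
qed (simp_all add: representable_def comp_closed comp_linear comp_id id_closed comp_assoc)

lemma through_closed: "\<lbrakk>H \<in> Ob; K \<in> Ob; x \<in> through k G K H\<rbrakk> \<Longrightarrow> x \<in> Hom K H"
  by (rotate_tac 2, induction rule: through.induct) (auto intro: comp_closed G_Ob)

text \<open>Zero is a composite of two zero arrows. In a composite through \<open>G\<close>, a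
  scalar is absorbed by the factor ending at \<open>G\<close>, and an arrow composed on the left by
  the factor starting at \<open>G\<close>.\<close>

lemma subfunctor_through:
  assumes H: "H \<in> Ob"
  shows "subfunctor k G (representable k H) (\<lambda>K. through k G K H)"
proof -
  have "\<zero>\<^bsub>kB k K H\<^esub> \<in> through k G K H" if K: "K \<in> Ob" for K
  proof -
    have "kB_comp k K G H \<zero>\<^bsub>kB k K G\<^esub> \<zero>\<^bsub>kB k G H\<^esub> = \<zero>\<^bsub>kB k K H\<^esub>"
      using comp_linear(1)[OF H G_Ob K hom.zero_closed hom.zero_closed hom.zero_closed]
        comp_closed[OF H G_Ob K hom.zero_closed hom.zero_closed]
      by (simp add: hom.add.r_cancel_one')
    then show ?thesis
      using through_comp[OF hom.zero_closed[of G H] hom.zero_closed[of K G]] by simp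
  qed
  moreover have "c \<odot>\<^bsub>kB k K H\<^esub> x \<in> through k G K H" if "c \<in> carrier k" "K \<in> Ob" "x \<in> through k G K H" for c K x
    using that(3)
  proof induction
    case (through_comp a b)
    then have "c \<odot>\<^bsub>kB k K H\<^esub> kB_comp k K G H b a = kB_comp k K G H b (c \<odot>\<^bsub>kB k G H\<^esub> a)"
      using that H G_Ob by (simp add: comp_linear)
    then show ?case
      using through.through_comp[OF hom.smult_closed[OF that(1) through_comp(1)] through_comp(2)] by simp
  next
    case (through_add x y)
    then show ?case
      using that H by (simp add: hom.smult_r_distr through_closed through.through_add)
  qed
  moreover have "kB_comp k L K H a x \<in> through k G L H" if "K \<in> Ob" "L \<in> Ob" "a \<in> Hom L K" "x \<in> through k G K H" for K L a x
    using that(4)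
  proof induction
    case (through_comp x b)
    then have "kB_comp k L K H a (kB_comp k K G H b x) = kB_comp k L G H (kB_comp k L K G a b) x"
      using that H G_Ob by (simp add: comp_assoc)
    then show ?case
      using through.through_comp[OF through_comp(1) comp_closed[OF G_Ob that(1,2) through_comp(2) that(3)]] by simp
  next
    case (through_add x y)
    then show ?case
      using that H by (simp add: comp_linear through_closed through.through_add)
  qed
  ultimately show ?thesis
    unfolding subfunctor_iff[OF representable_BF[OF H]]
    using H by (auto simp: representable_def through_closed intro: through.through_add)
qed

lemma non_vanishing_imp_through:
  assumes nv: "non_vanishing k G TYPE('m)" and inf: "infinite (UNIV :: 'm set)" and card: "carrier k \<lesssim> (UNIV :: 'm set)"
    and H: "H \<in> Ob"
  shows "kB_id k H \<in> through k G H H"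
proof (rule ccontr)
  assume notin: "kB_id k H \<notin> through k G H H"
  let ?P = "representable k H"
  note P = representable_BF[OF H]
  have P_simps: "fobj ?P K = kB k K H" "x \<in> Hom K H \<Longrightarrow> farr ?P K L a x = kB_comp k L K H a x" for K L a x
    by (simp_all add: representable_def)
  \<comment> \<open>A family of subsets indexed by groups is encoded as one relation, whose image of
    \<open>{K}\<close> is the part at \<open>K\<close>. Comparison of subfunctors thus becomes
    inclusion of sets, and Zorn's lemma applies as it stands.\<close>
  define fam where "fam = {A. subfunctor k G ?P (\<lambda>K. A `` {K}) \<and> (\<forall>K \<in> Ob. through k G K H \<subseteq> A `` {K}) \<and> (H, kB_id k H) \<notin> A}"
  have "\<exists>A\<in>fam. \<forall>X\<in>fam. A \<subseteq> X \<longrightarrow> X = A"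
  proof (rule subset_Zorn_nonempty)
    have "(SIGMA K:UNIV. through k G K H) \<in> fam"
      using subfunctor_through[OF H] notin by (simp add: fam_def Sigma_Image)
    then show "fam \<noteq> {}" by blast
  next
    fix C assume C: "C \<noteq> {}" "subset.chain fam C"
    then have sub: "A \<in> fam" if "A \<in> C" for A
      using that by (auto simp: subset_chain_def)
    have "subfunctor k G ?P (\<lambda>K. \<Union>C `` {K})"
      unfolding subfunctor_iff[OF P]
    proof (intro ballI conjI)
      fix K assume K: "K \<in> Ob"
      note subD = sub[unfolded fam_def subfunctor_iff[OF P], THEN CollectD, THEN conjunct1, THEN bspec, OF _ K]
      show "\<Union>C `` {K} \<subseteq> carrier (fobj ?P K)"
        using subD by blast
      show "\<zero>\<^bsub>fobj ?P K\<^esub> \<in> \<Union>C `` {K}"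
        using subD C(1) by blast
      show "x \<oplus>\<^bsub>fobj ?P K\<^esub> y \<in> \<Union>C `` {K}" if xy: "x \<in> \<Union>C `` {K}" "y \<in> \<Union>C `` {K}" for x y
      proof -
        obtain A B where "A \<in> C" "B \<in> C" "x \<in> A `` {K}" "y \<in> B `` {K}"
          using xy by blast
        \<comment> \<open>Addition is the one operation that involves two elements; comparability in
          the chain puts both into one member.\<close>
        moreover have "A \<subseteq> B \<or> B \<subseteq> A"
          using C(2) calculation by (auto simp: subset_chain_def)
        ultimately obtain D where "D \<in> C" "x \<in> D `` {K}" "y \<in> D `` {K}"
          by blast
        then show ?thesis
          using subD by blast
      qed
      show "c \<odot>\<^bsub>fobj ?P K\<^esub> x \<in> \<Union>C `` {K}" if "c \<in> carrier k" "x \<in> \<Union>C `` {K}" for c x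
        using that subD by blast
      show "farr ?P K L a x \<in> \<Union>C `` {L}" if "L \<in> Ob" "a \<in> Hom L K" "x \<in> \<Union>C `` {K}" for L a x
        using that subD by blast
    qed
    moreover have "\<forall>K \<in> Ob. through k G K H \<subseteq> \<Union>C `` {K}"
      using C(1) sub by (auto simp: fam_def)
    moreover have "(H, kB_id k H) \<notin> \<Union>C"
      using sub by (auto simp: fam_def)
    ultimately show "\<Union>C \<in> fam"
      by (simp add: fam_def)
  qed
  then obtain A where A: "A \<in> fam" and max: "\<And>X. \<lbrakk>X \<in> fam; A \<subseteq> X\<rbrakk> \<Longrightarrow> X = A"
    by blast
  define M where "M = (\<lambda>K. A `` {K})"
  have subM: "subfunctor k G ?P M" and throughM: "\<And>K. K \<in> Ob \<Longrightarrow> through k G K H \<subseteq> M K" and idM: "kB_id k H \<notin> M H"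
    using A by (auto simp: fam_def M_def)
  have M: "M K \<subseteq> Hom K H" "\<zero>\<^bsub>kB k K H\<^esub> \<in> M K" "\<And>x y. \<lbrakk>x \<in> M K; y \<in> M K\<rbrakk> \<Longrightarrow> x \<oplus>\<^bsub>kB k K H\<^esub> y \<in> M K"
    "\<And>c x. \<lbrakk>c \<in> carrier k; x \<in> M K\<rbrakk> \<Longrightarrow> c \<odot>\<^bsub>kB k K H\<^esub> x \<in> M K" if "K \<in> Ob" for K
    using subM[unfolded subfunctor_iff[OF P] P_simps(1), THEN bspec, OF that] by blast+
  have Marr: "kB_comp k L K H a x \<in> M L" if "K \<in> Ob" "L \<in> Ob" "a \<in> Hom L K" "x \<in> M K" for K L a x
  proof -
    have "farr ?P K L a x \<in> M L"
      using subM[unfolded subfunctor_iff[OF P], THEN bspec, OF that(1)] that by blast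
    then show ?thesis
      using M(1)[OF that(1)] that(4) by (simp add: P_simps(2) subsetD)
  qed
  \<comment> \<open>Here the size of \<open>'m\<close> is used: by \<open>kB_lepoll\<close> there is
    room for the quotient of each \<open>kB(K,H)\<close>.\<close>
  have "\<exists>\<rho> :: _ \<Rightarrow> 'm. \<forall>x \<in> Hom K H. \<forall>x' \<in> Hom K H. \<rho> x = \<rho> x' \<longleftrightarrow> x \<ominus>\<^bsub>kB k K H\<^esub> x' \<in> M K" if "K \<in> Ob" for K
    using subM that inf card Ob_finite[OF H] Ob_finite[OF that] k hom.module_axioms
    by (intro quotient_map_exists kB_lepoll) (auto simp: subfunctor_def P_simps)
  then obtain \<rho> :: "'g monoid \<Rightarrow> ('c, 'g, 'g) kburnside \<Rightarrow> 'm" where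
    \<rho>: "\<And>K x x'. \<lbrakk>K \<in> Ob; x \<in> Hom K H; x' \<in> Hom K H\<rbrakk> \<Longrightarrow> \<rho> K x = \<rho> K x' \<longleftrightarrow> x \<ominus>\<^bsub>kB k K H\<^esub> x' \<in> M K"
    by metis
  interpret functor_congruence k G ?P \<rho>
  proof (intro functor_congruence.intro functor_congruence_axioms.intro, goal_cases)
    case 1
    show ?case by (rule biset_setting_axioms)
  next
    case 2
    show ?case by (rule P)
  next
    case (3 K)
    have "left_module k (fobj ?P K)"
      using P 3 by (rule BF_module)
    moreover have "module_congruence_axioms k (fobj ?P K) (\<rho> K)"
    proof (rule module_congruence_axioms.intro, unfold P_simps)
      fix x x' y assume x: "x \<in> Hom K H" "x' \<in> Hom K H" "y \<in> Hom K H" "\<rho> K x = \<rho> K x'"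
      have "(x \<oplus>\<^bsub>kB k K H\<^esub> y) \<ominus>\<^bsub>kB k K H\<^esub> (x' \<oplus>\<^bsub>kB k K H\<^esub> y) = x \<ominus>\<^bsub>kB k K H\<^esub> x'"
        using x hom.a_lcomm[of y K H "\<ominus>\<^bsub>kB k K H\<^esub> x'" "\<ominus>\<^bsub>kB k K H\<^esub> y"]
        by (simp add: hom.minus_eq hom.minus_add hom.a_assoc hom.r_neg)
      then show "\<rho> K (x \<oplus>\<^bsub>kB k K H\<^esub> y) = \<rho> K (x' \<oplus>\<^bsub>kB k K H\<^esub> y)"
        using x 3 by (simp add: \<rho>)
    next
      fix c x x' assume x: "c \<in> carrier k" "x \<in> Hom K H" "x' \<in> Hom K H" "\<rho> K x = \<rho> K x'"
      then show "\<rho> K (c \<odot>\<^bsub>kB k K H\<^esub> x) = \<rho> K (c \<odot>\<^bsub>kB k K H\<^esub> x')"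
        using 3 M(4)[OF 3, of c "x \<ominus>\<^bsub>kB k K H\<^esub> x'"]
        by (simp add: \<rho> hom.minus_eq hom.smult_r_distr hom.smult_r_minus)
    qed
    ultimately show ?case
      by (simp add: module_congruence_def)
  next
    case (4 K L a x x')
    have x: "x \<in> Hom K H" "x' \<in> Hom K H"
      using 4 by (simp_all add: P_simps)
    have "kB_comp k L K H a (\<ominus>\<^bsub>kB k K H\<^esub> x') = \<ominus>\<^bsub>kB k L H\<^esub> kB_comp k L K H a x'"
      using 4 x H by (intro additive_minus[of "kB k K H" "kB k L H"]) (simp_all add: comp_closed comp_linear hom.abelian_group_axioms)
    then have "kB_comp k L K H a (x \<ominus>\<^bsub>kB k K H\<^esub> x') = kB_comp k L K H a x \<ominus>\<^bsub>kB k L H\<^esub> kB_comp k L K H a x'"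
      using 4 x H by (simp add: hom.minus_eq comp_linear)
    then show ?case
      using 4 x H Marr[of K L a "x \<ominus>\<^bsub>kB k K H\<^esub> x'"] by (simp add: P_simps \<rho> comp_closed)
  qed
  \<comment> \<open>The maximal subfunctor is the kernel of the quotient map; this translates
    between \<open>A\<close> and \<open>Q\<close>.\<close>
  have mem: "x \<in> M K \<longleftrightarrow> \<rho> K x = \<zero>\<^bsub>fobj Q K\<^esub>" if "K \<in> Ob" "x \<in> Hom K H" for K x
  proof -
    have "\<ominus>\<^bsub>kB k K H\<^esub> \<zero>\<^bsub>kB k K H\<^esub> = \<zero>\<^bsub>kB k K H\<^esub>"
      by (metis hom.a_inv_closed hom.l_zero hom.r_neg hom.zero_closed)
    then have "x \<ominus>\<^bsub>kB k K H\<^esub> \<zero>\<^bsub>kB k K H\<^esub> = x"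
      using that(2) by (metis hom.minus_eq hom.r_zero)
    then show ?thesis
      using that by (simp add: Q_zero P_simps(1) \<rho>)
  qed
  have "simple_functor k G Q"
    unfolding simple_functor_def
  proof (intro conjI allI impI)
    show "Q \<in> BF TYPE('m)" by (rule Q_BF)
    have "\<rho> H (kB_id k H) \<in> carrier (fobj Q H)" "\<rho> H (kB_id k H) \<noteq> \<zero>\<^bsub>fobj Q H\<^esub>"
      using idM H mem[OF H id_closed[OF H]] by (auto simp: Q_carrier P_simps id_closed)
    then show "\<exists>K\<in>Ob. carrier (fobj Q K) \<noteq> {\<zero>\<^bsub>fobj Q K\<^esub>}"
      using H by blast
  next
    fix T assume T: "subfunctor k G Q T"
    \<comment> \<open>The preimage, in the representable functor, of an arbitrary subfunctor
      \<open>T\<close> of the quotient.\<close>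
    define B where "B = (SIGMA K:Ob. {x \<in> Hom K H. \<rho> K x \<in> T K})"
    have BK: "B `` {K} = {x \<in> Hom K H. \<rho> K x \<in> T K}" if "K \<in> Ob" for K
      using that by (auto simp: B_def)
    note TD = T[unfolded subfunctor_iff[OF Q_BF], THEN bspec]
    have subB: "subfunctor k G ?P (\<lambda>K. B `` {K})"
      unfolding subfunctor_iff[OF P]
    proof (intro ballI)
      fix K assume K: "K \<in> Ob"
      have 1: "\<rho> K \<zero>\<^bsub>kB k K H\<^esub> \<in> T K"
        using TD[OF K] Q_zero[OF K] by (simp add: P_simps)
      have 2: "\<rho> K (x \<oplus>\<^bsub>kB k K H\<^esub> y) \<in> T K" if "x \<in> Hom K H" "y \<in> Hom K H" "\<rho> K x \<in> T K" "\<rho> K y \<in> T K" for x y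
        unfolding Q_add[OF K, unfolded P_simps(1), OF that(1,2), symmetric] using TD[OF K] that by blast
      have 3: "\<rho> K (c \<odot>\<^bsub>kB k K H\<^esub> x) \<in> T K" if "c \<in> carrier k" "x \<in> Hom K H" "\<rho> K x \<in> T K" for c x
        unfolding Q_smult[OF K, unfolded P_simps(1), OF that(1,2), symmetric] using TD[OF K] that by blast
      have 4: "\<rho> L (kB_comp k L K H a x) \<in> T L" if "L \<in> Ob" "a \<in> Hom L K" "x \<in> Hom K H" "\<rho> K x \<in> T K" for L a x
        unfolding Q_arr[OF K that(1,2), unfolded P_simps(1), OF that(3), unfolded P_simps(2)[OF that(3)], symmetric]
        using TD[OF K] that by blast
      show "B `` {K} \<subseteq> carrier (fobj ?P K) \<and> \<zero>\<^bsub>fobj ?P K\<^esub> \<in> B `` {K} \<and>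
          (\<forall>x\<in>B `` {K}. \<forall>y\<in>B `` {K}. x \<oplus>\<^bsub>fobj ?P K\<^esub> y \<in> B `` {K}) \<and>
          (\<forall>c\<in>carrier k. \<forall>x\<in>B `` {K}. c \<odot>\<^bsub>fobj ?P K\<^esub> x \<in> B `` {K}) \<and>
          (\<forall>L\<in>Ob. \<forall>a\<in>Hom L K. \<forall>x\<in>B `` {K}. farr ?P K L a x \<in> B `` {L})"
        using 1 2 3 4 K H by (simp add: BK P_simps comp_closed subset_iff)
    qed
    show "(\<forall>K\<in>Ob. T K = {\<zero>\<^bsub>fobj Q K\<^esub>}) \<or> (\<forall>K\<in>Ob. T K = carrier (fobj Q K))"
    proof (cases "kB_id k H \<in> B `` {H}")
      case True
      \<comment> \<open>Every arrow \<open>a\<close> is \<open>a\<close> composed with the identity,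
        so a subfunctor that contains the identity contains everything.\<close>
      have "carrier (fobj Q K) \<subseteq> T K" if K: "K \<in> Ob" for K
      proof -
        have "\<rho> K a \<in> T K" if "a \<in> Hom K H" for a
        proof -
          have "farr ?P H K a (kB_id k H) \<in> B `` {K}"
            using subB True H K that unfolding subfunctor_iff[OF P] by blast
          then show ?thesis
            using H K that by (simp add: P_simps id_closed comp_id BK)
        qed
        then show ?thesis
          using K by (auto simp: Q_carrier P_simps)
      qed
      then have "T K = carrier (fobj Q K)" if "K \<in> Ob" for K
        using TD[OF that] that by blast
      then show ?thesis by blast
    next
      case False
      have AB: "A `` {K} \<subseteq> B `` {K}" if K: "K \<in> Ob" for K
      proof
        fix x assume "x \<in> A `` {K}"
        then have x: "x \<in> M K" "x \<in> Hom K H"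
          using M(1)[OF K] by (auto simp: M_def)
        then have "\<rho> K x \<in> T K"
          using TD[OF K] mem[OF K x(2)] by simp
        then show "x \<in> B `` {K}"
          using K x by (simp add: BK)
      qed
      \<comment> \<open>\<open>B\<close> is empty away from \<open>Ob\<close>, whereas
        \<open>A\<close> is unconstrained there. Maximality is therefore applied to
        \<open>A \<union> B\<close>, which coincides with \<open>B\<close> on
        \<open>Ob\<close>.\<close>
      have "(A \<union> B) `` {K} = B `` {K}" if "K \<in> Ob" for K
        using AB[OF that] by blast
      then have "subfunctor k G ?P (\<lambda>K. (A \<union> B) `` {K}) \<longleftrightarrow> subfunctor k G ?P (\<lambda>K. B `` {K})"
        unfolding subfunctor_def by simp
      then have "A \<union> B \<in> fam"
        using subB A False by (auto simp: fam_def)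
      then have "B \<subseteq> A"
        using max[of "A \<union> B"] by blast
      have "T K = {\<zero>\<^bsub>fobj Q K\<^esub>}" if K: "K \<in> Ob" for K
      proof -
        have "s = \<zero>\<^bsub>fobj Q K\<^esub>" if "s \<in> T K" for s
        proof -
          obtain x where x: "x \<in> Hom K H" "s = \<rho> K x"
            using TD[OF K] \<open>s \<in> T K\<close> K by (auto simp: Q_carrier P_simps)
          then have "(K, x) \<in> B"
            using \<open>s \<in> T K\<close> K by (simp add: B_def)
          then have "x \<in> M K"
            using \<open>B \<subseteq> A\<close> by (auto simp: M_def)
          then show ?thesis
            using mem[OF K x(1)] x by simp
        qed
        moreover have "\<zero>\<^bsub>fobj Q K\<^esub> \<in> T K"
          using TD[OF K] by simp
        ultimately show ?thesis by blast
      qed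
      then show ?thesis by blast
    qed
  qed
  moreover have "carrier (fobj Q G) = {\<zero>\<^bsub>fobj Q G\<^esub>}"
  proof -
    \<comment> \<open>An arrow \<open>x\<close> from \<open>H\<close> to \<open>G\<close> is
      \<open>x\<close> followed by the identity of \<open>G\<close>, so it lies in the
      ideal.\<close>
    have "\<rho> G x = \<zero>\<^bsub>fobj Q G\<^esub>" if x: "x \<in> Hom G H" for x
    proof -
      have "kB_comp k G G H (kB_id k G) x \<in> through k G G H"
        using x id_closed[OF G_Ob] by (rule through_comp)
      then have "x \<in> M G"
        using throughM[OF G_Ob] comp_id(1)[OF H G_Ob x] by auto
      then show ?thesis
        using mem[OF G_Ob x] by simp
    qed
    then show ?thesis
      using hom.zero_closed by (force simp: Q_carrier G_Ob P_simps)
  qed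
  ultimately show False
    using nv by (auto simp: non_vanishing_def)
qed

end

section \<open>Evaluation when every identity factors through the group\<close>

text \<open>The maps of left modules over the double Burnside algebra from \<open>kB(G,H)\<close> to
  \<open>M\<close>. The model is an element \<open>y\<close> of \<open>F(H)\<close> seen from
  \<open>G\<close>: it gives the map sending \<open>a\<close> to \<open>F(a) y\<close>, which is
  equivariant because \<open>F(d a) y = F(d)(F(a) y)\<close>.\<close>

definition equivariant_maps :: "'c ring \<Rightarrow> 'g monoid \<Rightarrow> (('c, 'g, 'g) kburnside, 'm) module \<Rightarrow> 'g monoid \<Rightarrow>
    (('c, 'g, 'g) kburnside \<Rightarrow> 'm) set" where
  "equivariant_maps k G M H = {f \<in> carrier (kB k G H) \<rightarrow>\<^sub>E carrier M.
     (\<forall>x \<in> carrier (kB k G H). \<forall>y \<in> carrier (kB k G H). f (x \<oplus>\<^bsub>kB k G H\<^esub> y) = f x \<oplus>\<^bsub>M\<^esub> f y) \<and>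
     (\<forall>d \<in> carrier (kB k G G). \<forall>x \<in> carrier (kB k G H). f (kB_comp k G G H d x) = d \<odot>\<^bsub>M\<^esub> f x)}"

text \<open>Only the double Burnside algebra acts on \<open>M\<close>, so \<open>k\<close> acts on maps through their argument.\<close>

definition coinduced :: "'c ring \<Rightarrow> 'g monoid \<Rightarrow> (('c, 'g, 'g) kburnside, 'm) module \<Rightarrow>
    ('c, 'g, ('c, 'g, 'g) kburnside \<Rightarrow> 'm) biset_functor" where
  "coinduced k G M = \<lparr>
     fobj = (\<lambda>H. \<lparr>carrier = equivariant_maps k G M H,
        mult = (\<lambda>_ _. undefined), one = undefined,
        zero = (\<lambda>x \<in> carrier (kB k G H). \<zero>\<^bsub>M\<^esub>),
        add = (\<lambda>f g. \<lambda>x \<in> carrier (kB k G H). f x \<oplus>\<^bsub>M\<^esub> g x),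
        smult = (\<lambda>c f. \<lambda>x \<in> carrier (kB k G H). f (c \<odot>\<^bsub>kB k G H\<^esub> x))\<rparr>),
     farr = (\<lambda>H K a. \<lambda>f \<in> equivariant_maps k G M H.
        \<lambda>x \<in> carrier (kB k G K). f (kB_comp k G K H x a))\<rparr>"

section \<open>Full faithfulness of evaluation\<close>

locale generated = biset_setting k G for k :: "'c ring" and G :: "'g monoid" +
  assumes id_through: "H \<in> Ob \<Longrightarrow> kB_id k H \<in> through k G H H"
begin

text \<open>The induction shows that \<open>F(c) y\<close> is determined by the tested values for
  every \<open>c\<close> in the ideal, and the identity is one of these \<open>c\<close>.\<close>

lemma separation:
  assumes F: "F \<in> BF TYPE('m)" and H: "H \<in> Ob" and y: "y \<in> carrier (fobj F H)" "y' \<in> carrier (fobj F H)"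
    and eq: "\<And>a. a \<in> Hom G H \<Longrightarrow> farr F H G a y = farr F H G a y'"
  shows "y = y'"
proof -
  have "farr F H H c y = farr F H H c y'" if "c \<in> through k G H H" for c
    using that
  proof induction
    case (through_comp a b)
    then show ?case
      using H G_Ob y eq by (simp add: BF_comp[OF F])
  next
    case (through_add c c')
    then show ?case
      using H y by (simp add: BF_add_left[OF F] through_closed)
  qed
  from this[OF id_through[OF H]] show ?thesis
    using H y by (simp add: BF_id[OF F])
qed

text \<open>Naturality along \<open>a\<close> from \<open>H\<close> to \<open>G\<close> gives
  \<open>F'(a)(\<eta> H x) = \<eta> G (F(a) x)\<close>, so the component at \<open>G\<close> fixes
  all the values that \<open>separation\<close> tests.\<close>

lemma evaluation_faithful:
  assumes F': "F' \<in> BF TYPE('m)"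
    and \<eta>: "\<eta> \<in> arr (BFC TYPE('m)) F F'" and \<theta>: "\<theta> \<in> arr (BFC TYPE('m)) F F'"
    and F: "F \<in> BF TYPE('m)" and eq: "\<eta> G = \<theta> G"
  shows "\<eta> = \<theta>"
proof (rule extensionalityI[of _ Ob])
  fix H assume H: "H \<in> Ob"
  have \<eta>H: "\<eta> H \<in> linear_maps k (fobj F H) (fobj F' H)" and \<theta>H: "\<theta> H \<in> linear_maps k (fobj F H) (fobj F' H)"
    using \<eta> \<theta> H by (simp_all add: BF_arr_iff)
  show "\<eta> H = \<theta> H"
  proof (rule linear_maps_eqI[OF \<eta>H \<theta>H])
    fix x assume x: "x \<in> carrier (fobj F H)"
    show "\<eta> H x = \<theta> H x"
    proof (rule separation[OF F' H])
      fix a assume a: "a \<in> Hom G H"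
      show "farr F' H G a (\<eta> H x) = farr F' H G a (\<theta> H x)"
        using BF_natural[OF \<eta> H G_Ob a x] BF_natural[OF \<theta> H G_Ob a x] eq by simp
    qed (use x linear_maps_closed[OF \<eta>H] linear_maps_closed[OF \<theta>H] in auto)
  qed
qed (use \<eta> \<theta> in \<open>auto simp: BF_arr_iff\<close>)

text \<open>The extension is forced: \<open>\<eta> H x\<close> must be an element \<open>y\<close>
  with \<open>F'(a) y = f (F(a) x)\<close> for all \<open>a\<close> from \<open>H\<close> to
  \<open>G\<close>. By \<open>separation\<close> there is at most one, so linearity and naturality
  are checked by applying all \<open>F'(a)\<close>. Existence comes from
  \<open>y = sum F'(b_i)(f (F(a_i) x))\<close>.\<close>

lemma evaluation_full:
  assumes F: "F \<in> BF TYPE('m)" and F': "F' \<in> BF TYPE('m)"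
    and f: "f \<in> linear_maps DB (fobj (evaluation G) F) (fobj (evaluation G) F')"
  obtains \<eta> where "\<eta> \<in> arr (BFC TYPE('m)) F F'" "\<eta> G = f"
proof -
  have f_closed: "f x \<in> carrier (fobj F' G)" if "x \<in> carrier (fobj F G)" for x
    using linear_maps_closed[OF f, of x] that by (simp add: evaluation_def Let_def)
  have f_add: "f (x \<oplus>\<^bsub>fobj F G\<^esub> y) = f x \<oplus>\<^bsub>fobj F' G\<^esub> f y" if "x \<in> carrier (fobj F G)" "y \<in> carrier (fobj F G)" for x y
    using linear_maps_add[OF f, of x y] that by (simp add: evaluation_def Let_def)
  have f_arr: "f (farr F G G d x) = farr F' G G d (f x)" if "d \<in> Hom G G" "x \<in> carrier (fobj F G)" for d x
    using linear_maps_smult[OF f, of d x] that by (simp add: evaluation_def Let_def DB_simps)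
  \<comment> \<open>Linearity over \<open>k\<close> is linearity over the double Burnside algebra
    for multiples of the identity of \<open>G\<close>.\<close>
  have f_smult: "f (c \<odot>\<^bsub>fobj F G\<^esub> x) = c \<odot>\<^bsub>fobj F' G\<^esub> f x" if "c \<in> carrier k" "x \<in> carrier (fobj F G)" for c x
    using f_arr[of "c \<odot>\<^bsub>kB k G G\<^esub> kB_id k G" x] that G_Ob f_closed
    by (simp add: BF_smult_left[OF F] BF_smult_left[OF F'] BF_id[OF F] BF_id[OF F'] id_closed)
  have ex: "\<exists>y \<in> carrier (fobj F' H). \<forall>a \<in> Hom G H. farr F' H G a y = f (farr F H G a x)"
    if H: "H \<in> Ob" and x: "x \<in> carrier (fobj F H)" for H x
  proof -
    \<comment> \<open>For general \<open>c\<close> the claim is about \<open>F(c) x\<close> in place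
      of \<open>x\<close>. In this form it passes to sums in \<open>c\<close>, and at the identity
      it is the goal.\<close>
    have "\<exists>y \<in> carrier (fobj F' H). \<forall>a \<in> Hom G H. farr F' H G a y = f (farr F H G (kB_comp k G H H a c) x)"
      if "c \<in> through k G H H" for c
      using that
    proof induction
      case (through_comp a0 b)
      have x0: "farr F H G a0 x \<in> carrier (fobj F G)"
        using through_comp H x by (simp add: BF_closed[OF F] G_Ob)
      show ?case
      proof (intro bexI ballI)
        show "farr F' G H b (f (farr F H G a0 x)) \<in> carrier (fobj F' H)"
          using through_comp H x0 by (simp add: BF_closed[OF F'] f_closed G_Ob)
        fix a assume a: "a \<in> Hom G H"
        \<comment> \<open>The composite of \<open>b\<close> and \<open>a\<close> is an endomorphism
          of \<open>G\<close>, so \<open>f\<close> commutes with its action.\<close>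
        have "f (farr F H G (kB_comp k G H H a (kB_comp k H G H b a0)) x)
            = f (farr F G G (kB_comp k G H G a b) (farr F H G a0 x))"
          using through_comp H x a G_Ob
          by (simp add: comp_assoc[symmetric] BF_comp[OF F, symmetric] comp_closed)
        also have "\<dots> = farr F' G G (kB_comp k G H G a b) (f (farr F H G a0 x))"
          using through_comp H x0 a G_Ob by (simp add: f_arr comp_closed)
        also have "\<dots> = farr F' H G a (farr F' G H b (f (farr F H G a0 x)))"
          using through_comp H x0 a G_Ob by (simp add: BF_comp[OF F'] f_closed)
        finally show "farr F' H G a (farr F' G H b (f (farr F H G a0 x))) = f (farr F H G (kB_comp k G H H a (kB_comp k H G H b a0)) x)"
          by simp
      qed
    next
      case (through_add c c')
      then obtain y y' where y: "y \<in> carrier (fobj F' H)" "y' \<in> carrier (fobj F' H)"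
        "\<And>a. a \<in> Hom G H \<Longrightarrow> farr F' H G a y = f (farr F H G (kB_comp k G H H a c) x)"
        "\<And>a. a \<in> Hom G H \<Longrightarrow> farr F' H G a y' = f (farr F H G (kB_comp k G H H a c') x)"
        by blast
      interpret N: left_module k "fobj F' H"
        using F' H by (rule BF_module)
      have "farr F' H G a (y \<oplus>\<^bsub>fobj F' H\<^esub> y') = f (farr F H G (kB_comp k G H H a (c \<oplus>\<^bsub>kB k H H\<^esub> c')) x)"
        if a: "a \<in> Hom G H" for a
        using y a H x G_Ob through_closed[OF H H through_add(1)] through_closed[OF H H through_add(2)]
        by (simp add: BF_add[OF F'] comp_linear BF_add_left[OF F] comp_closed f_add BF_closed[OF F])
      moreover have "y \<oplus>\<^bsub>fobj F' H\<^esub> y' \<in> carrier (fobj F' H)"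
        using y by simp
      ultimately show ?case
        by blast
    qed
    from this[OF id_through[OF H]] show ?thesis
      using H G_Ob by (simp add: comp_id)
  qed
  define \<eta> where "\<eta> = (\<lambda>H\<in>Ob. \<lambda>x\<in>carrier (fobj F H).
      SOME y. y \<in> carrier (fobj F' H) \<and> (\<forall>a \<in> Hom G H. farr F' H G a y = f (farr F H G a x)))"
  have \<eta>: "\<eta> H x \<in> carrier (fobj F' H) \<and> (\<forall>a \<in> Hom G H. farr F' H G a (\<eta> H x) = f (farr F H G a x))"
    if "H \<in> Ob" "x \<in> carrier (fobj F H)" for H x
    using that someI_ex[of "\<lambda>y. y \<in> carrier (fobj F' H) \<and> (\<forall>a \<in> Hom G H. farr F' H G a y = f (farr F H G a x))"]
      ex[OF that] by (auto simp: \<eta>_def)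
  have \<eta>_lin: "\<eta> H \<in> linear_maps k (fobj F H) (fobj F' H)" if H: "H \<in> Ob" for H
  proof -
    interpret M: left_module k "fobj F H" using F H by (rule BF_module)
    interpret N: left_module k "fobj F' H" using F' H by (rule BF_module)
    show ?thesis
    proof (rule linear_mapsI)
      show "\<eta> H \<in> extensional (carrier (fobj F H))"
        using H by (simp add: \<eta>_def)
      show "\<eta> H x \<in> carrier (fobj F' H)" if "x \<in> carrier (fobj F H)" for x
        using \<eta>[OF H that] by blast
      show "\<eta> H (x \<oplus>\<^bsub>fobj F H\<^esub> y) = \<eta> H x \<oplus>\<^bsub>fobj F' H\<^esub> \<eta> H y"
        if "x \<in> carrier (fobj F H)" "y \<in> carrier (fobj F H)" for x y
        by (rule separation[OF F' H])
          (use that \<eta>[OF H] H G_Ob in \<open>simp_all add: BF_add[OF F] BF_add[OF F'] f_add BF_closed[OF F]\<close>)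
      show "\<eta> H (c \<odot>\<^bsub>fobj F H\<^esub> x) = c \<odot>\<^bsub>fobj F' H\<^esub> \<eta> H x"
        if "c \<in> carrier k" "x \<in> carrier (fobj F H)" for c x
        by (rule separation[OF F' H])
          (use that \<eta>[OF H] H G_Ob in \<open>simp_all add: M.smult_closed N.smult_closed BF_smult[OF F] BF_smult[OF F'] f_smult BF_closed[OF F]\<close>)
    qed
  qed
  have "\<eta> \<in> arr (BFC TYPE('m)) F F'"
  proof (rule BF_arrI)
    fix H K c x assume HK: "H \<in> Ob" "K \<in> Ob" "c \<in> Hom K H" "x \<in> carrier (fobj F H)"
    show "\<eta> K (farr F H K c x) = farr F' H K c (\<eta> H x)"
      by (rule separation[OF F' HK(2)])
        (use HK \<eta> G_Ob in \<open>simp_all add: BF_closed[OF F] BF_closed[OF F'] BF_comp[OF F, symmetric] BF_comp[OF F', symmetric] comp_closed\<close>)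
  qed (use \<eta>_lin in \<open>auto simp: \<eta>_def\<close>)
  moreover have "\<eta> G = f"
  proof (rule extensionalityI[of _ "carrier (fobj F G)"])
    show "\<eta> G \<in> extensional (carrier (fobj F G))"
      using linear_maps_ext[OF \<eta>_lin[OF G_Ob]] .
    show "f \<in> extensional (carrier (fobj F G))"
      using linear_maps_ext[OF f] by (simp add: evaluation_def Let_def)
    fix x assume x: "x \<in> carrier (fobj F G)"
    show "\<eta> G x = f x"
      by (rule separation[OF F' G_Ob]) (use \<eta>[OF G_Ob x] x f_closed f_arr in auto)
  qed
  ultimately show thesis
    using that by blast
qed

section \<open>Essential surjectivity through equivariant maps\<close>

context
  fixes M :: "(('c, 'g, 'g) kburnside, 'm) module"
  assumes M: "left_module DB M"
begin

interpretation M: left_module DB M by (rule M)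

abbreviation E where "E \<equiv> coinduced k G M"

lemma E_carrier: "f \<in> carrier (fobj E H) \<longleftrightarrow> f \<in> extensional (Hom G H) \<and>
    (\<forall>x \<in> Hom G H. f x \<in> carrier M) \<and>
    (\<forall>x \<in> Hom G H. \<forall>y \<in> Hom G H. f (x \<oplus>\<^bsub>kB k G H\<^esub> y) = f x \<oplus>\<^bsub>M\<^esub> f y) \<and>
    (\<forall>d \<in> Hom G G. \<forall>x \<in> Hom G H. f (kB_comp k G G H d x) = d \<odot>\<^bsub>M\<^esub> f x)"
  by (auto simp: coinduced_def equivariant_maps_def PiE_def)

lemma E_I:
  assumes "f \<in> extensional (Hom G H)" "\<And>x. x \<in> Hom G H \<Longrightarrow> f x \<in> carrier M"
    and "\<And>x y. \<lbrakk>x \<in> Hom G H; y \<in> Hom G H\<rbrakk> \<Longrightarrow> f (x \<oplus>\<^bsub>kB k G H\<^esub> y) = f x \<oplus>\<^bsub>M\<^esub> f y"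
    and "\<And>d x. \<lbrakk>d \<in> Hom G G; x \<in> Hom G H\<rbrakk> \<Longrightarrow> f (kB_comp k G G H d x) = d \<odot>\<^bsub>M\<^esub> f x"
  shows "f \<in> carrier (fobj E H)"
  using assms by (simp add: E_carrier)

lemma E_D:
  assumes "f \<in> carrier (fobj E H)"
  shows E_ext: "f \<in> extensional (Hom G H)"
    and E_closed: "x \<in> Hom G H \<Longrightarrow> f x \<in> carrier M"
    and E_add: "\<lbrakk>x \<in> Hom G H; y \<in> Hom G H\<rbrakk> \<Longrightarrow> f (x \<oplus>\<^bsub>kB k G H\<^esub> y) = f x \<oplus>\<^bsub>M\<^esub> f y"
    and E_comp: "\<lbrakk>d \<in> Hom G G; x \<in> Hom G H\<rbrakk> \<Longrightarrow> f (kB_comp k G G H d x) = d \<odot>\<^bsub>M\<^esub> f x"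
  using assms by (simp_all add: E_carrier)

lemma E_simps:
  "\<zero>\<^bsub>fobj E H\<^esub> = (\<lambda>x \<in> Hom G H. \<zero>\<^bsub>M\<^esub>)"
  "f \<oplus>\<^bsub>fobj E H\<^esub> g = (\<lambda>x \<in> Hom G H. f x \<oplus>\<^bsub>M\<^esub> g x)"
  "c \<odot>\<^bsub>fobj E H\<^esub> f = (\<lambda>x \<in> Hom G H. f (c \<odot>\<^bsub>kB k G H\<^esub> x))"
  "f \<in> carrier (fobj E H) \<Longrightarrow> farr E H K a f = (\<lambda>x \<in> Hom G K. f (kB_comp k G K H x a))"
  by (simp_all add: coinduced_def)

lemma E_eqI:
  assumes "f \<in> carrier (fobj E H)" "g \<in> carrier (fobj E H)" "\<And>x. x \<in> Hom G H \<Longrightarrow> f x = g x"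
  shows "f = g"
  using assms(3) by (intro extensionalityI[OF E_ext[OF assms(1)] E_ext[OF assms(2)]])

lemma E_zero_closed: "\<zero>\<^bsub>fobj E H\<^esub> \<in> carrier (fobj E H)" if "H \<in> Ob"
  using that G_Ob by (simp add: E_carrier E_simps comp_closed M.smult_r_zero DB_simps)

lemma E_add_closed:
  assumes "H \<in> Ob" and f: "f \<in> carrier (fobj E H)" and g: "g \<in> carrier (fobj E H)"
  shows "f \<oplus>\<^bsub>fobj E H\<^esub> g \<in> carrier (fobj E H)"
  using assms G_Ob
  unfolding E_simps
  by (intro E_I) (simp_all add: comp_closed E_D(2-4)[OF f] E_D(2-4)[OF g] M.smult_r_distr DB_simps M.M.a_ac)

lemma E_smult_closed:
  assumes "H \<in> Ob" and f: "f \<in> carrier (fobj E H)" and c: "c \<in> carrier k"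
  shows "c \<odot>\<^bsub>fobj E H\<^esub> f \<in> carrier (fobj E H)"
  using assms G_Ob
  unfolding E_simps
  by (intro E_I) (simp_all add: comp_closed E_D(2-4)[OF f] hom.smult_r_distr comp_linear(3)[symmetric])

text \<open>Composition with \<open>a\<close> on the source side commutes with the left action of
  the algebra by associativity, so equivariance is preserved.\<close>

lemma E_arr_closed:
  assumes "H \<in> Ob" "K \<in> Ob" "a \<in> Hom K H" and f: "f \<in> carrier (fobj E H)"
  shows "farr E H K a f \<in> carrier (fobj E K)"
  using assms G_Ob
  unfolding E_simps(4)[OF f]
  by (intro E_I) (simp_all add: comp_closed E_D(2-4)[OF f] comp_linear comp_assoc)

lemma left_module_E:
  assumes H: "H \<in> Ob"
  shows "left_module k (fobj E H)"
proof -
  have "abelian_group (fobj E H)"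
  proof (rule abelian_groupI)
    fix f assume f: "f \<in> carrier (fobj E H)"
    \<comment> \<open>The negative of \<open>f\<close> is taken as minus one times \<open>f\<close>,
      that is, \<open>f\<close> applied to negated arguments, so that \<open>E_smult_closed\<close>
      gives its membership at once.\<close>
    define g where "g = (\<ominus>\<^bsub>k\<^esub> \<one>\<^bsub>k\<^esub>) \<odot>\<^bsub>fobj E H\<^esub> f"
    have "\<ominus>\<^bsub>k\<^esub> \<one>\<^bsub>k\<^esub> \<in> carrier k"
      using k by (simp add: cring.cring_simprules)
    then have g: "g \<in> carrier (fobj E H)"
      unfolding g_def using H f by (intro E_smult_closed)
    have "f \<zero>\<^bsub>kB k G H\<^esub> = \<zero>\<^bsub>M\<^esub>"
      using hom.abelian_group_axioms M.M.abelian_group_axioms E_closed[OF f] E_add[OF f] by (rule additive_zero)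
    then have "f (\<ominus>\<^bsub>kB k G H\<^esub> x) \<oplus>\<^bsub>M\<^esub> f x = \<zero>\<^bsub>M\<^esub>" if "x \<in> Hom G H" for x
      using E_add[OF f, of "\<ominus>\<^bsub>kB k G H\<^esub> x" x] that by (simp add: hom.l_neg)
    then have "g \<oplus>\<^bsub>fobj E H\<^esub> f = \<zero>\<^bsub>fobj E H\<^esub>"
      by (auto simp: E_simps g_def hom.smult_l_minus intro!: restrict_ext)
    then show "\<exists>g\<in>carrier (fobj E H). g \<oplus>\<^bsub>fobj E H\<^esub> f = \<zero>\<^bsub>fobj E H\<^esub>"
      using g by blast
  next
    fix f g h assume f: "f \<in> carrier (fobj E H)" and g: "g \<in> carrier (fobj E H)" and h: "h \<in> carrier (fobj E H)"
    show "f \<oplus>\<^bsub>fobj E H\<^esub> g \<oplus>\<^bsub>fobj E H\<^esub> h = f \<oplus>\<^bsub>fobj E H\<^esub> (g \<oplus>\<^bsub>fobj E H\<^esub> h)"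
      by (auto simp: E_simps M.M.a_assoc E_closed[OF f] E_closed[OF g] E_closed[OF h] intro!: restrict_ext)
  next
    fix f g assume f: "f \<in> carrier (fobj E H)" and g: "g \<in> carrier (fobj E H)"
    show "f \<oplus>\<^bsub>fobj E H\<^esub> g = g \<oplus>\<^bsub>fobj E H\<^esub> f"
      by (auto simp: E_simps M.M.a_comm E_closed[OF f] E_closed[OF g] intro!: restrict_ext)
  next
    fix f assume f: "f \<in> carrier (fobj E H)"
    show "\<zero>\<^bsub>fobj E H\<^esub> \<oplus>\<^bsub>fobj E H\<^esub> f = f"
      by (rule E_eqI[OF E_add_closed[OF H E_zero_closed[OF H] f] f]) (simp add: E_simps E_closed[OF f])
  qed (auto simp: H E_zero_closed E_add_closed)
  moreover have "left_module_axioms k (fobj E H)"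
  proof (rule left_module_axioms.intro)
    fix c d f assume c: "c \<in> carrier k" "d \<in> carrier k" and f: "f \<in> carrier (fobj E H)"
    show "(c \<oplus>\<^bsub>k\<^esub> d) \<odot>\<^bsub>fobj E H\<^esub> f = c \<odot>\<^bsub>fobj E H\<^esub> f \<oplus>\<^bsub>fobj E H\<^esub> d \<odot>\<^bsub>fobj E H\<^esub> f"
      using c by (auto simp: E_simps hom.smult_l_distr E_add[OF f] intro!: restrict_ext)
    \<comment> \<open>Scalars act through the argument, which reverses their order; commutativity of
      \<open>k\<close> restores it.\<close>
    have "(c \<otimes>\<^bsub>k\<^esub> d) \<odot>\<^bsub>kB k G H\<^esub> x = d \<odot>\<^bsub>kB k G H\<^esub> (c \<odot>\<^bsub>kB k G H\<^esub> x)" if "x \<in> Hom G H" for x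
      using c that hom.smult_assoc1[of d c x] k by (simp add: cring.cring_simprules(14))
    then show "(c \<otimes>\<^bsub>k\<^esub> d) \<odot>\<^bsub>fobj E H\<^esub> f = c \<odot>\<^bsub>fobj E H\<^esub> (d \<odot>\<^bsub>fobj E H\<^esub> f)"
      using c by (auto simp: E_simps intro!: restrict_ext)
  next
    fix c f g assume c: "c \<in> carrier k" and f: "f \<in> carrier (fobj E H)" and g: "g \<in> carrier (fobj E H)"
    show "c \<odot>\<^bsub>fobj E H\<^esub> (f \<oplus>\<^bsub>fobj E H\<^esub> g) = c \<odot>\<^bsub>fobj E H\<^esub> f \<oplus>\<^bsub>fobj E H\<^esub> c \<odot>\<^bsub>fobj E H\<^esub> g"
      using c by (auto simp: E_simps intro!: restrict_ext)
  next
    fix f assume f: "f \<in> carrier (fobj E H)"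
    show "\<one>\<^bsub>k\<^esub> \<odot>\<^bsub>fobj E H\<^esub> f = f"
      using k by (intro E_eqI[OF E_smult_closed[OF H f] f]) (simp_all add: E_simps cring.cring_simprules(6))
  qed (auto simp: H E_smult_closed)
  ultimately show ?thesis
    using k by (simp add: left_module_def cring_def)
qed

lemma E_BF: "E \<in> BF TYPE(('c, 'g, 'g) kburnside \<Rightarrow> 'm)"
proof (rule BF_I)
  fix H K a assume HK: "H \<in> Ob" "K \<in> Ob" "a \<in> Hom K H"
  show "farr E H K a \<in> linear_maps k (fobj E H) (fobj E K)"
  proof (rule linear_mapsI)
    fix f g assume fg: "f \<in> carrier (fobj E H)" "g \<in> carrier (fobj E H)"
    show "farr E H K a (f \<oplus>\<^bsub>fobj E H\<^esub> g) = farr E H K a f \<oplus>\<^bsub>fobj E K\<^esub> farr E H K a g"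
      using HK fg G_Ob
      by (simp add: E_simps(4) E_add_closed) (auto simp: E_simps(2) comp_closed intro!: restrict_ext)
  next
    fix c f assume "c \<in> carrier k" "f \<in> carrier (fobj E H)"
    then show "farr E H K a (c \<odot>\<^bsub>fobj E H\<^esub> f) = c \<odot>\<^bsub>fobj E K\<^esub> farr E H K a f"
      using HK G_Ob
      by (simp add: E_simps(4) E_smult_closed) (auto simp: E_simps(3) comp_closed comp_linear intro!: restrict_ext)
  qed (use HK in \<open>auto simp: E_arr_closed\<close>, simp add: coinduced_def)
next
  fix H f assume "H \<in> Ob" "f \<in> carrier (fobj E H)"
  then show "farr E H H (kB_id k H) f = f"
    by (intro E_eqI[of _ H]) (auto simp: E_arr_closed id_closed, simp add: E_simps comp_id G_Ob)
next
  fix H K L a b f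
  assume "H \<in> Ob" "K \<in> Ob" "L \<in> Ob" "a \<in> Hom K H" "b \<in> Hom L K" "f \<in> carrier (fobj E H)"
  then show "farr E H L (kB_comp k L K H b a) f = farr E K L b (farr E H K a f)"
    using G_Ob by (simp add: E_simps(4)[OF E_arr_closed]) (auto simp: E_simps comp_closed comp_assoc intro!: restrict_ext)
next
  fix H K a b f
  assume H: "H \<in> Ob" "K \<in> Ob" "a \<in> Hom K H" "b \<in> Hom K H" and f: "f \<in> carrier (fobj E H)"
  show "farr E H K (a \<oplus>\<^bsub>kB k K H\<^esub> b) f = farr E H K a f \<oplus>\<^bsub>fobj E K\<^esub> farr E H K b f"
    using H f G_Ob by (auto simp: E_simps comp_linear comp_closed E_add[OF f] intro!: restrict_ext)
next
  fix H K a c f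
  assume "H \<in> Ob" "K \<in> Ob" "a \<in> Hom K H" "c \<in> carrier k" "f \<in> carrier (fobj E H)"
  then show "farr E H K (c \<odot>\<^bsub>kB k K H\<^esub> a) f = c \<odot>\<^bsub>fobj E K\<^esub> farr E H K a f"
    using G_Ob by (auto simp: E_simps comp_linear intro!: restrict_ext)
qed (rule left_module_E)

text \<open>For \<open>c\<close> equal to \<open>b\<close> after \<open>a0\<close> through
  \<open>G\<close>, equivariance gives \<open>f(a c) = (a b) f(a0)\<close>, so the single value at
  \<open>a0\<close> governs \<open>f\<close> on all arrows \<open>a c\<close>. Sums of such
  \<open>c\<close> take unions of the test sets, and at the identity of \<open>H\<close> the arrows
  \<open>a c\<close> are all arrows.\<close>

lemma E_determined:
  assumes H: "H \<in> Ob"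
  shows "\<exists>S. finite S \<and> (\<forall>f \<in> carrier (fobj E H). \<forall>g \<in> carrier (fobj E H). (\<forall>s \<in> S. f s = g s) \<longrightarrow> f = g)"
proof -
  have "\<exists>S. finite S \<and> (\<forall>f \<in> carrier (fobj E H). \<forall>g \<in> carrier (fobj E H). (\<forall>s \<in> S. f s = g s) \<longrightarrow>
      (\<forall>a \<in> Hom G H. f (kB_comp k G H H a c) = g (kB_comp k G H H a c)))" if "c \<in> through k G H H" for c
    using that
  proof induction
    case (through_comp a0 b)
    have eq: "f (kB_comp k G H H a (kB_comp k H G H b a0)) = kB_comp k G H G a b \<odot>\<^bsub>M\<^esub> f a0"
      if "f \<in> carrier (fobj E H)" "a \<in> Hom G H" for f a
      using that through_comp H G_Ob E_comp[OF that(1), of "kB_comp k G H G a b" a0]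
      by (simp add: comp_assoc comp_closed)
    show ?case
      by (intro exI[of _ "{a0}"]) (auto simp: eq)
  next
    case (through_add c c')
    obtain S where "finite S" and S: "\<forall>f \<in> carrier (fobj E H). \<forall>g \<in> carrier (fobj E H). (\<forall>s \<in> S. f s = g s) \<longrightarrow>
        (\<forall>a \<in> Hom G H. f (kB_comp k G H H a c) = g (kB_comp k G H H a c))"
      using through_add(3) by (elim exE conjE)
    obtain S' where "finite S'" and S': "\<forall>f \<in> carrier (fobj E H). \<forall>g \<in> carrier (fobj E H). (\<forall>s \<in> S'. f s = g s) \<longrightarrow>
        (\<forall>a \<in> Hom G H. f (kB_comp k G H H a c') = g (kB_comp k G H H a c'))"
      using through_add(4) by (elim exE conjE)
    have eq: "f (kB_comp k G H H a (c \<oplus>\<^bsub>kB k H H\<^esub> c')) = f (kB_comp k G H H a c) \<oplus>\<^bsub>M\<^esub> f (kB_comp k G H H a c')"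
      if "f \<in> carrier (fobj E H)" "a \<in> Hom G H" for f a
      using that H G_Ob through_closed[OF H H through_add(1)] through_closed[OF H H through_add(2)]
      by (simp add: comp_linear E_add comp_closed)
    have "f (kB_comp k G H H a (c \<oplus>\<^bsub>kB k H H\<^esub> c')) = g (kB_comp k G H H a (c \<oplus>\<^bsub>kB k H H\<^esub> c'))"
      if "f \<in> carrier (fobj E H)" "g \<in> carrier (fobj E H)" "\<forall>s \<in> S \<union> S'. f s = g s" "a \<in> Hom G H" for f g a
    proof -
      have "f (kB_comp k G H H a c) = g (kB_comp k G H H a c)" "f (kB_comp k G H H a c') = g (kB_comp k G H H a c')"
        using S S' that by blast+
      then show ?thesis
        by (simp only: eq[OF that(1,4)] eq[OF that(2,4)])
    qed
    then show ?case
      using \<open>finite S\<close> \<open>finite S'\<close> by (intro exI[of _ "S \<union> S'"]) blast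
  qed
  from this[OF id_through[OF H]] obtain S where "finite S"
    and S: "\<forall>f \<in> carrier (fobj E H). \<forall>g \<in> carrier (fobj E H). (\<forall>s \<in> S. f s = g s) \<longrightarrow>
        (\<forall>a \<in> Hom G H. f (kB_comp k G H H a (kB_id k H)) = g (kB_comp k G H H a (kB_id k H)))"
    by (elim exE conjE)
  have "f = g" if "f \<in> carrier (fobj E H)" "g \<in> carrier (fobj E H)" "\<forall>s \<in> S. f s = g s" for f g
  proof (rule E_eqI[OF that(1,2)])
    fix x assume x: "x \<in> Hom G H"
    then have "f (kB_comp k G H H x (kB_id k H)) = g (kB_comp k G H H x (kB_id k H))"
      using S that by blast
    then show "f x = g x"
      using x H G_Ob by (simp add: comp_id)
  qed
  then show ?thesis
    using \<open>finite S\<close> by blast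
qed

text \<open>\<open>f\<close> is encoded by the list of its values on a finite determining set; lists
  over an infinite type are in bijection with the type itself.\<close>

lemma E_inj:
  assumes inf: "infinite (UNIV :: 'm set)" and H: "H \<in> Ob"
  shows "\<exists>\<rho> :: (('c, 'g, 'g) kburnside \<Rightarrow> 'm) \<Rightarrow> 'm. inj_on \<rho> (carrier (fobj E H))"
proof -
  obtain S where S: "finite S" "\<And>f g. \<lbrakk>f \<in> carrier (fobj E H); g \<in> carrier (fobj E H); \<forall>s \<in> S. f s = g s\<rbrakk> \<Longrightarrow> f = g"
    using E_determined[OF H] by blast
  obtain xs where xs: "set xs = S"
    using finite_list[OF S(1)] by blast
  obtain j :: "'m list \<Rightarrow> 'm" where j: "bij j"
    using lists_infinite_bij_betw_types[OF inf] by blast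
  have "inj_on (\<lambda>f. j (map f xs)) (carrier (fobj E H))"
  proof (rule inj_onI)
    fix f g assume "f \<in> carrier (fobj E H)" "g \<in> carrier (fobj E H)" and eq: "j (map f xs) = j (map g xs)"
    moreover have "map f xs = map g xs"
      using j eq by (simp add: bij_def inj_eq)
    ultimately show "f = g"
      using S(2) xs by simp
  qed
  then show ?thesis by blast
qed

text \<open>At \<open>G\<close> the construction is the module of linear maps from the algebra to
  \<open>M\<close>, which evaluation at the identity identifies with \<open>M\<close>.\<close>

lemma evaluation_essentially_surjective:
  assumes inf: "infinite (UNIV :: 'm set)"
  shows "\<exists>F \<in> BF TYPE('m). \<exists>f. iso_arr (module_category DB TYPE('m)) (fobj (evaluation G) F) M f"
proof -
  obtain \<rho> :: "'g monoid \<Rightarrow> (('c, 'g, 'g) kburnside \<Rightarrow> 'm) \<Rightarrow> 'm" where \<rho>: "\<And>H. H \<in> Ob \<Longrightarrow> inj_on (\<rho> H) (carrier (fobj E H))"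
    using E_inj[OF inf] by metis
  \<comment> \<open>For injective \<open>\<rho>\<close> the congruence conditions are trivial;
    \<open>Q\<close> is a copy of \<open>E\<close> with values in \<open>'m\<close>.\<close>
  interpret functor_congruence k G E \<rho>
  proof (intro functor_congruence.intro functor_congruence_axioms.intro)
    fix H assume H: "H \<in> Ob"
    show "module_congruence k (fobj E H) (\<rho> H)"
      using left_module_E[OF H] \<rho>[OF H]
      by (auto simp: module_congruence_def module_congruence_axioms_def inj_on_def)
  next
    fix H K a x x' assume "H \<in> Ob" "x \<in> carrier (fobj E H)" "x' \<in> carrier (fobj E H)" "\<rho> H x = \<rho> H x'"
    then show "\<rho> K (farr E H K a x) = \<rho> K (farr E H K a x')"
      using \<rho> by (auto simp: inj_on_def)
  qed (rule biset_setting_axioms, rule E_BF)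
  define \<sigma> where "\<sigma> = inv_into (carrier (fobj E G)) (\<rho> G)"
  have \<sigma>: "\<sigma> (\<rho> G f) = f" if "f \<in> carrier (fobj E G)" for f
    unfolding \<sigma>_def using \<rho>[OF G_Ob] that by (rule inv_into_f_f)
  \<comment> \<open>\<open>\<sigma>\<close> decodes an element of the copy to an equivariant map,
    which is then evaluated at the identity.\<close>
  define \<tau> where "\<tau> = (\<lambda>s\<in>carrier (fobj Q G). \<sigma> s (kB_id k G))"
  have \<tau>: "\<tau> (\<rho> G f) = f (kB_id k G)" if "f \<in> carrier (fobj E G)" for f
    using that by (simp add: \<tau>_def \<sigma> Q_carrier G_Ob)
  have Q_elim: "\<exists>f \<in> carrier (fobj E G). s = \<rho> G f" if "s \<in> carrier (fobj Q G)" for s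
    using that by (auto simp: Q_carrier G_Ob)
  \<comment> \<open>Since \<open>x\<close> is \<open>x\<close> composed with the identity,
    equivariance determines \<open>f\<close> by its value there. Both the linearity of
    \<open>\<tau>\<close> over the algebra and its injectivity rest on this.\<close>
  have val: "f x = x \<odot>\<^bsub>M\<^esub> f (kB_id k G)" if "f \<in> carrier (fobj E G)" "x \<in> Hom G G" for f x
    using E_comp[OF that(1,2) id_closed[OF G_Ob]] that(2) by (simp add: comp_id G_Ob)
  have "\<tau> \<in> linear_maps DB (fobj (evaluation G) Q) M"
  proof (rule linear_mapsI, unfold evaluation_def Let_def cat_functor.simps module.simps monoid.simps partial_object.simps ring.simps DB_simps)
    show "\<tau> \<in> extensional (carrier (fobj Q G))"
      by (simp add: \<tau>_def)
  next
    fix s assume "s \<in> carrier (fobj Q G)"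
    then show "\<tau> s \<in> carrier M"
      using Q_elim by (force simp: \<tau> E_closed id_closed G_Ob)
  next
    fix s t assume "s \<in> carrier (fobj Q G)" "t \<in> carrier (fobj Q G)"
    then obtain f g where "f \<in> carrier (fobj E G)" "s = \<rho> G f" "g \<in> carrier (fobj E G)" "t = \<rho> G g"
      using Q_elim by blast
    then show "\<tau> (s \<oplus>\<^bsub>fobj Q G\<^esub> t) = \<tau> s \<oplus>\<^bsub>M\<^esub> \<tau> t"
      by (simp add: Q_add G_Ob \<tau> E_add_closed) (simp add: E_simps id_closed G_Ob)
  next
    fix d s assume d: "d \<in> Hom G G" and "s \<in> carrier (fobj Q G)"
    then obtain f where f: "f \<in> carrier (fobj E G)" "s = \<rho> G f"
      using Q_elim by blast
    then show "\<tau> (farr Q G G d s) = d \<odot>\<^bsub>M\<^esub> \<tau> s"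
      using d val[OF f(1) d] by (simp add: Q_arr G_Ob \<tau> E_arr_closed) (simp add: E_simps id_closed comp_id G_Ob)
  qed
  moreover have "bij_betw \<tau> (carrier (fobj Q G)) (carrier M)"
  proof (rule bij_betw_imageI)
    show "inj_on \<tau> (carrier (fobj Q G))"
    proof (rule inj_onI)
      fix s t assume "s \<in> carrier (fobj Q G)" "t \<in> carrier (fobj Q G)" "\<tau> s = \<tau> t"
      then obtain f g where fg: "f \<in> carrier (fobj E G)" "s = \<rho> G f" "g \<in> carrier (fobj E G)" "t = \<rho> G g"
        and eq: "f (kB_id k G) = g (kB_id k G)"
        using Q_elim by (metis \<tau>)
      have "f = g"
        using val[OF fg(1)] val[OF fg(3)] eq by (intro E_eqI[OF fg(1,3)]) simp
      then show "s = t"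
        using fg by simp
    qed
    have "m \<in> \<tau> ` carrier (fobj Q G)" if m: "m \<in> carrier M" for m
    proof -
      \<comment> \<open>The preimage of \<open>m\<close> is the linear map on the regular module
        that sends the identity to \<open>m\<close>.\<close>
      define f where "f = (\<lambda>x\<in>Hom G G. x \<odot>\<^bsub>M\<^esub> m)"
      have f: "f \<in> carrier (fobj E G)"
        using m M.smult_closed M.smult_l_distr M.smult_assoc by (simp add: E_carrier f_def DB_simps comp_closed G_Ob)
      have "\<tau> (\<rho> G f) = m"
        unfolding \<tau>[OF f] using M.smult_one[OF m] id_closed[OF G_Ob] by (simp add: f_def DB_simps)
      then show ?thesis
        using f by (force simp: Q_carrier G_Ob)
    qed
    moreover have "\<tau> ` carrier (fobj Q G) \<subseteq> carrier M"
      using Q_elim by (force simp: \<tau> E_closed id_closed G_Ob)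
    ultimately show "\<tau> ` carrier (fobj Q G) = carrier M"
      by blast
  qed
  then have "bij_betw \<tau> (carrier (fobj (evaluation G) Q)) (carrier M)"
    by (simp add: evaluation_def Let_def)
  ultimately have "iso_arr (module_category DB TYPE('m)) (fobj (evaluation G) Q) M \<tau>"
    using left_module_evaluation[OF Q_BF] M by (intro iso_arr_module_category)
  then show ?thesis
    using Q_BF by blast
qed

end

lemma evaluation_equivalence:
  assumes inf: "infinite (UNIV :: 'm set)"
  shows "equivalence_of_categories (BFC TYPE('m)) (module_category DB TYPE('m)) (evaluation G)"
proof (rule equivalence_of_categoriesI[OF cat_BF cat_module_category is_functor_evaluation])
  fix F F' assume F: "F \<in> BF TYPE('m)" "F' \<in> BF TYPE('m)"
  have ev: "farr (evaluation G) F F' = (\<lambda>\<eta>. \<eta> G)"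
    by (simp add: evaluation_def)
  show "bij_betw (farr (evaluation G) F F') (arr (BFC TYPE('m)) F F')
      (arr (module_category DB TYPE('m)) (fobj (evaluation G) F) (fobj (evaluation G) F'))"
  proof (rule bij_betw_imageI)
    show "inj_on (farr (evaluation G) F F') (arr (BFC TYPE('m)) F F')"
      unfolding ev by (rule inj_onI) (rule evaluation_faithful[OF F(2) _ _ F(1)])
    have "farr (evaluation G) F F' ` arr (BFC TYPE('m)) F F'
        \<subseteq> arr (module_category DB TYPE('m)) (fobj (evaluation G) F) (fobj (evaluation G) F')"
      using is_functor_evaluation[where 'm = 'm] F unfolding is_functor_def by blast
    moreover have "arr (module_category DB TYPE('m)) (fobj (evaluation G) F) (fobj (evaluation G) F')
        \<subseteq> farr (evaluation G) F F' ` arr (BFC TYPE('m)) F F'"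
      unfolding ev using evaluation_full[OF F] by (force simp: module_category_def)
    ultimately show "farr (evaluation G) F F' ` arr (BFC TYPE('m)) F F' =
        arr (module_category DB TYPE('m)) (fobj (evaluation G) F) (fobj (evaluation G) F')"
      by blast
  qed
next
  fix M :: "(('c, 'g, 'g) kburnside, 'm) module"
  assume "M \<in> obj (module_category DB TYPE('m))"
  then show "\<exists>F \<in> BF TYPE('m). \<exists>f. iso_arr (module_category DB TYPE('m)) (fobj (evaluation G) F) M f"
    using evaluation_essentially_surjective[OF _ inf] by (simp add: module_category_def)
qed

end

theorem theorem4p7:
  fixes k :: "'c ring" and G :: "'g monoid"
  assumes "field k"
    and "group G" and "finite (carrier G)"
    and "infinite (UNIV :: 'm set)" and "carrier k \<lesssim> (UNIV :: 'm set)"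
  shows "non_vanishing k G TYPE('m) \<longleftrightarrow>
    equivalence_of_categories
      (biset_functor_category k G TYPE('m))
      (module_category (double_burnside_algebra k G) TYPE('m))
      (evaluation G)"
proof
  interpret biset_setting k G
    using assms(1-3) by (simp add: biset_setting_def field_def domain_def)
  show "equivalence_of_categories (BFC TYPE('m)) (module_category DB TYPE('m)) (evaluation G)"
    if "non_vanishing k G TYPE('m)"
  proof -
    interpret generated k G
      using non_vanishing_imp_through[OF that assms(4,5)] by unfold_locales
    show ?thesis
      using assms(4) by (rule evaluation_equivalence)
  qed
  show "non_vanishing k G TYPE('m)"
    if "equivalence_of_categories (BFC TYPE('m)) (module_category DB TYPE('m)) (evaluation G)"
    using that by (rule equivalence_imp_non_vanishing)
qed

end
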